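(* Let $d \ge 1$, let $0<\lambda\le\Lambda$, and let $F$ be uniformly elliptic with constants $\lambda,\Lambda$. There is no continuous function $u : Q_1 \to \mathbb R$ such that all of the following hold: $u$ is a viscosity solution of $u_t - F(D^2 u) = 0$ in $Q_1$; $u$ is real analytic in $(t,x)$ on $Q_1 \setminus \{(0,0)\}$ (at points with $t=0$ this means $u$ coincides near the point with a real-analytic function of $(t,x)$ defined in a full neighborhood); the function $x \mapsto u(0,x)$ is homogeneous of degree two on $B_1$ (i.e. $u(0,ax) = a^2 u(0,x)$ whenever $a>0$ and $x, ax \in B_1$); and $x\mapsto u(0,x)$ is not $C^2$ in any neighborhood of $x=0$.
   Context: $B_1$ is the open unit ball of $\mathbb R^d$ and $Q_1 := (-1,0] \times B_1$. A function $F$ on real symmetric $d\times d$ matrices is uniformly elliptic with constants $0<\lambda\le\Lambda$ if for all symmetric $A,B$ with $B \ge 0$, $\lambda \operatorname{tr} B \le F(A+B) - F(A) \le \Lambda \operatorname{tr} B$. $D^2u$ denotes the spatial Hessian. *)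

theory Defs
  imports "HOL-Analysis.Analysis"
begin

definition Q1 :: "(real \<times> (real^'n)) set" where
  "Q1 = {-1<..0} \<times> ball 0 1"

definition symmetric_mat :: "real^'n^'n \<Rightarrow> bool" where
  "symmetric_mat A \<longleftrightarrow> transpose A = A"

definition psd_mat :: "real^'n^'n \<Rightarrow> bool" where
  "psd_mat B \<longleftrightarrow> (\<forall>\<xi>. \<xi> \<bullet> (B *v \<xi>) \<ge> 0)"

definition uniformly_elliptic :: "real \<Rightarrow> real \<Rightarrow> (real^'n^'n \<Rightarrow> real) \<Rightarrow> bool" where
  "uniformly_elliptic lam Lam F \<longleftrightarrow>
     (\<forall>A B. symmetric_mat A \<and> symmetric_mat B \<and> psd_mat B \<longrightarrow>
        lam * trace B \<le> F (A + B) - F A \<and> F (A + B) - F A \<le> Lam * trace B)"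

definition C2_on :: "(real^'n) set \<Rightarrow> (real^'n \<Rightarrow> real) \<Rightarrow> bool" where
  "C2_on S f \<longleftrightarrow> (\<exists>g h.
     continuous_on S f \<and> (\<forall>i. continuous_on S (g i)) \<and> (\<forall>i j. continuous_on S (h i j)) \<and>
     (\<forall>x\<in>S. \<forall>i. ((\<lambda>s. f (x + s *\<^sub>R axis i 1)) has_real_derivative g i x) (at 0)) \<and>
     (\<forall>x\<in>S. \<forall>i j. ((\<lambda>s. g i (x + s *\<^sub>R axis j 1)) has_real_derivative h i j x) (at 0)))"

definition C12_test :: "(real \<times> (real^'n) \<Rightarrow> real) \<Rightarrow> (real \<times> (real^'n) \<Rightarrow> real)
     \<Rightarrow> ('n \<Rightarrow> 'n \<Rightarrow> real \<times> (real^'n) \<Rightarrow> real) \<Rightarrow> bool" where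
  "C12_test phi phit h \<longleftrightarrow> (\<exists>g.
     continuous_on UNIV phi \<and> continuous_on UNIV phit \<and> (\<forall>i. continuous_on UNIV (g i)) \<and>
     (\<forall>i j. continuous_on UNIV (h i j)) \<and>
     (\<forall>t x. ((\<lambda>s. phi (t + s, x)) has_real_derivative phit (t, x)) (at 0)) \<and>
     (\<forall>t x i. ((\<lambda>s. phi (t, x + s *\<^sub>R axis i 1)) has_real_derivative g i (t, x)) (at 0)) \<and>
     (\<forall>t x i j. ((\<lambda>s. g i (t, x + s *\<^sub>R axis j 1)) has_real_derivative h i j (t, x)) (at 0)))"

definition hess_mat :: "('n \<Rightarrow> 'n \<Rightarrow> real \<times> (real^'n) \<Rightarrow> real) \<Rightarrow> real \<times> (real^'n) \<Rightarrow> real^'n^'n" where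
  "hess_mat h p = (\<chi> i j. h i j p)"

definition viscosity_subsolution ::
  "(real^'n^'n \<Rightarrow> real) \<Rightarrow> (real \<times> (real^'n)) set \<Rightarrow> (real \<times> (real^'n) \<Rightarrow> real) \<Rightarrow> bool" where
  "viscosity_subsolution F Q u \<longleftrightarrow>
     (\<forall>p0\<in>Q. \<forall>phi phit h. C12_test phi phit h \<and>
        (\<exists>r>0. \<forall>q\<in>Q. dist q p0 < r \<longrightarrow> u q - phi q \<le> u p0 - phi p0)
        \<longrightarrow> phit p0 - F (hess_mat h p0) \<le> 0)"

definition viscosity_supersolution ::
  "(real^'n^'n \<Rightarrow> real) \<Rightarrow> (real \<times> (real^'n)) set \<Rightarrow> (real \<times> (real^'n) \<Rightarrow> real) \<Rightarrow> bool" where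
  "viscosity_supersolution F Q u \<longleftrightarrow>
     (\<forall>p0\<in>Q. \<forall>phi phit h. C12_test phi phit h \<and>
        (\<exists>r>0. \<forall>q\<in>Q. dist q p0 < r \<longrightarrow> u q - phi q \<ge> u p0 - phi p0)
        \<longrightarrow> phit p0 - F (hess_mat h p0) \<ge> 0)"

definition viscosity_solution ::
  "(real^'n^'n \<Rightarrow> real) \<Rightarrow> (real \<times> (real^'n)) set \<Rightarrow> (real \<times> (real^'n) \<Rightarrow> real) \<Rightarrow> bool" where
  "viscosity_solution F Q u \<longleftrightarrow>
     continuous_on Q u \<and> viscosity_subsolution F Q u \<and> viscosity_supersolution F Q u"

definition real_analytic_at :: "(real \<times> (real^'n) \<Rightarrow> real) \<Rightarrow> real \<times> (real^'n) \<Rightarrow> bool" where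
  "real_analytic_at g p \<longleftrightarrow> (\<exists>r>0. \<exists>c :: nat \<times> ('n \<Rightarrow> nat) \<Rightarrow> real. \<forall>q. dist q p < r \<longrightarrow>
     ((\<lambda>(k, \<alpha>). c (k, \<alpha>) * (fst q - fst p) ^ k * (\<Prod>i\<in>UNIV. (snd q $ i - snd p $ i) ^ \<alpha> i))
        has_sum g q) UNIV)"

definition real_analytic_on :: "(real \<times> (real^'n) \<Rightarrow> real) \<Rightarrow> (real \<times> (real^'n)) set \<Rightarrow> bool" where
  "real_analytic_on g U \<longleftrightarrow> (\<forall>p\<in>U. real_analytic_at g p)"

end

theory Submission
  imports Defs
begin

text \<open>
  Away from the origin a viscosity solution that is analytic solves the equation classically. The
  terminal datum determines all Taylor coefficients in \<open>t\<close>: as \<open>F\<close> is Lipschitz, two solutions whose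
  coefficients agree below order \<open>k\<close> have Hessians differing by \<open>O(t\<^sup>k)\<close>, hence time derivatives
  differing by \<open>O(t\<^sup>k)\<close>, hence equal \<open>k\<close>-th coefficients. Applied to \<open>u\<close> and its parabolic rescalings,
  this makes \<open>u\<close> parabolically homogeneous of degree two, so \<open>u\<close> extends to all \<open>t \<le> 0\<close> and
  \<open>W(y) = u\<^sub>t(-1,y)\<close> is bounded on the whole space. Differentiating the equation in time shows that \<open>W\<close>
  satisfies an elliptic equation with inward drift \<open>- y/2\<close> and no zeroth-order term; the strong maximum
  principle, with barrier \<open>exp (-\<alpha> |y - y\<^sub>0|\<^sup>2)\<close> and the growing function \<open>|y|\<^sup>2\<close> controlling infinity,
  forces \<open>W\<close> to be constant. Hence \<open>u(t,x) = u(0,x) + c t\<close>, so \<open>u(0,\<cdot>)\<close> is analytic at the origin and,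
  being homogeneous of degree two, a quadratic form.
\<close>

subsection \<open>One-variable power series\<close>

text \<open>Solving from \<open>t = 0\<close> into the past is ill-posed, and \<open>F\<close>
  cannot be differentiated, so neither a well-posedness theory nor a recursion for the coefficients
  is at hand. Comparing two analytic solutions order by order asks only for the size of the Hessian
  difference. The elliptic part is shaped by the same obstacle: no linear equation for
  \<open>W\<close> is written down, and difference quotients in time yield one-sided inequalities,
  which suffice for a maximum principle. The zeroth-order term is absent because the time derivative
  of a function of parabolic degree two has degree zero; at \<open>t = -1\<close> Euler's relation
  turns \<open>2 * W_t\<close> into \<open>y . grad W\<close>, which is the drift. \<open>W\<close>
  is bounded because large \<open>y\<close> correspond to points near \<open>t = 0\<close> away from
  the origin, where \<open>u\<close> is analytic up to the terminal time. Spatial derivatives are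
  read off from homogeneous parts of Taylor expansions, and summable majorants of these parts make
  all remainders uniform.\<close>

lemma le_0_if_le_small:
  fixes c C :: real
  assumes "0 < \<delta>" "\<And>s. 0 < s \<Longrightarrow> s < \<delta> \<Longrightarrow> c \<le> C * s"
  shows "c \<le> 0"
proof -
  have "((\<lambda>s. C * s) \<longlongrightarrow> C * 0) (at_right 0)" by (intro tendsto_intros)
  moreover have "\<forall>\<^sub>F s in at_right 0. c \<le> C * s"
    using assms by (auto simp: eventually_at_right_field intro!: exI[of _ \<delta>])
  ultimately have "c \<le> C * 0" by (intro tendsto_le[OF _ _ tendsto_const]) auto
  then show ?thesis by simp
qed

lemma small_scale:
  fixes x :: "'a::real_normed_vector"
  assumes "0 < \<rho>"
  shows "0 < \<rho> / (1 + norm x)" "0 < s \<Longrightarrow> s < \<rho> / (1 + norm x) \<Longrightarrow> \<bar>s\<bar> * norm x < \<rho>"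
proof -
  have pos: "0 < 1 + norm x" by (simp add: add_pos_nonneg)
  then show "0 < \<rho> / (1 + norm x)" using assms by simp
  assume s: "0 < s" "s < \<rho> / (1 + norm x)"
  then have lt: "s * (1 + norm x) < \<rho>" using pos by (simp add: pos_less_divide_eq)
  have "s * norm x \<le> s * (1 + norm x)" using s by (intro mult_left_mono) auto
  from order_le_less_trans[OF this lt] show "\<bar>s\<bar> * norm x < \<rho>" using s by simp
qed

text \<open>For \<open>r \<le> \<rho>\<close> every term of index at least \<open>K\<close> gains
  the factor \<open>(r / \<rho>) ^ K\<close> over its bound at \<open>\<rho>\<close>. The constant
  in front does not depend on \<open>r\<close>, so this is a remainder of order
  \<open>r ^ K\<close>, uniform in everything that the majorant \<open>B\<close> controls.\<close>

lemma series_tail_bound: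
  fixes g B :: "nat \<Rightarrow> real"
  assumes "0 < \<rho>" "0 \<le> r" "r \<le> \<rho>" and B: "summable (\<lambda>k. B k * \<rho> ^ k)" "\<And>k. 0 \<le> B k"
    and g: "\<And>k. \<bar>g k\<bar> \<le> B k * r ^ k" "g sums v"
  shows "\<bar>v - (\<Sum>k<K. g k)\<bar> \<le> (\<Sum>k. B k * \<rho> ^ k) * (r / \<rho>) ^ K"
proof -
  have sg: "summable g" and v: "v = suminf g" using g(2) by (auto simp: sums_iff)
  have bd: "\<bar>g (k + K)\<bar> \<le> B (k + K) * \<rho> ^ (k + K) * (r / \<rho>) ^ K" for k
  proof -
    have "r ^ k * r ^ K \<le> \<rho> ^ k * r ^ K"
      using assms by (intro mult_right_mono power_mono) auto
    also have "\<dots> = \<rho> ^ (k + K) * (r / \<rho>) ^ K"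
      using assms(1) by (simp add: power_add power_divide)
    finally have "r ^ (k + K) \<le> \<rho> ^ (k + K) * (r / \<rho>) ^ K" by (simp add: power_add)
    then have "B (k + K) * r ^ (k + K) \<le> B (k + K) * (\<rho> ^ (k + K) * (r / \<rho>) ^ K)"
      using B(2) by (intro mult_left_mono) auto
    then show ?thesis using g(1)[of "k + K"] by (simp add: mult.assoc)
  qed
  have sB: "summable (\<lambda>k. B (k + K) * \<rho> ^ (k + K))"
    using B(1) by (rule summable_ignore_initial_segment)
  have "v - (\<Sum>k<K. g k) = (\<Sum>k. g (k + K))"
    unfolding v by (rule suminf_minus_initial_segment[symmetric, OF sg])
  also have "\<bar>\<dots>\<bar> \<le> (\<Sum>k. B (k + K) * \<rho> ^ (k + K) * (r / \<rho>) ^ K)"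
    using norm_suminf_le[of "\<lambda>k. g (k + K)", OF _ summable_mult2[OF sB]] bd by simp
  also have "\<dots> = (\<Sum>k. B (k + K) * \<rho> ^ (k + K)) * (r / \<rho>) ^ K"
    by (rule suminf_mult2[symmetric, OF sB])
  also have "(\<Sum>k. B (k + K) * \<rho> ^ (k + K)) \<le> (\<Sum>k. B k * \<rho> ^ k)"
  proof -
    have "0 \<le> (\<Sum>k<K. B k * \<rho> ^ k)" using assms by (intro sum_nonneg) auto
    then show ?thesis using suminf_split_initial_segment[OF B(1), of K] by simp
  qed
  finally show ?thesis using assms by (simp add: mult_right_mono)
qed

text \<open>Values on one side of 0 suffice; this matters because at \<open>t = 0\<close> only the
  past is available. The first coefficient not yet known to vanish contributes order
  \<open>s ^ K\<close>, whereas the tail after it is of order \<open>s ^ Suc K\<close>.\<close>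

lemma powser_zero_right:
  fixes h :: "nat \<Rightarrow> real"
  assumes "0 < \<delta>" and h: "\<And>s. 0 < s \<Longrightarrow> s < \<delta> \<Longrightarrow> (\<lambda>k. h k * s ^ k) sums 0"
  shows "h k = 0"
proof (induction k rule: less_induct)
  case (less K)
  define \<rho> where "\<rho> = \<delta> / 2"
  have \<rho>: "0 < \<rho>" "\<rho> < \<delta>" using assms(1) by (auto simp: \<rho>_def)
  \<comment> \<open>Plain convergence at a point strictly between \<open>\<rho>\<close> and
    \<open>\<delta>\<close> gives absolute convergence at \<open>\<rho>\<close>.\<close>
  have "summable (\<lambda>k. h k * (3 * \<delta> / 4) ^ k)" using h[of "3 * \<delta> / 4"] \<open>0 < \<delta>\<close> by (auto simp: sums_iff)
  from powser_insidea[OF this, of \<rho>] have "summable (\<lambda>k. norm (h k * \<rho> ^ k))"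
    using \<open>0 < \<delta>\<close> by (simp add: \<rho>_def)
  then have sm: "summable (\<lambda>k. \<bar>h k\<bar> * \<rho> ^ k)"
    using \<rho> by (simp add: abs_mult power_abs)
  define M where "M = (\<Sum>k. \<bar>h k\<bar> * \<rho> ^ k)"
  have "\<bar>h K\<bar> * s ^ K \<le> M * (s / \<rho>) ^ Suc K" if s: "0 < s" "s \<le> \<rho>" for s
  proof -
    have "\<bar>0 - (\<Sum>k<Suc K. h k * s ^ k)\<bar> \<le> M * (s / \<rho>) ^ Suc K"
      unfolding M_def using s \<rho> sm h[of s]
      by (intro series_tail_bound) (auto simp: abs_mult)
    moreover have "(\<Sum>k<Suc K. h k * s ^ k) = h K * s ^ K"
      using less.IH by simp
    ultimately show ?thesis using s by (simp add: abs_mult del: power_Suc)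
  qed
  note bound = this
  have le: "\<bar>h K\<bar> \<le> M / \<rho> ^ Suc K * s" if s: "0 < s" "s \<le> \<rho>" for s
    using bound[OF s] s(1) \<rho> by (simp add: power_divide field_simps)
  have "\<bar>h K\<bar> \<le> 0" by (rule le_0_if_le_small[OF \<rho>(1) le]) auto
  then show ?case by simp
qed

lemma powser_unique_right:
  fixes f g :: "nat \<Rightarrow> real"
  assumes "0 < \<delta>" and "\<And>s. 0 < s \<Longrightarrow> s < \<delta> \<Longrightarrow> (\<lambda>k. f k * s ^ k) sums v s"
    and "\<And>s. 0 < s \<Longrightarrow> s < \<delta> \<Longrightarrow> (\<lambda>k. g k * s ^ k) sums v s"
  shows "f k = g k"
proof -
  have "(\<lambda>k. (f k - g k) * s ^ k) sums 0" if "0 < s" "s < \<delta>" for s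
    using sums_diff[OF assms(2,3), OF that that] by (simp add: algebra_simps)
  from powser_zero_right[OF assms(1), of "\<lambda>k. f k - g k", OF this] show ?thesis by simp
qed

lemma powser_unique_left:
  fixes f g :: "nat \<Rightarrow> real"
  assumes "0 < \<delta>" and "\<And>s. - \<delta> < s \<Longrightarrow> s < 0 \<Longrightarrow> (\<lambda>k. f k * s ^ k) sums v s"
    and "\<And>s. - \<delta> < s \<Longrightarrow> s < 0 \<Longrightarrow> (\<lambda>k. g k * s ^ k) sums v s"
  shows "f k = g k"
proof -
  have "f k * (-1) ^ k = g k * (-1) ^ k"
  proof (rule powser_unique_right[OF assms(1), of _ "\<lambda>s. v (- s)"])
    fix s :: real assume s: "0 < s" "s < \<delta>"
    show "(\<lambda>k. f k * (-1) ^ k * s ^ k) sums v (- s)" "(\<lambda>k. g k * (-1) ^ k * s ^ k) sums v (- s)"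
      using assms(2,3)[of "- s"] s by (auto simp: mult.assoc simp flip: power_mult_distrib)
  qed
  then show ?thesis by simp
qed

text \<open>The factor \<open>Suc k\<close> produced by differentiation is at most
  \<open>2 ^ k\<close>, so halving the radius absorbs it.\<close>

lemma summable_diffs_half:
  fixes f :: "nat \<Rightarrow> real"
  assumes "0 < \<rho>" "summable (\<lambda>k. \<bar>f k\<bar> * \<rho> ^ k)"
  shows "summable (\<lambda>k. \<bar>diffs f k\<bar> * (\<rho> / 2) ^ k)"
proof (rule summable_comparison_test)
  have "summable (\<lambda>k. \<bar>f (Suc k)\<bar> * \<rho> ^ Suc k)"
    using assms(2) by (subst summable_Suc_iff)
  then show "summable (\<lambda>k. 1 / \<rho> * (\<bar>f (Suc k)\<bar> * \<rho> ^ Suc k))" by (rule summable_mult)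
  have "\<bar>diffs f k\<bar> * (\<rho> / 2) ^ k \<le> 1 / \<rho> * (\<bar>f (Suc k)\<bar> * \<rho> ^ Suc k)" for k
  proof -
    have "k < 2 ^ k" by (rule less_exp)
    then have "real (Suc k) \<le> real (2 ^ k)" by (simp only: of_nat_le_iff) 
    then have "real (Suc k) / 2 ^ k \<le> 1" by simp
    then have "real (Suc k) / 2 ^ k * (\<bar>f (Suc k)\<bar> * \<rho> ^ k) \<le> 1 * (\<bar>f (Suc k)\<bar> * \<rho> ^ k)"
      using assms(1) by (intro mult_right_mono) auto
    then show ?thesis using assms(1)
      by (simp add: diffs_def abs_mult power_divide field_simps del: of_nat_Suc)
  qed
  then show "\<exists>N. \<forall>n\<ge>N. norm (\<bar>diffs f n\<bar> * (\<rho> / 2) ^ n) \<le> 1 / \<rho> * (\<bar>f (Suc n)\<bar> * \<rho> ^ Suc n)"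
    using assms(1) by (auto simp: abs_mult)
qed

text \<open>The series has to represent \<open>v\<close> only on the open set \<open>U\<close>: an
  expansion centred at a negative time \<open>t\<close> describes \<open>u\<close> only up to time
  0.\<close>

lemma DERIV_powser:
  fixes f :: "nat \<Rightarrow> real"
  assumes "0 < \<rho>" "summable (\<lambda>k. \<bar>f k\<bar> * \<rho> ^ k)" "\<bar>\<tau>\<bar> < \<rho>"
    and U: "open U" "\<tau> \<in> U" "\<And>s. s \<in> U \<Longrightarrow> \<bar>s\<bar> < \<rho> \<Longrightarrow> (\<lambda>k. f k * s ^ k) sums v s"
  shows "(v has_real_derivative (\<Sum>k. diffs f k * \<tau> ^ k)) (at \<tau>)"
proof -
  have "summable (\<lambda>k. norm (f k * \<rho> ^ k))"
    using assms(1,2) by (simp add: abs_mult)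
  then have sm: "summable (\<lambda>k. f k * \<rho> ^ k)" by (rule summable_norm_cancel)
  have D: "((\<lambda>s. \<Sum>k. f k * s ^ k) has_real_derivative (\<Sum>k. diffs f k * \<tau> ^ k)) (at \<tau>)"
    using termdiffs_strong[OF sm, of \<tau>] assms(1,3) by simp
  show ?thesis
  proof (rule has_field_derivative_transform_within_open[OF D])
    show "open (U \<inter> {-\<rho><..<\<rho>})" using U(1) by auto
    show "\<tau> \<in> U \<inter> {-\<rho><..<\<rho>}" using U(2) assms(3) by auto
    show "(\<Sum>k. f k * s ^ k) = v s" if "s \<in> U \<inter> {-\<rho><..<\<rho>}" for s
      using U(3)[of s] that by (auto simp: sums_iff)
  qed
qed

subsection \<open>Expansions of analytic functions by degree in space\<close>

text \<open>
  In \<open>jet u p \<rho> a A\<close>, the function \<open>a k n\<close> is the part of the Taylor series at \<open>p\<close> of degree \<open>k\<close> in time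
  and homogeneous degree \<open>n\<close> in space. The expansion is only required for nonpositive times, so at \<open>t = 0\<close>
  it sees \<open>u\<close> and not the analytic continuation. The spatial Hessian at \<open>p\<close> is twice the matrix of the
  quadratic form \<open>a 0 2\<close>.
\<close>

definition jet :: "(real \<times> (real^'n) \<Rightarrow> real) \<Rightarrow> real \<times> (real^'n) \<Rightarrow> real
    \<Rightarrow> (nat \<Rightarrow> nat \<Rightarrow> real^'n \<Rightarrow> real) \<Rightarrow> (nat \<Rightarrow> nat \<Rightarrow> real) \<Rightarrow> bool" where
  "jet u p \<rho> a A \<longleftrightarrow> 0 < \<rho> \<and>
     (\<lambda>(k, n). A k n * \<rho> ^ (k + n)) summable_on UNIV \<and>
     (\<forall>k n. 0 \<le> A k n) \<and>
     (\<forall>k n x. \<bar>a k n x\<bar> \<le> A k n * norm x ^ n) \<and>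
     (\<forall>k n s x. a k n (s *\<^sub>R x) = s ^ n * a k n x) \<and>
     (\<forall>k. \<exists>b. \<forall>x. a k 1 x = b \<bullet> x) \<and>
     (\<forall>k. \<exists>H. symmetric_mat H \<and> (\<forall>x. a k 2 x = x \<bullet> (H *v x))) \<and>
     (\<forall>\<tau> x. \<bar>\<tau>\<bar> \<le> \<rho> \<longrightarrow> norm x \<le> \<rho> \<longrightarrow> fst p + \<tau> \<le> 0 \<longrightarrow>
        ((\<lambda>(k, n). a k n x * \<tau> ^ k) has_sum u (fst p + \<tau>, snd p + x)) UNIV)"

section \<open>Linear and quadratic parts from multi-indices\<close>

lemma finite_multiindices: "finite {\<alpha> :: 'n::finite \<Rightarrow> nat. sum \<alpha> UNIV = n}"
proof (rule finite_subset)
  show "{\<alpha> :: 'n \<Rightarrow> nat. sum \<alpha> UNIV = n} \<subseteq> PiE UNIV (\<lambda>_. {..n})"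
    by (auto intro: member_le_sum)
qed (intro finite_PiE; simp)

lemma monomial_Suc:
  fixes \<alpha> :: "'n::finite \<Rightarrow> nat"
  assumes "sum \<alpha> UNIV = Suc n"
  obtains i \<beta> where "sum \<beta> UNIV = n"
    "\<And>x :: real^'n. (\<Prod>i\<in>UNIV. x $ i ^ \<alpha> i) = x $ i * (\<Prod>i\<in>UNIV. x $ i ^ \<beta> i)"
proof -
  have "\<exists>i. \<alpha> i \<noteq> 0" using assms by (metis sum.neutral nat.distinct(1))
  then obtain i where i: "\<alpha> i \<noteq> 0" by blast
  define \<beta> where "\<beta> = \<alpha>(i := \<alpha> i - 1)"
  have "sum \<alpha> UNIV = \<alpha> i + sum \<alpha> (UNIV - {i})" "sum \<beta> UNIV = \<beta> i + sum \<beta> (UNIV - {i})"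
    by (auto intro: sum.remove)
  moreover have "sum \<beta> (UNIV - {i}) = sum \<alpha> (UNIV - {i})"
    by (intro sum.cong) (auto simp: \<beta>_def)
  ultimately have 1: "sum \<beta> UNIV = n" using assms i by (simp add: \<beta>_def)
  have 2: "(\<Prod>i\<in>UNIV. x $ i ^ \<alpha> i) = x $ i * (\<Prod>i\<in>UNIV. x $ i ^ \<beta> i)" for x :: "real^'n"
  proof -
    have "(\<Prod>i\<in>UNIV. x $ i ^ \<alpha> i) = x $ i ^ \<alpha> i * (\<Prod>i\<in>UNIV - {i}. x $ i ^ \<alpha> i)"
      "(\<Prod>i\<in>UNIV. x $ i ^ \<beta> i) = x $ i ^ \<beta> i * (\<Prod>i\<in>UNIV - {i}. x $ i ^ \<beta> i)"
      by (auto intro: prod.remove)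
    moreover have "(\<Prod>i\<in>UNIV - {i}. x $ i ^ \<beta> i) = (\<Prod>i\<in>UNIV - {i}. x $ i ^ \<alpha> i)"
      by (intro prod.cong) (auto simp: \<beta>_def)
    moreover have "x $ i ^ \<alpha> i = x $ i * x $ i ^ \<beta> i"
      using i by (cases "\<alpha> i") (auto simp: \<beta>_def)
    ultimately show ?thesis by simp
  qed
  show ?thesis using that[OF 1 2] .
qed

lemma monomial_0:
  fixes \<alpha> :: "'n::finite \<Rightarrow> nat" and x :: "real^'n"
  assumes "sum \<alpha> UNIV = 0"
  shows "(\<Prod>i\<in>UNIV. x $ i ^ \<alpha> i) = 1"
  using assms by simp

lemma linear_monomial:
  fixes \<alpha> :: "'n::finite \<Rightarrow> nat"
  assumes "sum \<alpha> UNIV = 1"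
  shows "\<exists>b. \<forall>x :: real^'n. (\<Prod>i\<in>UNIV. x $ i ^ \<alpha> i) = b \<bullet> x"
proof -
  obtain i and \<beta> :: "'n \<Rightarrow> nat" where \<beta>: "sum \<beta> UNIV = 0"
    and eq: "\<And>x :: real^'n. (\<Prod>i\<in>UNIV. x $ i ^ \<alpha> i) = x $ i * (\<Prod>i\<in>UNIV. x $ i ^ \<beta> i)"
    by (rule monomial_Suc[of \<alpha> 0]) (use assms in simp, blast)
  show ?thesis unfolding eq monomial_0[OF \<beta>]
    by (rule exI[of _ "axis i 1"]) (simp add: inner_axis')
qed

lemma quadratic_monomial:
  fixes \<alpha> :: "'n::finite \<Rightarrow> nat"
  assumes "sum \<alpha> UNIV = 2"
  shows "\<exists>H. symmetric_mat H \<and> (\<forall>x :: real^'n. (\<Prod>i\<in>UNIV. x $ i ^ \<alpha> i) = x \<bullet> (H *v x))"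
proof -
  obtain i and \<beta> :: "'n \<Rightarrow> nat" where \<beta>: "sum \<beta> UNIV = 1"
    and eq: "\<And>x :: real^'n. (\<Prod>i\<in>UNIV. x $ i ^ \<alpha> i) = x $ i * (\<Prod>i\<in>UNIV. x $ i ^ \<beta> i)"
    by (rule monomial_Suc[of \<alpha> 1]) (use assms in simp, blast)
  obtain b where b: "\<And>x :: real^'n. (\<Prod>i\<in>UNIV. x $ i ^ \<beta> i) = b \<bullet> x"
    using linear_monomial[OF \<beta>] by blast
  \<comment> \<open>The symmetrised product of the linear forms \<open>x $ i\<close> and
    \<open>b \<bullet> x\<close>.\<close>
  define H :: "real^'n^'n" where
    "H = (\<chi> k l. (axis i 1 $ k * b $ l + b $ k * axis i 1 $ l) / 2)"
  have "symmetric_mat H" by (simp add: H_def symmetric_mat_def transpose_def vec_eq_iff)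
  moreover have "x \<bullet> (H *v x) = x $ i * (b \<bullet> x)" for x
  proof -
    have Hx: "H *v x = ((b \<bullet> x) / 2) *\<^sub>R axis i 1 + (x $ i / 2) *\<^sub>R b"
    proof (subst vec_eq_iff, rule allI)
      fix k
      have "(H *v x) $ k = (\<Sum>l\<in>UNIV. axis i 1 $ k / 2 * (b $ l * x $ l) + b $ k / 2 * (axis i 1 $ l * x $ l))"
        by (simp add: matrix_vector_mult_def H_def field_simps)
      also have "\<dots> = axis i 1 $ k / 2 * (b \<bullet> x) + b $ k / 2 * (axis i 1 \<bullet> x)"
        by (simp add: sum.distrib sum_distrib_left inner_vec_def)
      finally show "(H *v x) $ k = (((b \<bullet> x) / 2) *\<^sub>R axis i 1 + (x $ i / 2) *\<^sub>R b) $ k"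
        by (simp add: inner_axis' mult.commute)
    qed
    show ?thesis unfolding Hx by (simp add: inner_add_right inner_axis inner_commute)
  qed
  ultimately show ?thesis unfolding eq b by metis
qed

lemma linear_sum:
  fixes f :: "'a \<Rightarrow> real^'n \<Rightarrow> real"
  assumes "\<And>i. i \<in> I \<Longrightarrow> \<exists>b. \<forall>x. f i x = b \<bullet> x"
  shows "\<exists>b. \<forall>x. (\<Sum>i\<in>I. c i * f i x) = b \<bullet> x"
proof -
  obtain b where "\<And>i x. i \<in> I \<Longrightarrow> f i x = b i \<bullet> x" using assms by metis
  then have "(\<Sum>i\<in>I. c i * f i x) = (\<Sum>i\<in>I. c i *\<^sub>R b i) \<bullet> x" for x
    by (simp add: inner_sum_left)
  then show ?thesis by blast
qed

lemma symmetric_mat_scale: "symmetric_mat H \<Longrightarrow> symmetric_mat (c *\<^sub>R H)"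
  by (simp add: symmetric_mat_def transpose_def vec_eq_iff)

lemma symmetric_mat_add: "symmetric_mat H \<Longrightarrow> symmetric_mat K \<Longrightarrow> symmetric_mat (H + K)"
  by (simp add: symmetric_mat_def transpose_def vec_eq_iff)

lemma symmetric_mat_sum: "(\<And>i. i \<in> I \<Longrightarrow> symmetric_mat (H i)) \<Longrightarrow> symmetric_mat (\<Sum>i\<in>I. H i)"
  by (simp add: symmetric_mat_def transpose_def vec_eq_iff)

lemma sum_matrix_vector_mult: "(\<Sum>i\<in>I. H i) *v x = (\<Sum>i\<in>I. H i *v (x :: real^'n))"
  by (induction I rule: infinite_finite_induct) (auto simp: matrix_vector_mult_add_rdistrib)

lemma quadratic_sum:
  fixes f :: "'a \<Rightarrow> real^'n \<Rightarrow> real"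
  assumes "\<And>i. i \<in> I \<Longrightarrow> \<exists>H. symmetric_mat H \<and> (\<forall>x. f i x = x \<bullet> (H *v x))"
  shows "\<exists>H. symmetric_mat H \<and> (\<forall>x. (\<Sum>i\<in>I. c i * f i x) = x \<bullet> (H *v x))"
proof -
  obtain H where H: "\<And>i. i \<in> I \<Longrightarrow> symmetric_mat (H i)" "\<And>i x. i \<in> I \<Longrightarrow> f i x = x \<bullet> (H i *v x)"
    using assms by metis
  have "(\<Sum>i\<in>I. c i * f i x) = x \<bullet> ((\<Sum>i\<in>I. c i *\<^sub>R H i) *v x)" for x
    by (simp add: H sum_matrix_vector_mult inner_sum_right scaleR_matrix_vector_assoc[symmetric])
  moreover have "symmetric_mat (\<Sum>i\<in>I. c i *\<^sub>R H i)"
    using H by (intro symmetric_mat_sum symmetric_mat_scale)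
  ultimately show ?thesis by blast
qed

lemma dist_shift_le:
  fixes p :: "real \<times> (real^'n)"
  shows "dist (fst p + \<tau>, snd p + x) p \<le> \<bar>\<tau>\<bar> + norm x"
proof -
  have "(fst p + \<tau>, snd p + x) - p = (\<tau>, x)" by (simp add: prod_eq_iff)
  then show ?thesis using norm_Pair_le[of \<tau> x] by (simp add: dist_norm)
qed

lemma has_sum_by_degree:
  fixes f :: "nat \<times> ('n::finite \<Rightarrow> nat) \<Rightarrow> real"
  assumes "(f has_sum v) UNIV"
  shows "((\<lambda>(k, n). \<Sum>\<alpha> | sum \<alpha> UNIV = n. f (k, \<alpha>)) has_sum v) UNIV"
proof -
  let ?S = "Sigma UNIV (\<lambda>(k :: nat, n). {\<alpha> :: 'n \<Rightarrow> nat. sum \<alpha> UNIV = n})"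
  have "(f has_sum v) UNIV \<longleftrightarrow> ((\<lambda>(q, \<alpha>). f (fst q, \<alpha>)) has_sum v) ?S"
    by (rule has_sum_reindex_bij_witness[where i = "\<lambda>(q, \<alpha>). (fst q, \<alpha>)"
          and j = "\<lambda>(k, \<alpha>). ((k, sum \<alpha> UNIV), \<alpha>)"]) auto
  then have 1: "((\<lambda>(q, \<alpha>). f (fst q, \<alpha>)) has_sum v) ?S" using assms by simp
  show ?thesis
  proof (rule has_sum_SigmaD[OF 1])
    fix q :: "nat \<times> nat"
    show "((\<lambda>y. case (q, y) of (q, \<alpha>) \<Rightarrow> f (fst q, \<alpha>)) has_sum
        (case q of (k, n) \<Rightarrow> \<Sum>\<alpha> | sum \<alpha> UNIV = n. f (k, \<alpha>)))
        (case q of (k, n) \<Rightarrow> {\<alpha>. sum \<alpha> UNIV = n})"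
      by (cases q) (auto intro!: has_sum_finiteI finite_multiindices)
  qed
qed

text \<open>The sum over multi-indices is unordered, hence absolutely convergent, so it may be
  grouped by space degree and its absolute values supply the majorant.\<close>

lemma real_analytic_imp_jet:
  fixes g :: "real \<times> (real^'n) \<Rightarrow> real"
  assumes "real_analytic_at g p"
  shows "\<exists>\<rho> a A. jet g p \<rho> a A"
proof -
  obtain r c where r: "r > 0" and c: "\<And>q. dist q p < r \<Longrightarrow>
     ((\<lambda>(k, \<alpha>). c (k, \<alpha>) * (fst q - fst p) ^ k * (\<Prod>i\<in>UNIV. (snd q $ i - snd p $ i) ^ \<alpha> i))
        has_sum g q) UNIV"
    using assms unfolding real_analytic_at_def by blast
  define N where "N = real CARD('n)"
  \<comment> \<open>The majorant is summed at the point displaced by \<open>\<rho>\<close> in time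
    and in each of the \<open>N\<close> space coordinates; its distance from \<open>p\<close> is at
    most \<open>\<rho> + N * \<rho> = r / 2\<close>.\<close>
  define \<rho> where "\<rho> = r / 2 / (1 + N)"
  have N: "N \<ge> 1" by (simp add: N_def Suc_leI)
  have "(1 + N) * \<rho> = r / 2" unfolding \<rho>_def
    by (subst times_divide_eq_right, rule nonzero_mult_div_cancel_left) (use N in simp)
  then have "\<rho> + N * \<rho> = r / 2" by (simp add: distrib_right)
  then have \<rho>: "\<rho> > 0" "\<rho> + N * \<rho> < r" using r N by (auto simp: \<rho>_def)
  define a where "a k n x = (\<Sum>\<alpha> | sum \<alpha> UNIV = n. c (k, \<alpha>) * (\<Prod>i\<in>UNIV. x $ i ^ \<alpha> i))"
    for k n and x :: "real^'n"
  define A where "A k n = (\<Sum>\<alpha> :: 'n \<Rightarrow> nat | sum \<alpha> UNIV = n. \<bar>c (k, \<alpha>)\<bar>)" for k n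
  have hs: "((\<lambda>(k, \<alpha>). c (k, \<alpha>) * \<tau> ^ k * (\<Prod>i\<in>UNIV. x $ i ^ \<alpha> i)) has_sum
      g (fst p + \<tau>, snd p + x)) UNIV" if "\<bar>\<tau>\<bar> + norm x < r" for \<tau> x
    using c[of "(fst p + \<tau>, snd p + x)"] dist_shift_le[of p \<tau> x] that by simp
  have norm_pow: "(\<Prod>i\<in>UNIV. \<bar>x $ i\<bar> ^ \<alpha> i) \<le> norm x ^ n" if "sum \<alpha> UNIV = n"
    for \<alpha> :: "'n \<Rightarrow> nat" and x :: "real^'n" and n
  proof -
    have "(\<Prod>i\<in>UNIV. \<bar>x $ i\<bar> ^ \<alpha> i) \<le> (\<Prod>i\<in>UNIV. norm x ^ \<alpha> i)"
      by (intro prod_mono) (auto intro!: power_mono component_le_norm_cart)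
    also have "\<dots> = norm x ^ sum \<alpha> UNIV" by (simp add: power_sum)
    finally show ?thesis using that by simp
  qed
  show ?thesis
  proof (intro exI)
    show "jet g p \<rho> a A"
      unfolding jet_def
    proof (intro conjI allI impI)
      show "0 < \<rho>" by fact
      have "norm (vec \<rho> :: real^'n) \<le> N * \<rho>"
        using norm_le_l1_cart[of "vec \<rho> :: real^'n"] \<rho> by (simp add: N_def)
      then have "((\<lambda>(k, \<alpha>). c (k, \<alpha>) * \<rho> ^ k * (\<Prod>i\<in>UNIV. (vec \<rho> :: real^'n) $ i ^ \<alpha> i)) has_sum
            g (fst p + \<rho>, snd p + vec \<rho>)) UNIV"
        using \<rho> by (intro hs) auto
      then have "(\<lambda>(k, \<alpha>). c (k, \<alpha>) * \<rho> ^ (k + sum \<alpha> UNIV)) summable_on UNIV"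
        by (auto simp: summable_on_def power_add power_sum mult.assoc)
      then have "(\<lambda>q. norm (case q of (k, \<alpha>) \<Rightarrow> c (k, \<alpha>) * \<rho> ^ (k + sum \<alpha> UNIV))) summable_on UNIV"
        by (rule summable_on_iff_abs_summable_on_real[THEN iffD1])
      then obtain v where
        "((\<lambda>q. norm (case q of (k, \<alpha>) \<Rightarrow> c (k, \<alpha>) * \<rho> ^ (k + sum \<alpha> UNIV))) has_sum v) UNIV"
        by (auto simp: summable_on_def)
      from has_sum_by_degree[OF this]
      have "((\<lambda>(k, n). A k n * \<rho> ^ (k + n)) has_sum v) UNIV"
        using \<rho> by (simp add: A_def abs_mult sum_distrib_right)
      then show "(\<lambda>(k, n). A k n * \<rho> ^ (k + n)) summable_on UNIV"
        by (auto simp: summable_on_def)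
      show "0 \<le> A k n" for k n by (simp add: A_def sum_nonneg)
      show "\<bar>a k n x\<bar> \<le> A k n * norm x ^ n" for k n x
      proof -
        have "\<bar>a k n x\<bar> \<le> (\<Sum>\<alpha> | sum \<alpha> UNIV = n. \<bar>c (k, \<alpha>)\<bar> * (\<Prod>i\<in>UNIV. \<bar>x $ i\<bar> ^ \<alpha> i))"
          unfolding a_def by (rule order_trans[OF sum_abs]) (simp add: abs_mult abs_prod power_abs)
        also have "\<dots> \<le> (\<Sum>\<alpha> :: 'n \<Rightarrow> nat | sum \<alpha> UNIV = n. \<bar>c (k, \<alpha>)\<bar> * norm x ^ n)"
          by (intro sum_mono mult_left_mono norm_pow) auto
        finally show ?thesis by (simp add: A_def sum_distrib_right)
      qed
      show "a k n (s *\<^sub>R x) = s ^ n * a k n x" for k n s x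
        unfolding a_def sum_distrib_left
        by (intro sum.cong) (auto simp: power_mult_distrib prod.distrib power_sum)
      show "\<exists>b. \<forall>x. a k 1 x = b \<bullet> x" for k
        unfolding a_def by (intro linear_sum linear_monomial) auto
      show "\<exists>H. symmetric_mat H \<and> (\<forall>x. a k 2 x = x \<bullet> (H *v x))" for k
        unfolding a_def by (intro quadratic_sum quadratic_monomial) auto
      fix \<tau> :: real and x :: "real^'n"
      assume "\<bar>\<tau>\<bar> \<le> \<rho>" "norm x \<le> \<rho>"
      moreover have "\<rho> \<le> N * \<rho>" using N \<rho>(1) by simp
      ultimately have "\<bar>\<tau>\<bar> + norm x < r" using \<rho> by linarith
      from has_sum_by_degree[OF hs[OF this]]
      show "((\<lambda>(k, n). a k n x * \<tau> ^ k) has_sum g (fst p + \<tau>, snd p + x)) UNIV"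
        by (simp add: a_def sum_distrib_left sum_distrib_right mult_ac)
    qed
  qed
qed

section \<open>Partial sums, derivatives and re-expansion of jets\<close>

lemma jetD:
  assumes "jet u p \<rho> a A"
  shows "0 < \<rho>" "(\<lambda>(k, n). A k n * \<rho> ^ (k + n)) summable_on UNIV" "0 \<le> A k n"
    "\<bar>a k n x\<bar> \<le> A k n * norm x ^ n" "a k n (s *\<^sub>R x) = s ^ n * a k n x"
    "\<exists>b. \<forall>x. a k 1 x = b \<bullet> x"
    "\<exists>H. symmetric_mat H \<and> (\<forall>x. a k 2 x = x \<bullet> (H *v x))"
  using assms unfolding jet_def by blast+

lemma jet_has_sum:
  assumes "jet u (t, y) \<rho> a A" "\<bar>\<tau>\<bar> \<le> \<rho>" "norm x \<le> \<rho>" "t + \<tau> \<le> 0"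
  shows "((\<lambda>(k, n). a k n x * \<tau> ^ k) has_sum u (t + \<tau>, y + x)) UNIV"
  using assms unfolding jet_def by simp

lemma jet_degree_0: "jet u p \<rho> a A \<Longrightarrow> a k 0 x = a k 0 0"
  using jetD(5)[of u p \<rho> a A k 0 0 x] by simp

lemma jet_at_0: "jet u p \<rho> a A \<Longrightarrow> n \<noteq> 0 \<Longrightarrow> a k n 0 = 0"
  using jetD(5)[of u p \<rho> a A k n 0 0] by (simp add: power_0_left)

lemma jet_shrink:
  assumes "jet u p \<rho> a A" "0 < r" "r \<le> \<rho>"
  shows "jet u p r a A"
proof -
  have "(\<lambda>(k, n). A k n * r ^ (k + n)) summable_on UNIV"
    by (rule summable_on_comparison_test[OF jetD(2)[OF assms(1)]])
       (use assms jetD(3)[OF assms(1)] in \<open>auto intro!: mult_left_mono power_mono\<close>)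
  then show ?thesis using assms unfolding jet_def by force
qed

lemma jet_cong:
  assumes "jet u (t, y) \<rho> a A"
    and "\<And>\<tau> x. \<bar>\<tau>\<bar> \<le> \<rho> \<Longrightarrow> norm x \<le> \<rho> \<Longrightarrow> t + \<tau> \<le> 0 \<Longrightarrow> v (t + \<tau>, y + x) = u (t + \<tau>, y + x)"
  shows "jet v (t, y) \<rho> a A"
  using assms unfolding jet_def by simp

text \<open>The double series is summed along one index only. A frozen space displacement yields the
  time series at the displaced point; a frozen time displacement, as in \<open>space_coeff\<close>,
  yields the homogeneous space parts at the displaced time. Moving the centre of a jet reduces to
  these two.\<close>

definition time_coeff :: "(nat \<Rightarrow> nat \<Rightarrow> real^'n \<Rightarrow> real) \<Rightarrow> real^'n \<Rightarrow> nat \<Rightarrow> real" where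
  "time_coeff a x k = (\<Sum>n. a k n x)"

definition space_coeff :: "(nat \<Rightarrow> nat \<Rightarrow> real^'n \<Rightarrow> real) \<Rightarrow> real \<Rightarrow> real^'n \<Rightarrow> nat \<Rightarrow> real" where
  "space_coeff a \<tau> x n = (\<Sum>k. a k n x * \<tau> ^ k)"

lemma jet_summable_degree:
  assumes "jet u p \<rho> a A"
  shows "(\<lambda>n. A k n * \<rho> ^ n) summable_on UNIV"
    and "(\<lambda>k. (\<Sum>n. A k n * \<rho> ^ n) * \<rho> ^ k) summable_on UNIV"
proof -
  note \<rho> = jetD(1)[OF assms]
  have S: "(\<lambda>(k, n). A k n * \<rho> ^ (k + n)) summable_on UNIV \<times> UNIV"
    using jetD(2)[OF assms] by simp
  have 1: "(\<lambda>n. A k n * \<rho> ^ (k + n)) summable_on UNIV" for k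
    using summable_on_SigmaD1[OF S, of k] by simp
  have "(\<lambda>n. 1 / \<rho> ^ k * (A k n * \<rho> ^ (k + n))) summable_on UNIV" for k
    by (rule summable_on_cmult_right[OF 1])
  then show 2: "(\<lambda>n. A k n * \<rho> ^ n) summable_on UNIV" for k
    using \<rho> by (simp add: power_add)
  have "(\<lambda>k. \<Sum>\<^sub>\<infinity>n. A k n * \<rho> ^ (k + n)) summable_on UNIV"
    using summable_on_SigmaD[OF S] 1 by simp
  moreover have "(\<Sum>\<^sub>\<infinity>n. A k n * \<rho> ^ (k + n)) = (\<Sum>n. A k n * \<rho> ^ n) * \<rho> ^ k" for k
  proof -
    have "((\<lambda>n. A k n * \<rho> ^ n * \<rho> ^ k) has_sum (\<Sum>n. A k n * \<rho> ^ n) * \<rho> ^ k) UNIV"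
      using has_sum_imp_sums[OF has_sum_infsum[OF 2]] has_sum_infsum[OF 2, of k]
      by (intro has_sum_cmult_left) (simp add: sums_iff)
    from infsumI[OF this] show ?thesis by (simp add: power_add mult_ac)
  qed
  ultimately show "(\<lambda>k. (\<Sum>n. A k n * \<rho> ^ n) * \<rho> ^ k) summable_on UNIV" by simp
qed

lemma jet_summable_time:
  assumes "jet u p \<rho> a A"
  shows "(\<lambda>k. A k n * \<rho> ^ k) summable_on UNIV"
proof -
  note \<rho> = jetD(1)[OF assms]
  have "(\<lambda>(k, n). A k n * \<rho> ^ (k + n)) summable_on UNIV \<times> UNIV"
    using jetD(2)[OF assms] by simp
  then have S: "(\<lambda>(n, k). A k n * \<rho> ^ (k + n)) summable_on UNIV \<times> UNIV"
    by (subst (asm) summable_on_swap) simp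
  have "(\<lambda>k. A k n * \<rho> ^ (k + n)) summable_on UNIV"
    using summable_on_SigmaD1[OF S, of n] by simp
  then have "(\<lambda>k. 1 / \<rho> ^ n * (A k n * \<rho> ^ (k + n))) summable_on UNIV"
    by (rule summable_on_cmult_right)
  then show ?thesis
    using \<rho> by (simp add: power_add)
qed

lemma summable_on_abs_le:
  fixes f g :: "'a \<Rightarrow> real"
  assumes "g summable_on S" "\<And>x. x \<in> S \<Longrightarrow> \<bar>f x\<bar> \<le> g x"
  shows "f summable_on S"
  by (rule abs_summable_summable, rule Infinite_Sum.abs_summable_on_comparison_test'[OF assms(1)])
     (use assms(2) in simp)

lemma summable_on_imp_has_sum_suminf:
  fixes f :: "nat \<Rightarrow> real"
  assumes "f summable_on UNIV"
  shows "(f has_sum suminf f) UNIV"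
  using has_sum_infsum[OF assms] has_sum_imp_sums[OF has_sum_infsum[OF assms]]
  by (simp add: sums_iff)

lemma jet_time:
  assumes jet: "jet u (t, y) \<rho> a A" and x: "norm x \<le> \<rho>"
  shows "((\<lambda>n. a k n x) has_sum time_coeff a x k) UNIV"
    and "\<bar>time_coeff a x k\<bar> \<le> (\<Sum>n. A k n * \<rho> ^ n)"
    and "summable (\<lambda>k. \<bar>time_coeff a x k\<bar> * \<rho> ^ k)"
    and "\<bar>\<tau>\<bar> \<le> \<rho> \<Longrightarrow> t + \<tau> \<le> 0 \<Longrightarrow> (\<lambda>k. time_coeff a x k * \<tau> ^ k) sums u (t + \<tau>, y + x)"
proof -
  note \<rho> = jetD(1)[OF jet]
  have le: "\<bar>a k n x\<bar> \<le> A k n * \<rho> ^ n" for k n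
    by (rule order_trans[OF jetD(4)[OF jet]]) (use x jetD(3)[OF jet] in \<open>auto intro!: mult_left_mono power_mono\<close>)
  have "(\<lambda>n. a k n x) summable_on UNIV" for k
    by (rule summable_on_abs_le[OF jet_summable_degree(1)[OF jet, of k] le])
  from summable_on_imp_has_sum_suminf[OF this]
  show hs: "((\<lambda>n. a k n x) has_sum time_coeff a x k) UNIV" for k by (simp add: time_coeff_def)
  show le2: "\<bar>time_coeff a x k\<bar> \<le> (\<Sum>n. A k n * \<rho> ^ n)" for k
    unfolding time_coeff_def
    using norm_suminf_le[of "\<lambda>n. a k n x", OF _ summable_on_imp_summable[OF jet_summable_degree(1)[OF jet]]] le
    by simp
  show "summable (\<lambda>k. \<bar>time_coeff a x k\<bar> * \<rho> ^ k)"
    by (rule summable_comparison_test[OF _ summable_on_imp_summable[OF jet_summable_degree(2)[OF jet]]])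
       (use le2 \<rho> in \<open>auto intro!: mult_right_mono\<close>)
  assume \<tau>: "\<bar>\<tau>\<bar> \<le> \<rho>" "t + \<tau> \<le> 0"
  have *: "((\<lambda>(k, n). a k n x * \<tau> ^ k) has_sum u (t + \<tau>, y + x)) (UNIV \<times> UNIV)"
    using jet_has_sum[OF jet \<tau>(1) x \<tau>(2)] by simp
  have "((\<lambda>k. time_coeff a x k * \<tau> ^ k) has_sum u (t + \<tau>, y + x)) UNIV"
    by (rule has_sum_SigmaD[OF *]) (simp add: has_sum_cmult_left[OF hs])
  then show "(\<lambda>k. time_coeff a x k * \<tau> ^ k) sums u (t + \<tau>, y + x)" by (rule has_sum_imp_sums)
qed

lemma time_coeff_0: "jet u p \<rho> a A \<Longrightarrow> time_coeff a 0 k = a k 0 0"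
  unfolding time_coeff_def
  by (subst suminf_finite[of "{0}"]) (auto simp: jet_at_0)

lemma jet_space:
  assumes jet: "jet u (t, y) \<rho> a A" and \<tau>: "\<bar>\<tau>\<bar> \<le> \<rho>"
  shows "((\<lambda>k. a k n x * \<tau> ^ k) has_sum space_coeff a \<tau> x n) UNIV"
    and "t + \<tau> \<le> 0 \<Longrightarrow> \<bar>s\<bar> * norm x \<le> \<rho> \<Longrightarrow>
      (\<lambda>n. space_coeff a \<tau> x n * s ^ n) sums u (t + \<tau>, y + s *\<^sub>R x)"
proof -
  have le: "\<bar>a k n x * \<tau> ^ k\<bar> \<le> norm x ^ n * (A k n * \<rho> ^ k)" for k n
  proof -
    have "\<bar>a k n x * \<tau> ^ k\<bar> \<le> (A k n * norm x ^ n) * \<rho> ^ k"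
      unfolding abs_mult power_abs
      by (intro mult_mono jetD(4)[OF jet] power_mono \<tau>) (auto intro!: mult_nonneg_nonneg jetD(3)[OF jet])
    then show ?thesis by (simp add: mult_ac)
  qed
  have "(\<lambda>k. a k n x * \<tau> ^ k) summable_on UNIV" for n
    by (rule summable_on_abs_le[OF summable_on_cmult_right[OF jet_summable_time[OF jet]] le])
  from summable_on_imp_has_sum_suminf[OF this]
  show hs: "((\<lambda>k. a k n x * \<tau> ^ k) has_sum space_coeff a \<tau> x n) UNIV" for n
    by (simp add: space_coeff_def)
  assume s: "t + \<tau> \<le> 0" "\<bar>s\<bar> * norm x \<le> \<rho>"
  have "((\<lambda>(k, n). a k n (s *\<^sub>R x) * \<tau> ^ k) has_sum u (t + \<tau>, y + s *\<^sub>R x)) (UNIV \<times> UNIV)"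
    using jet_has_sum[OF jet \<tau> _ s(1), of "s *\<^sub>R x"] s(2) by simp
  then have *: "((\<lambda>(n, k). a k n x * \<tau> ^ k * s ^ n) has_sum u (t + \<tau>, y + s *\<^sub>R x)) (UNIV \<times> UNIV)"
    by (subst (asm) has_sum_swap) (simp add: jetD(5)[OF jet] mult_ac)
  have "((\<lambda>n. space_coeff a \<tau> x n * s ^ n) has_sum u (t + \<tau>, y + s *\<^sub>R x)) UNIV"
    by (rule has_sum_SigmaD[OF *]) (simp add: has_sum_cmult_left[OF hs])
  then show "(\<lambda>n. space_coeff a \<tau> x n * s ^ n) sums u (t + \<tau>, y + s *\<^sub>R x)"
    by (rule has_sum_imp_sums)
qed

lemma space_coeff_0: "space_coeff a 0 x n = a 0 n x"
  unfolding space_coeff_def by (subst suminf_finite[of "{0}"]) auto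

lemma jet_time_center:
  assumes "jet u (t, y) \<rho> a A" "\<bar>\<tau>\<bar> \<le> \<rho>" "t + \<tau> \<le> 0"
  shows "(\<lambda>k. a k 0 0 * \<tau> ^ k) sums u (t + \<tau>, y)"
  using jet_time(4)[OF assms(1) _ assms(2,3), of 0] jetD(1)[OF assms(1)]
  by (simp add: time_coeff_0[OF assms(1)])

text \<open>Both series represent \<open>u\<close> in time at the point \<open>y + x\<close>. If
  \<open>t = 0\<close>, only negative increments are available, hence the left-sided
  uniqueness.\<close>

lemma jet_shift_space:
  assumes "jet u (t, y) \<rho> a A" "jet u (t, y + x) r a' A'" "norm x \<le> \<rho>" "t \<le> 0"
  shows "a' k 0 0 = time_coeff a x k"
proof (rule powser_unique_left[of "min \<rho> r" _ "\<lambda>s. u (t + s, y + x)"])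
  show "0 < min \<rho> r" using jetD(1)[OF assms(1)] jetD(1)[OF assms(2)] by simp
next
  fix s assume "- min \<rho> r < s" "s < 0"
  then show "(\<lambda>k. a' k 0 0 * s ^ k) sums u (t + s, y + x)"
    "(\<lambda>k. time_coeff a x k * s ^ k) sums u (t + s, y + x)"
    using jet_time_center[OF assms(2), of s] jet_time(4)[OF assms(1,3), of s] assms(4) by auto
qed

text \<open>Both sides are the coefficients of \<open>u\<close> along the ray through
  \<open>x\<close> at one fixed time. For \<open>n = 2\<close> this describes how the Hessian
  changes in time, which is what the equation consumes.\<close>

lemma jet_shift_time:
  assumes "jet u (t, y) \<rho> a A" "jet u (t + \<tau>, y) r a' A'" "\<bar>\<tau>\<bar> \<le> \<rho>" "t + \<tau> \<le> 0"
  shows "a' 0 n x = space_coeff a \<tau> x n"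
proof (rule powser_unique_right[of "min \<rho> r / (1 + norm x)" _ "\<lambda>s. u (t + \<tau>, y + s *\<^sub>R x)"])
  have \<rho>: "0 < \<rho>" "0 < r" using jetD(1)[OF assms(1)] jetD(1)[OF assms(2)] by auto
  then have pos: "0 < min \<rho> r" by simp
  show "0 < min \<rho> r / (1 + norm x)" by (rule small_scale[OF pos])
  fix s assume s: "0 < s" "s < min \<rho> r / (1 + norm x)"
  then have "s * norm x \<le> \<rho>" "s * norm x \<le> r" using small_scale(2)[OF pos s] by auto
  then show "(\<lambda>n. a' 0 n x * s ^ n) sums u (t + \<tau>, y + s *\<^sub>R x)"
    "(\<lambda>n. space_coeff a \<tau> x n * s ^ n) sums u (t + \<tau>, y + s *\<^sub>R x)"
    using jet_space(2)[OF assms(1,3,4), of s x] jet_space(2)[OF assms(2), of 0 s x] assms s \<rho>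
    by (auto simp: space_coeff_0)
qed

lemma jet_time_deriv:
  assumes "jet u (t, y) \<rho> a A" "norm x \<le> \<rho>" "\<bar>\<tau>\<bar> < \<rho>" "t + \<tau> < 0"
  shows "((\<lambda>s. u (s, y + x)) has_real_derivative (\<Sum>k. diffs (time_coeff a x) k * \<tau> ^ k)) (at (t + \<tau>))"
proof -
  have "((\<lambda>s. u (t + s, y + x)) has_real_derivative (\<Sum>k. diffs (time_coeff a x) k * \<tau> ^ k)) (at \<tau>)"
  proof (rule DERIV_powser[OF jetD(1)[OF assms(1)] jet_time(3)[OF assms(1,2)] assms(3)])
    show "open {..< -t}" "\<tau> \<in> {..< -t}" using assms(4) by auto
    show "(\<lambda>k. time_coeff a x k * s ^ k) sums u (t + s, y + x)" if "s \<in> {..< -t}" "\<bar>s\<bar> < \<rho>" for s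
      using that by (intro jet_time(4)[OF assms(1,2)]) auto
  qed
  then show ?thesis
    using DERIV_shift[of "\<lambda>s. u (s, y + x)" _ \<tau> t] by (simp add: add.commute)
qed

lemma jet_time_deriv_0:
  assumes "jet u (t, y) \<rho> a A" "norm x \<le> \<rho>" "t < 0"
  shows "((\<lambda>s. u (s, y + x)) has_real_derivative time_coeff a x 1) (at t)"
proof -
  have "(\<Sum>k. diffs (time_coeff a x) k * 0 ^ k) = time_coeff a x 1"
    by (subst suminf_finite[of "{0}"]) (auto simp: diffs_def)
  then show ?thesis
    using jet_time_deriv[OF assms(1,2), of 0] jetD(1)[OF assms(1)] assms(3) by simp
qed

lemma jet_time_deriv_center:
  assumes "jet u (t, y) \<rho> a A" "\<bar>\<tau>\<bar> < \<rho>" "t + \<tau> < 0"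
  shows "((\<lambda>s. u (s, y)) has_real_derivative (\<Sum>k. diffs (\<lambda>k. a k 0 0) k * \<tau> ^ k)) (at (t + \<tau>))"
proof -
  have "time_coeff a 0 = (\<lambda>k. a k 0 0)" by (rule ext, rule time_coeff_0[OF assms(1)])
  then show ?thesis
    using jet_time_deriv[OF assms(1) _ assms(2,3), of 0] jetD(1)[OF assms(1)] by simp
qed

lemma jet_deriv:
  assumes "jet u (t, y) \<rho> a A" "t < 0"
  shows "((\<lambda>s. u (s, y)) has_real_derivative a 1 0 0) (at t)"
  using jet_time_deriv_0[OF assms(1) _ assms(2), of 0] jetD(1)[OF assms(1)]
  by (simp add: time_coeff_0[OF assms(1)])

lemma jet_shift_time_deriv:
  assumes "jet u (t, y) \<rho> a A" "jet u (t + \<tau>, y) r a' A'" "\<bar>\<tau>\<bar> < \<rho>" "t + \<tau> < 0"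
  shows "a' 1 0 0 = (\<Sum>k. diffs (\<lambda>k. a k 0 0) k * \<tau> ^ k)"
  using DERIV_unique[OF jet_deriv[OF assms(2,4)] jet_time_deriv_center[OF assms(1,3,4)]] .

subsection \<open>The classical equation\<close>

lemma psd_trace_nonneg: "psd_mat B \<Longrightarrow> 0 \<le> trace B"
proof -
  assume B: "psd_mat B"
  have "B $ i $ i = axis i 1 \<bullet> (B *v axis i 1)" for i
    by (simp add: inner_axis' matrix_vector_mult_basis column_def)
  then have "0 \<le> B $ i $ i" for i using B by (simp add: psd_mat_def)
  then show ?thesis by (simp add: trace_def sum_nonneg)
qed

lemma elliptic_mono:
  assumes "uniformly_elliptic lam Lam F" "0 < lam" "symmetric_mat A" "symmetric_mat B"
    and "\<And>x. x \<bullet> (A *v x) \<le> x \<bullet> (B *v x)"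
  shows "F A \<le> F B"
proof -
  have psd: "psd_mat (B - A)"
    using assms(5) by (simp add: psd_mat_def matrix_vector_mult_diff_rdistrib inner_diff_right)
  have "symmetric_mat (B - A)"
    using assms(3,4) by (simp add: symmetric_mat_def transpose_def vec_eq_iff)
  then have "lam * trace (B - A) \<le> F (A + (B - A)) - F A"
    using assms(1,3) psd unfolding uniformly_elliptic_def by blast
  moreover have "0 \<le> lam * trace (B - A)" using psd_trace_nonneg[OF psd] assms(2) by simp
  ultimately show ?thesis by simp
qed

lemma symmetric_mat_id: "symmetric_mat (mat c)"
  by (simp add: symmetric_mat_def)

text \<open>\<open>B\<close> is compared with \<open>A\<close> plus \<open>c\<close> times the
  identity minus \<open>e\<close> times the rank-one matrix of \<open>z\<close>. The first change
  raises \<open>F\<close> by at most \<open>Lam\<close> times its trace, the second lowers it by at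
  least \<open>lam\<close> times its trace. With \<open>z = 0\<close> this is the Lipschitz bound;
  the rank-one term is what later makes the barrier effective.\<close>

lemma elliptic_upper:
  fixes F :: "real^'n^'n \<Rightarrow> real"
  assumes F: "uniformly_elliptic lam Lam F" "0 < lam" and sym: "symmetric_mat A" "symmetric_mat B"
    and ce: "0 \<le> c" "0 \<le> e"
    and le: "\<And>x. x \<bullet> (B *v x) \<le> x \<bullet> (A *v x) + c * (norm x)\<^sup>2 - e * (z \<bullet> x)\<^sup>2"
  shows "F B \<le> F A + Lam * real CARD('n) * c - lam * e * (norm z)\<^sup>2"
proof -
  define N :: "real^'n^'n" where "N = (\<chi> i j. e * z $ i * z $ j)"
  define P :: "real^'n^'n" where "P = c *\<^sub>R mat 1"
  have N: "symmetric_mat N" by (simp add: N_def symmetric_mat_def transpose_def vec_eq_iff)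
  have P: "symmetric_mat P" by (simp add: P_def symmetric_mat_scale symmetric_mat_id)
  have Nx: "N *v x = (e * (z \<bullet> x)) *\<^sub>R z" for x
    by (simp add: N_def vec_eq_iff matrix_vector_mult_def inner_vec_def sum_distrib_left sum_distrib_right mult_ac)
  have Px: "P *v x = c *\<^sub>R x" for x
    by (simp add: P_def scaleR_matrix_vector_assoc[symmetric])
  have Nq: "x \<bullet> (N *v x) = e * (z \<bullet> x)\<^sup>2" for x
    by (simp add: Nx power2_eq_square inner_commute)
  have Pq: "x \<bullet> (P *v x) = c * (norm x)\<^sup>2" for x
    by (simp add: Px power2_norm_eq_inner)
  have pN: "psd_mat N" and pP: "psd_mat P" using ce by (auto simp: psd_mat_def Nq Pq)
  have tN: "trace N = e * (norm z)\<^sup>2"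
    by (simp add: N_def trace_def power2_norm_eq_inner inner_vec_def sum_distrib_left mult_ac)
  have tP: "trace P = real CARD('n) * c"
    by (simp add: P_def trace_def mat_def)
  have sC: "symmetric_mat (A + P - N)"
    using sym N P by (simp add: symmetric_mat_def transpose_def vec_eq_iff)
  have "F B \<le> F (A + P - N)"
    by (rule elliptic_mono[OF F sym(2) sC])
       (use le in \<open>simp add: matrix_vector_mult_diff_rdistrib matrix_vector_mult_add_rdistrib
          inner_diff_right inner_add_right Nq Pq\<close>)
  moreover have "lam * trace N \<le> F (A + P - N + N) - F (A + P - N)"
    using F(1) sC N pN unfolding uniformly_elliptic_def by blast
  moreover have "F (A + P) - F A \<le> Lam * trace P"
    using F(1) sym(1) P pP unfolding uniformly_elliptic_def by blast
  ultimately show ?thesis by (simp add: tN tP)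
qed

lemma elliptic_lipschitz:
  fixes F :: "real^'n^'n \<Rightarrow> real"
  assumes F: "uniformly_elliptic lam Lam F" "0 < lam" and sym: "symmetric_mat A" "symmetric_mat B"
    and "0 \<le> c" "\<And>x. \<bar>x \<bullet> (A *v x) - x \<bullet> (B *v x)\<bar> \<le> c * (norm x)\<^sup>2"
  shows "\<bar>F A - F B\<bar> \<le> Lam * real CARD('n) * c"
proof -
  have "F B \<le> F A + Lam * real CARD('n) * c - lam * 0 * (norm (0 :: real^'n))\<^sup>2"
    by (rule elliptic_upper[OF F sym assms(5)]) (use assms(6) in \<open>auto simp: abs_le_iff algebra_simps\<close>)
  moreover have "F A \<le> F B + Lam * real CARD('n) * c - lam * 0 * (norm (0 :: real^'n))\<^sup>2"
    by (rule elliptic_upper[OF F sym(2,1) assms(5)]) (use assms(6) in \<open>auto simp: abs_le_iff algebra_simps\<close>)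
  ultimately show ?thesis by (simp add: abs_le_iff)
qed

text \<open>Analyticity towards the past and the classical equation are bundled so that they
  transfer together under rescaling and localisation. A quadratic form has exactly one symmetric
  matrix, so the quantifier over \<open>H\<close> picks out half the Hessian.
  \<open>solves_at_jet\<close> frees the equation from the choice of the jet.\<close>

definition solves_at :: "(real^'n^'n \<Rightarrow> real) \<Rightarrow> (real \<times> (real^'n) \<Rightarrow> real) \<Rightarrow> real \<times> (real^'n) \<Rightarrow> bool" where
  "solves_at F u p \<longleftrightarrow> (\<exists>\<rho> a A. jet u p \<rho> a A \<and>
     (\<forall>H. symmetric_mat H \<longrightarrow> (\<forall>x. a 0 2 x = x \<bullet> (H *v x)) \<longrightarrow> a 1 0 0 = F (2 *\<^sub>R H)))"

lemma solves_at_jet: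
  assumes "solves_at F u (t, y)" "jet u (t, y) \<rho> a A" "t \<le> 0"
    and "symmetric_mat H" "\<And>x. a 0 2 x = x \<bullet> (H *v x)"
  shows "a 1 0 0 = F (2 *\<^sub>R H)"
proof -
  obtain r a' A' where j: "jet u (t, y) r a' A'"
    and s: "\<And>H. symmetric_mat H \<Longrightarrow> (\<And>x. a' 0 2 x = x \<bullet> (H *v x)) \<Longrightarrow> a' 1 0 0 = F (2 *\<^sub>R H)"
    using assms(1) unfolding solves_at_def by blast
  have 1: "a' 1 0 0 = a 1 0 0"
    using jet_shift_space[of u t y \<rho> a A 0 r a' A' 1] assms(2,3) j jetD(1)[OF assms(2)]
    by (simp add: time_coeff_0)
  have 2: "a' 0 2 x = a 0 2 x" for x
    using jet_shift_time[of u t y \<rho> a A 0 r a' A' 2 x] assms(2,3) j jetD(1)[OF assms(2)]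
    by (simp add: space_coeff_0)
  show ?thesis using s[OF assms(4)] assms(5) 1 2 by simp
qed

section \<open>From viscosity solutions to the classical equation\<close>

lemma power_prod_bound:
  fixes \<sigma> \<kappa> :: real
  assumes "0 \<le> \<sigma>" "\<sigma> \<le> 1" "0 \<le> \<kappa>" "\<kappa> \<le> 1"
    and "(k, n) \<notin> {(0, 0), (1, 0), (0, 1), (0, 2)}"
  shows "\<sigma> ^ k * \<kappa> ^ n \<le> \<sigma>\<^sup>2 + \<sigma> * \<kappa> + \<kappa> ^ 3"
proof -
  have nn: "0 \<le> \<sigma>\<^sup>2" "0 \<le> \<sigma> * \<kappa>" "0 \<le> \<kappa> ^ 3" using assms(1,3) by auto
  have "k = 0 \<and> n \<ge> 3 \<or> k = 1 \<and> n \<ge> 1 \<or> k \<ge> 2"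
    using assms(5) by simp presburger
  then consider "k = 0" "n \<ge> 3" | "k = 1" "n \<ge> 1" | "k \<ge> 2" by blast
  then show ?thesis
  proof cases
    case 1
    then show ?thesis
      using power_decreasing[of 3 n \<kappa>] assms(3,4) nn unfolding 1(1) power_0 mult_1 by linarith
  next
    case 2
    have "\<sigma> * \<kappa> ^ n \<le> \<sigma> * \<kappa> ^ 1" using 2 assms(1-4) by (intro mult_left_mono power_decreasing) auto
    then show ?thesis using nn unfolding 2(1) power_one_right by linarith
  next
    case 3
    have "\<sigma> ^ k * \<kappa> ^ n \<le> \<sigma>\<^sup>2 * 1"
      using 3 assms(1-4) by (intro mult_mono power_decreasing power_le_one) auto
    then show ?thesis using nn by linarith
  qed
qed

text \<open>Once the four leading terms, indexed by \<open>E\<close>, are removed, every term has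
  \<open>k \<ge> 2\<close>, or \<open>k = 1\<close> and \<open>n \<ge> 1\<close>, or
  \<open>k = 0\<close> and \<open>n \<ge> 3\<close>. These cases give the three summands of the
  remainder.\<close>

lemma jet_taylor:
  assumes jet: "jet u (t, y) \<rho> a A"
  shows "\<exists>M\<ge>0. \<forall>\<tau> x. \<bar>\<tau>\<bar> \<le> \<rho> \<longrightarrow> norm x \<le> \<rho> \<longrightarrow> t + \<tau> \<le> 0 \<longrightarrow>
     \<bar>u (t + \<tau>, y + x) - (a 0 0 0 + a 1 0 0 * \<tau> + a 0 1 x + a 0 2 x)\<bar>
       \<le> M * (\<tau>\<^sup>2 + \<bar>\<tau>\<bar> * norm x + norm x ^ 3)"
proof -
  define E where "E = {(0 :: nat, 0 :: nat), (1, 0), (0, 1), (0, 2)}"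
  note \<rho> = jetD(1)[OF jet]
  have "(\<lambda>(k, n). A k n * \<rho> ^ (k + n)) summable_on - E"
    using jetD(2)[OF jet] by (rule summable_on_subset) auto
  then obtain D where D: "((\<lambda>(k, n). A k n * \<rho> ^ (k + n)) has_sum D) (- E)"
    by (auto simp: summable_on_def)
  have D0: "0 \<le> D" using D by (rule has_sum_nonneg) (use jetD(3)[OF jet] \<rho> in auto)
  define M where "M = D / \<rho>\<^sup>2 + D / \<rho> ^ 3"
  show ?thesis
  proof (intro exI[of _ M] conjI allI impI)
    show "0 \<le> M" using D0 \<rho> by (simp add: M_def)
    fix \<tau> :: real and x :: "real^'a"
    assume *: "\<bar>\<tau>\<bar> \<le> \<rho>" "norm x \<le> \<rho>" "t + \<tau> \<le> 0"
    define \<sigma> where "\<sigma> = \<bar>\<tau>\<bar> / \<rho>"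
    define \<kappa> where "\<kappa> = norm x / \<rho>"
    define S where "S = \<sigma>\<^sup>2 + \<sigma> * \<kappa> + \<kappa> ^ 3"
    have \<sigma>\<kappa>: "0 \<le> \<sigma>" "\<sigma> \<le> 1" "0 \<le> \<kappa>" "\<kappa> \<le> 1" using * \<rho> by (auto simp: \<sigma>_def \<kappa>_def)
    let ?f = "\<lambda>(k, n). a k n x * \<tau> ^ k"
    let ?v = "u (t + \<tau>, y + x) - (a 0 0 0 + a 1 0 0 * \<tau> + a 0 1 x + a 0 2 x)"
    have fE: "(?f has_sum (a 0 0 0 + a 1 0 0 * \<tau> + a 0 1 x + a 0 2 x)) E"
      by (rule has_sum_finiteI)
         (auto simp: E_def jet_degree_0[OF jet, of _ x])
    have f: "(?f has_sum ?v) (UNIV - E)"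
      by (rule has_sum_Diff[OF jet_has_sum[OF jet *] fE]) auto
    have g: "((\<lambda>(k, n). A k n * \<rho> ^ (k + n) * S) has_sum D * S) (UNIV - E)"
      using has_sum_cmult_left[OF D, of S] by (simp add: case_prod_unfold Compl_eq_Diff_UNIV)
    have le: "\<bar>?f q\<bar> \<le> (case q of (k, n) \<Rightarrow> A k n * \<rho> ^ (k + n) * S)" if q: "q \<in> UNIV - E" for q
    proof -
      obtain k n where kn: "q = (k, n)" by (cases q)
      have "\<bar>a k n x * \<tau> ^ k\<bar> \<le> A k n * norm x ^ n * \<bar>\<tau>\<bar> ^ k"
        unfolding abs_mult power_abs by (intro mult_right_mono jetD(4)[OF jet]) auto
      also have "\<dots> = A k n * \<rho> ^ (k + n) * (\<sigma> ^ k * \<kappa> ^ n)"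
        using \<rho> by (simp add: \<sigma>_def \<kappa>_def power_add power_divide)
      also have "\<dots> \<le> A k n * \<rho> ^ (k + n) * S"
        unfolding S_def using q kn \<rho> jetD(3)[OF jet]
        by (intro mult_left_mono power_prod_bound \<sigma>\<kappa>) (auto simp: E_def)
      finally show ?thesis by (simp add: kn)
    qed
    have "?v \<le> D * S" using has_sum_mono[OF f g] le by (force simp: abs_le_iff)
    moreover have "- ?v \<le> D * S"
      using has_sum_mono[OF has_sum_uminusI[OF f] g] le by (force simp: abs_le_iff)
    ultimately have "\<bar>?v\<bar> \<le> D * S" by (simp add: abs_le_iff)
    also have "D * S = D / \<rho>\<^sup>2 * (\<tau>\<^sup>2 + \<bar>\<tau>\<bar> * norm x) + D / \<rho> ^ 3 * norm x ^ 3"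
      unfolding S_def \<sigma>_def \<kappa>_def power_divide times_divide_times_eq power2_abs
      by (simp add: algebra_simps power2_eq_square add_divide_distrib)
    also have "\<dots> \<le> M * (\<tau>\<^sup>2 + \<bar>\<tau>\<bar> * norm x) + M * norm x ^ 3"
      using D0 \<rho> by (intro add_mono mult_right_mono) (auto simp: M_def)
    finally show "\<bar>?v\<bar> \<le> M * (\<tau>\<^sup>2 + \<bar>\<tau>\<bar> * norm x + norm x ^ 3)"
      by (simp add: algebra_simps)
  qed
qed

lemma symmetric_mat_inner: "symmetric_mat H \<Longrightarrow> x \<bullet> (H *v y) = (H *v x) \<bullet> y"
  by (metis dot_lmul_matrix symmetric_mat_def transpose_matrix_vector)

lemma C12_quadratic:
  fixes y b :: "real^'n" and H :: "real^'n^'n"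
  assumes "symmetric_mat H"
  shows "C12_test (\<lambda>(t, x). c + a * (t - t0) + C * (t - t0)\<^sup>2 + b \<bullet> (x - y) + (x - y) \<bullet> (H *v (x - y)))
     (\<lambda>(t, x). a + 2 * C * (t - t0)) (\<lambda>i j p. (2 *\<^sub>R H) $ i $ j)"
proof -
  note cm[continuous_intros] = bounded_linear.continuous_on[OF matrix_vector_mul_bounded_linear]
  define g where "g i = (\<lambda>(t :: real, x). b $ i + 2 * (H *v (x - y)) $ i)" for i
  show ?thesis
    unfolding C12_test_def
  proof (intro exI[of _ g] conjI allI)
    fix t :: real and x :: "real^'n" and i j
    show "((\<lambda>s. case (t + s, x) of (t, x) \<Rightarrow> c + a * (t - t0) + C * (t - t0)\<^sup>2 + b \<bullet> (x - y) + (x - y) \<bullet> (H *v (x - y)))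
        has_real_derivative (case (t, x) of (t, x) \<Rightarrow> a + 2 * C * (t - t0))) (at 0)"
      by (auto intro!: derivative_eq_intros)
    have eq: "(x + s *\<^sub>R axis i 1 - y) \<bullet> (H *v (x + s *\<^sub>R axis i 1 - y)) =
        (x - y) \<bullet> (H *v (x - y)) + s * (2 * (H *v (x - y)) $ i) + s\<^sup>2 * (axis i 1 \<bullet> (H *v axis i 1))" for s
    proof -
      have "x + s *\<^sub>R axis i 1 - y = (x - y) + s *\<^sub>R axis i 1" by simp
      then show ?thesis
        by (simp only: matrix_vector_right_distrib matrix_vector_mult_scaleR inner_add_left inner_add_right
            symmetric_mat_inner[OF assms, of "x - y" "axis i 1"] inner_scaleR_left inner_scaleR_right)
           (simp add: inner_axis inner_axis' power2_eq_square algebra_simps)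
    qed
    have eq2: "b \<bullet> (x + s *\<^sub>R axis i 1 - y) = b \<bullet> (x - y) + s * b $ i" for s
      by (simp add: inner_diff_right inner_add_right inner_axis)
    show "((\<lambda>s. case (t, x + s *\<^sub>R axis i 1) of (t, x) \<Rightarrow> c + a * (t - t0) + C * (t - t0)\<^sup>2 + b \<bullet> (x - y) + (x - y) \<bullet> (H *v (x - y)))
        has_real_derivative g i (t, x)) (at 0)"
      unfolding prod.case eq eq2 g_def by (auto intro!: derivative_eq_intros)
    have "(H *v (x + s *\<^sub>R axis j 1 - y)) $ i = (H *v (x - y)) $ i + s * H $ i $ j" for s
    proof -
      have "x + s *\<^sub>R axis j 1 - y = (x - y) + s *\<^sub>R axis j 1" by simp
      then show ?thesis
        by (simp only: matrix_vector_right_distrib matrix_vector_mult_scaleR)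
           (simp add: matrix_vector_mult_basis column_def)
    qed
    then have "g i (t, x + s *\<^sub>R axis j 1) = b $ i + 2 * ((H *v (x - y)) $ i + s * H $ i $ j)" for s
      by (simp add: g_def)
    then show "((\<lambda>s. g i (t, x + s *\<^sub>R axis j 1)) has_real_derivative (2 *\<^sub>R H) $ i $ j) (at 0)"
      by (auto intro!: derivative_eq_intros)
  qed (auto simp: case_prod_unfold g_def intro!: continuous_intros)
qed

lemma quadratic_add_id:
  fixes x :: "real^'n"
  shows "x \<bullet> ((H + c *\<^sub>R mat 1) *v x) = x \<bullet> (H *v x) + c * (norm x)\<^sup>2"
  by (simp add: matrix_vector_mult_add_rdistrib scaleR_matrix_vector_assoc[symmetric]
      inner_add_right power2_norm_eq_inner)

text \<open>Young's inequality for the mixed term, and smallness of \<open>X\<close> for the cubic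
  one. The coefficient of \<open>\<tau>\<^sup>2\<close> may blow up as \<open>\<epsilon>\<close>
  tends to 0, because it changes neither the time derivative nor the Hessian of the test function at
  the contact point.\<close>

lemma touching_absorb:
  fixes \<tau> X M \<epsilon> :: real
  assumes "0 \<le> M" "0 < \<epsilon>" "0 \<le> X" "M * X \<le> \<epsilon> / 2"
  shows "M * (\<tau>\<^sup>2 + \<bar>\<tau>\<bar> * X + X ^ 3) \<le> (M + M\<^sup>2 / (2 * \<epsilon>)) * \<tau>\<^sup>2 + \<epsilon> * X\<^sup>2"
proof -
  have "0 \<le> (M * \<bar>\<tau>\<bar> - \<epsilon> * X)\<^sup>2 / (2 * \<epsilon>)" using assms by simp
  also have "\<dots> = M\<^sup>2 / (2 * \<epsilon>) * \<tau>\<^sup>2 - M * (\<bar>\<tau>\<bar> * X) + \<epsilon> / 2 * X\<^sup>2"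
    using assms by (simp add: power2_diff power_mult_distrib field_simps power2_eq_square)
  finally have 1: "M * (\<bar>\<tau>\<bar> * X) \<le> M\<^sup>2 / (2 * \<epsilon>) * \<tau>\<^sup>2 + \<epsilon> / 2 * X\<^sup>2" by simp
  have "M * X * X\<^sup>2 \<le> \<epsilon> / 2 * X\<^sup>2" using assms by (intro mult_right_mono) auto
  then have 2: "M * X ^ 3 \<le> \<epsilon> / 2 * X\<^sup>2" by (simp add: power3_eq_cube power2_eq_square mult.assoc)
  show ?thesis using 1 2 by (simp add: algebra_simps)
qed

lemma viscosity_imp_equation:
  fixes F :: "real^'n^'n \<Rightarrow> real"
  assumes F: "uniformly_elliptic lam Lam F" "0 < lam"
    and u: "viscosity_solution F Q1 u" and p: "(t, y) \<in> Q1" and jet: "jet u (t, y) \<rho> a A"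
    and H: "symmetric_mat H" "\<And>x. a 0 2 x = x \<bullet> (H *v x)"
  shows "a 1 0 0 = F (2 *\<^sub>R H)"
proof -
  obtain b where b: "\<And>x. a 0 1 x = b \<bullet> x" using jetD(6)[OF jet] by metis
  obtain M where M: "0 \<le> M" and taylor: "\<And>\<tau> x. \<bar>\<tau>\<bar> \<le> \<rho> \<Longrightarrow> norm x \<le> \<rho> \<Longrightarrow> t + \<tau> \<le> 0 \<Longrightarrow>
     \<bar>u (t + \<tau>, y + x) - (a 0 0 0 + a 1 0 0 * \<tau> + a 0 1 x + a 0 2 x)\<bar>
       \<le> M * (\<tau>\<^sup>2 + \<bar>\<tau>\<bar> * norm x + norm x ^ 3)"
    using jet_taylor[OF jet] by blast
  have t: "t \<le> 0" using p by (auto simp: Q1_def)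
  have a0: "u (t, y) = a 0 0 0"
    using taylor[of 0 0] jetD(1)[OF jet] t jet_at_0[OF jet] by simp
  \<comment> \<open>The sign \<open>\<sigma>\<close> selects the side: \<open>T 1\<close> will touch
    \<open>u\<close> from above at \<open>(t, y)\<close> and \<open>T (-1)\<close> from
    below.\<close>
  define T where "T \<sigma> \<epsilon> C = (\<lambda>(s, x). a 0 0 0 + a 1 0 0 * (s - t) + \<sigma> * C * (s - t)\<^sup>2 + b \<bullet> (x - y)
      + (x - y) \<bullet> ((H + (\<sigma> * \<epsilon>) *\<^sub>R mat 1) *v (x - y)))" for \<sigma> \<epsilon> C :: real
  have symT: "symmetric_mat (H + (\<sigma> * \<epsilon>) *\<^sub>R mat 1)" for \<sigma> \<epsilon> :: real
    using H(1) by (intro symmetric_mat_add symmetric_mat_scale symmetric_mat_id)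
  have C12: "C12_test (T \<sigma> \<epsilon> C) (\<lambda>(s, x). a 1 0 0 + 2 * (\<sigma> * C) * (s - t))
      (\<lambda>i j p. (2 *\<^sub>R (H + (\<sigma> * \<epsilon>) *\<^sub>R mat 1)) $ i $ j)" for \<sigma> \<epsilon> C
    unfolding T_def by (rule C12_quadratic[OF symT])
  have Tp: "T \<sigma> \<epsilon> C (t, y) = a 0 0 0" for \<sigma> \<epsilon> C by (simp add: T_def)
  have touch: "\<exists>r>0. \<forall>q\<in>Q1. dist q (t, y) < r \<longrightarrow>
      u q \<le> T 1 \<epsilon> (M + M\<^sup>2 / (2 * \<epsilon>)) q \<and> T (-1) \<epsilon> (M + M\<^sup>2 / (2 * \<epsilon>)) q \<le> u q" if "\<epsilon> > 0" for \<epsilon>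
  proof (intro exI conjI ballI impI)
    define C where "C = M + M\<^sup>2 / (2 * \<epsilon>)"
    \<comment> \<open>The second radius ensures
      \<open>M * norm (x - y) \<le> \<epsilon> / 2\<close>, as \<open>touching_absorb\<close>
      demands; \<open>M + 1\<close> avoids dividing by zero.\<close>
    let ?r = "min \<rho> (\<epsilon> / 2 / (M + 1))"
    show "0 < ?r" using jetD(1)[OF jet] that M by simp
    fix q assume q: "q \<in> Q1" "dist q (t, y) < ?r"
    obtain s x where sx: "q = (s, x)" by (cases q)
    have "\<bar>s - t\<bar> \<le> dist q (t, y)" "norm (x - y) \<le> dist q (t, y)"
      using dist_fst_le[of q "(t, y)"] dist_snd_le[of q "(t, y)"] by (auto simp: sx dist_norm)
    then have d: "\<bar>s - t\<bar> \<le> \<rho>" "norm (x - y) \<le> \<rho>" "norm (x - y) \<le> \<epsilon> / 2 / (M + 1)" using q(2) by auto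
    have "M * norm (x - y) \<le> (M + 1) * (\<epsilon> / 2 / (M + 1))"
      using d(3) M by (intro mult_mono) auto
    also have "\<dots> = \<epsilon> / 2"
      by (subst times_divide_eq_right, rule nonzero_mult_div_cancel_left) (use M in simp)
    finally have small: "M * norm (x - y) \<le> \<epsilon> / 2" .
    have "s \<le> 0" using q(1) by (auto simp: Q1_def sx)
    then have "\<bar>u (s, x) - (a 0 0 0 + a 1 0 0 * (s - t) + b \<bullet> (x - y) + (x - y) \<bullet> (H *v (x - y)))\<bar>
       \<le> M * ((s - t)\<^sup>2 + \<bar>s - t\<bar> * norm (x - y) + norm (x - y) ^ 3)"
      using taylor[OF d(1,2)] by (simp add: H(2) b del: One_nat_def)
    also have "\<dots> \<le> C * (s - t)\<^sup>2 + \<epsilon> * (norm (x - y))\<^sup>2"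
      unfolding C_def by (rule touching_absorb[OF M that _ small]) simp
    finally have main: "\<bar>u (s, x) - (a 0 0 0 + a 1 0 0 * (s - t) + b \<bullet> (x - y) + (x - y) \<bullet> (H *v (x - y)))\<bar>
       \<le> C * (s - t)\<^sup>2 + \<epsilon> * (norm (x - y))\<^sup>2" .
    have Tq: "T \<sigma> \<epsilon> C (s, x) = a 0 0 0 + a 1 0 0 * (s - t) + b \<bullet> (x - y) + (x - y) \<bullet> (H *v (x - y))
        + \<sigma> * (C * (s - t)\<^sup>2 + \<epsilon> * (norm (x - y))\<^sup>2)" for \<sigma>
      by (simp only: T_def prod.case quadratic_add_id) (simp add: distrib_left)
    show "u q \<le> T 1 \<epsilon> (M + M\<^sup>2 / (2 * \<epsilon>)) q" "T (-1) \<epsilon> (M + M\<^sup>2 / (2 * \<epsilon>)) q \<le> u q"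
      using main unfolding sx C_def[symmetric] Tq by (auto simp: abs_le_iff)
  qed
  have sub: "phit (t, y) - F (hess_mat h (t, y)) \<le> 0"
    if "C12_test phi phit h" "\<exists>r>0. \<forall>q\<in>Q1. dist q (t, y) < r \<longrightarrow> u q - phi q \<le> u (t, y) - phi (t, y)" for phi phit h
    using u p that unfolding viscosity_solution_def viscosity_subsolution_def by blast
  have super: "phit (t, y) - F (hess_mat h (t, y)) \<ge> 0"
    if "C12_test phi phit h" "\<exists>r>0. \<forall>q\<in>Q1. dist q (t, y) < r \<longrightarrow> u q - phi q \<ge> u (t, y) - phi (t, y)" for phi phit h
    using u p that unfolding viscosity_solution_def viscosity_supersolution_def by blast
  \<comment> \<open>The Hessians of the two test functions differ from twice \<open>H\<close> by
    \<open>2 * \<epsilon>\<close> times the identity, so the two viscosity inequalities trap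
    \<open>a 1 0 0\<close> up to a Lipschitz error that vanishes with
    \<open>\<epsilon>\<close>.\<close>
  have bounds: "\<bar>a 1 0 0 - F (2 *\<^sub>R H)\<bar> \<le> Lam * real CARD('n) * (2 * \<epsilon>)" if \<epsilon>: "\<epsilon> > 0" for \<epsilon>
  proof -
    let ?C = "M + M\<^sup>2 / (2 * \<epsilon>)"
    obtain r where r: "r > 0" "\<And>q. q \<in> Q1 \<Longrightarrow> dist q (t, y) < r \<Longrightarrow> u q \<le> T 1 \<epsilon> ?C q \<and> T (-1) \<epsilon> ?C q \<le> u q"
      using touch[OF \<epsilon>] by blast
    have hm: "hess_mat (\<lambda>i j p. K $ i $ j) q = K" for K :: "real^'n^'n" and q
      by (simp add: hess_mat_def vec_eq_iff)
    have "\<exists>r>0. \<forall>q\<in>Q1. dist q (t, y) < r \<longrightarrow> u q - T 1 \<epsilon> ?C q \<le> u (t, y) - T 1 \<epsilon> ?C (t, y)"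
      using r(1) r(2)[THEN conjunct1] by (intro exI[of _ r]) (simp add: Tp a0)
    from sub[OF C12 this, unfolded hm] have 1: "a 1 0 0 \<le> F (2 *\<^sub>R (H + (1 * \<epsilon>) *\<^sub>R mat 1))"
      by simp
    have "\<exists>r>0. \<forall>q\<in>Q1. dist q (t, y) < r \<longrightarrow> u q - T (-1) \<epsilon> ?C q \<ge> u (t, y) - T (-1) \<epsilon> ?C (t, y)"
      using r(1) r(2)[THEN conjunct2] by (intro exI[of _ r]) (simp add: Tp a0)
    from super[OF C12 this, unfolded hm] have 2: "a 1 0 0 \<ge> F (2 *\<^sub>R (H + (-1 * \<epsilon>) *\<^sub>R mat 1))"
      by simp
    have 3: "\<bar>F (2 *\<^sub>R (H + (\<sigma> * \<epsilon>) *\<^sub>R mat 1)) - F (2 *\<^sub>R H)\<bar> \<le> Lam * real CARD('n) * (2 * \<epsilon>)"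
      if "\<bar>\<sigma>\<bar> = 1" for \<sigma>
    proof (rule elliptic_lipschitz[OF F])
      fix x :: "real^'n"
      have "x \<bullet> ((2 *\<^sub>R (H + (\<sigma> * \<epsilon>) *\<^sub>R mat 1)) *v x) - x \<bullet> ((2 *\<^sub>R H) *v x) = 2 * \<sigma> * \<epsilon> * (norm x)\<^sup>2"
        by (simp only: scaleR_matrix_vector_assoc[symmetric] inner_scaleR_right quadratic_add_id)
           (simp add: distrib_left)
      then show "\<bar>x \<bullet> ((2 *\<^sub>R (H + (\<sigma> * \<epsilon>) *\<^sub>R mat 1)) *v x) - x \<bullet> ((2 *\<^sub>R H) *v x)\<bar> \<le> 2 * \<epsilon> * (norm x)\<^sup>2"
        using that \<epsilon> by (simp add: abs_mult)
    qed (use \<epsilon> H symT in \<open>auto intro: symmetric_mat_scale\<close>)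
    show ?thesis using 1 2 3[of 1] 3[of "-1"] by (simp add: abs_le_iff)
  qed
  have "\<bar>a 1 0 0 - F (2 *\<^sub>R H)\<bar> \<le> 0"
    by (rule le_0_if_le_small[of 1 _ "Lam * real CARD('n) * 2"]) (use bounds in \<open>auto simp: mult.assoc\<close>)
  then show ?thesis by simp
qed

subsection \<open>Uniqueness for the terminal value problem\<close>

lemma jet_value:
  assumes "jet u (t, y) \<rho> a A" "t \<le> 0"
  shows "a 0 0 0 = u (t, y)"
  using sums_unique2[OF jet_time_center[OF assms(1), of 0] powser_sums_zero[of "\<lambda>k. a k 0 0"]]
    jetD(1)[OF assms(1)] assms(2) by simp

lemma summable_abs_powser:
  fixes f :: "nat \<Rightarrow> real"
  assumes "summable (\<lambda>k. \<bar>f k\<bar> * \<rho> ^ k)" "\<bar>\<tau>\<bar> \<le> \<rho>"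
  shows "summable (\<lambda>k. f k * \<tau> ^ k)"
  by (rule summable_comparison_test[OF _ assms(1)])
     (use assms(2) in \<open>auto simp: abs_mult power_abs intro!: mult_left_mono power_mono\<close>)

lemma jet_summable_center:
  assumes "jet u (t, y) \<rho> a A"
  shows "summable (\<lambda>k. \<bar>a k 0 0\<bar> * \<rho> ^ k)"
  using jet_time(3)[OF assms, of 0] jetD(1)[OF assms] by (simp add: time_coeff_0[OF assms])

lemma jet_space_line:
  assumes "jet u (t, y) \<rho> a A" "\<bar>s\<bar> * norm x \<le> \<rho>"
  shows "(\<lambda>n. a k n x * s ^ n) sums time_coeff a (s *\<^sub>R x) k"
  using has_sum_imp_sums[OF jet_time(1)[OF assms(1), of "s *\<^sub>R x" k]] assms(2)
  by (simp add: jetD(5)[OF assms(1)] mult.commute)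

text \<open>The induction treats all centres in the open set \<open>X\<close> at once: a time
  coefficient that agrees at every nearby centre agrees as a function of space, hence so do its
  homogeneous parts and in particular its quadratic part. This is why a pointwise induction at a
  single \<open>y\<close> would not close.\<close>

lemma solution_coeff_unique:
  fixes F :: "real^'n^'n \<Rightarrow> real"
  assumes F: "uniformly_elliptic lam Lam F" "0 < lam" and X: "open X" and T: "T < 0"
    and u: "\<And>t y. T < t \<Longrightarrow> t \<le> 0 \<Longrightarrow> y \<in> X \<Longrightarrow> solves_at F u (t, y)"
    and v: "\<And>t y. T < t \<Longrightarrow> t \<le> 0 \<Longrightarrow> y \<in> X \<Longrightarrow> solves_at F v (t, y)"
    and uv: "\<And>y. y \<in> X \<Longrightarrow> u (0, y) = v (0, y)"
  shows "y \<in> X \<Longrightarrow> jet u (0, y) \<rho> a A \<Longrightarrow> jet v (0, y) \<rho> b B \<Longrightarrow> a k 0 0 = b k 0 0"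
proof (induction k arbitrary: y \<rho> a A b B rule: less_induct)
  case (less k)
  note y = less.prems(1) and ju = less.prems(2) and jv = less.prems(3)
  note \<rho> = jetD(1)[OF ju]
  show ?case
  proof (cases k)
    case 0
    then show ?thesis using jet_value[OF ju] jet_value[OF jv] uv[OF y] by simp
  next
    case (Suc m)
    obtain e where e: "0 < e" "ball y e \<subseteq> X" using X y by (meson openE)
    \<comment> \<open>The induction hypothesis at the centres \<open>y + s *\<^sub>R x\<close> is
      read as an identity of power series in \<open>s\<close>.\<close>
    have low: "a j n x = b j n x" if j: "j \<le> m" for j n x
    proof (rule powser_unique_right[of "min \<rho> e / (1 + norm x)"])
      have pos: "0 < min \<rho> e" using \<rho> e by simp
      show "0 < min \<rho> e / (1 + norm x)" by (rule small_scale[OF pos])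
      fix s assume s: "0 < s" "s < min \<rho> e / (1 + norm x)"
      then have sx: "\<bar>s\<bar> * norm x < \<rho>" "\<bar>s\<bar> * norm x < e" using small_scale(2)[OF pos s] by auto
      then have yX: "y + s *\<^sub>R x \<in> X" using e(2) by (auto simp: dist_norm)
      obtain r1 a1 A1 where j1: "jet u (0, y + s *\<^sub>R x) r1 a1 A1"
        using u[OF T _ yX] unfolding solves_at_def by blast
      obtain r2 b1 B1 where j2: "jet v (0, y + s *\<^sub>R x) r2 b1 B1"
        using v[OF T _ yX] unfolding solves_at_def by blast
      \<comment> \<open>The induction hypothesis speaks of two jets with a common radius.\<close>
      have r: "0 < min r1 r2" using jetD(1)[OF j1] jetD(1)[OF j2] by simp
      have "a1 j 0 0 = b1 j 0 0"
        by (rule less.IH[OF _ yX jet_shrink[OF j1 r] jet_shrink[OF j2 r]]) (use j Suc in auto)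
      then have "time_coeff a (s *\<^sub>R x) j = time_coeff b (s *\<^sub>R x) j"
        using jet_shift_space[OF ju j1] jet_shift_space[OF jv j2] sx by simp
      then show "(\<lambda>n. a j n x * s ^ n) sums time_coeff a (s *\<^sub>R x) j"
        "(\<lambda>n. b j n x * s ^ n) sums time_coeff a (s *\<^sub>R x) j"
        using jet_space_line[OF ju, of s x j] jet_space_line[OF jv, of s x j] sx by auto
    qed
    define D where "D k = A k 2 + B k 2" for k
    have D0: "0 \<le> D k" for k using jetD(3)[OF ju] jetD(3)[OF jv] by (simp add: D_def)
    have sD: "summable (\<lambda>k. D k * \<rho> ^ k)"
      unfolding D_def distrib_right
      by (intro summable_add summable_on_imp_summable jet_summable_time[OF ju] jet_summable_time[OF jv])
    define C where "C = (\<Sum>k. D k * \<rho> ^ k) / \<rho> ^ Suc m"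
    \<comment> \<open>The orders up to \<open>m\<close> cancel by \<open>low\<close>; what is left
      is the tail from order \<open>Suc m\<close> on.\<close>
    have hess: "\<bar>space_coeff a \<tau> x 2 - space_coeff b \<tau> x 2\<bar> \<le> C * \<bar>\<tau>\<bar> ^ Suc m * (norm x)\<^sup>2"
      if \<tau>: "\<bar>\<tau>\<bar> \<le> \<rho>" for \<tau> x
    proof -
      have "(\<lambda>k. a k 2 x * \<tau> ^ k - b k 2 x * \<tau> ^ k) sums (space_coeff a \<tau> x 2 - space_coeff b \<tau> x 2)"
        by (intro sums_diff has_sum_imp_sums jet_space(1)[OF ju \<tau>] jet_space(1)[OF jv \<tau>])
      moreover have "\<bar>a k 2 x * \<tau> ^ k - b k 2 x * \<tau> ^ k\<bar> \<le> (norm x)\<^sup>2 * D k * \<bar>\<tau>\<bar> ^ k" for k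
      proof -
        have "\<bar>a k 2 x - b k 2 x\<bar> \<le> (norm x)\<^sup>2 * D k"
          using jetD(4)[OF ju, of k 2 x] jetD(4)[OF jv, of k 2 x] by (simp add: D_def algebra_simps)
        then have "\<bar>a k 2 x - b k 2 x\<bar> * \<bar>\<tau>\<bar> ^ k \<le> (norm x)\<^sup>2 * D k * \<bar>\<tau>\<bar> ^ k"
          by (intro mult_right_mono) auto
        then show ?thesis by (simp add: abs_mult power_abs flip: left_diff_distrib)
      qed
      ultimately have "\<bar>(space_coeff a \<tau> x 2 - space_coeff b \<tau> x 2)
            - (\<Sum>k<Suc m. a k 2 x * \<tau> ^ k - b k 2 x * \<tau> ^ k)\<bar>
          \<le> (\<Sum>k. (norm x)\<^sup>2 * D k * \<rho> ^ k) * (\<bar>\<tau>\<bar> / \<rho>) ^ Suc m"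
        using \<tau> \<rho> D0 summable_mult[OF sD, of "(norm x)\<^sup>2"]
        by (intro series_tail_bound) (auto simp: mult.assoc)
      moreover have "(\<Sum>k<Suc m. a k 2 x * \<tau> ^ k - b k 2 x * \<tau> ^ k) = 0"
        using low by (intro sum.neutral) auto
      moreover have "(\<Sum>k. (norm x)\<^sup>2 * D k * \<rho> ^ k) = (norm x)\<^sup>2 * (\<Sum>k. D k * \<rho> ^ k)"
        using suminf_mult[OF sD, of "(norm x)\<^sup>2"] by (simp add: mult.assoc)
      ultimately show ?thesis by (simp add: C_def power_divide mult_ac)
    qed
    define f where "f k = a k 0 0 - b k 0 0" for k
    have sf: "summable (\<lambda>k. \<bar>f k\<bar> * \<rho> ^ k)"
    proof (rule summable_comparison_test)
      show "summable (\<lambda>k. \<bar>a k 0 0\<bar> * \<rho> ^ k + \<bar>b k 0 0\<bar> * \<rho> ^ k)"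
        by (intro summable_add jet_summable_center[OF ju] jet_summable_center[OF jv])
      show "\<exists>N. \<forall>n\<ge>N. norm (\<bar>f n\<bar> * \<rho> ^ n) \<le> \<bar>a n 0 0\<bar> * \<rho> ^ n + \<bar>b n 0 0\<bar> * \<rho> ^ n"
        using \<rho> by (auto simp: f_def abs_mult simp flip: distrib_right intro!: mult_right_mono)
    qed
    note sdf = summable_diffs_half[OF \<rho> sf]
    define M where "M = (\<Sum>k. \<bar>diffs f k\<bar> * (\<rho> / 2) ^ k) / (\<rho> / 2) ^ Suc m"
    have f0: "f j = 0" if "j \<le> m" for j using low[OF that, of 0 0] by (simp add: f_def)
    \<comment> \<open>The same cancellation makes \<open>diffs f m\<close>, a multiple of
      \<open>f (Suc m)\<close>, the leading coefficient. It stands at order \<open>m\<close>, one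
      below the order of the Hessian difference, and this gap forces it to vanish.\<close>
    have time: "\<bar>diffs f m\<bar> * \<bar>\<tau>\<bar> ^ m \<le> \<bar>(\<Sum>k. diffs f k * \<tau> ^ k)\<bar> + M * \<bar>\<tau>\<bar> ^ Suc m"
      if \<tau>: "\<bar>\<tau>\<bar> \<le> \<rho> / 2" for \<tau>
    proof -
      have "\<bar>(\<Sum>k. diffs f k * \<tau> ^ k) - (\<Sum>k<Suc m. diffs f k * \<tau> ^ k)\<bar>
         \<le> (\<Sum>k. \<bar>diffs f k\<bar> * (\<rho> / 2) ^ k) * (\<bar>\<tau>\<bar> / (\<rho> / 2)) ^ Suc m"
        using \<rho> \<tau> sdf summable_sums[OF summable_abs_powser[OF sdf \<tau>]]
        by (intro series_tail_bound) (auto simp: abs_mult power_abs)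
      also have "\<dots> = M * \<bar>\<tau>\<bar> ^ Suc m" by (simp only: M_def power_divide times_divide_eq_right times_divide_eq_left)
      finally have "\<bar>(\<Sum>k. diffs f k * \<tau> ^ k) - (\<Sum>k<Suc m. diffs f k * \<tau> ^ k)\<bar> \<le> M * \<bar>\<tau>\<bar> ^ Suc m" .
      moreover have "(\<Sum>k<Suc m. diffs f k * \<tau> ^ k) = diffs f m * \<tau> ^ m"
        using f0 by (simp add: diffs_def)
      ultimately have "\<bar>diffs f m * \<tau> ^ m\<bar> \<le> \<bar>(\<Sum>k. diffs f k * \<tau> ^ k)\<bar> + M * \<bar>\<tau>\<bar> ^ Suc m"
        by linarith
      then show ?thesis by (simp add: abs_mult power_abs)
    qed
    define K where "K = Lam * real CARD('n) * (2 * C) + M"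
    have "\<bar>diffs f m\<bar> \<le> 0"
    proof (rule le_0_if_le_small)
      show "0 < min (\<rho> / 2) (- T)" using \<rho> T by simp
      fix s :: real assume s: "0 < s" "s < min (\<rho> / 2) (- T)"
      define \<tau> where "\<tau> = - s"
      have \<tau>: "\<tau> < 0" "\<bar>\<tau>\<bar> < \<rho>" "\<bar>\<tau>\<bar> \<le> \<rho>" "\<bar>\<tau>\<bar> \<le> \<rho> / 2" "T < \<tau>" "\<bar>\<tau>\<bar> = s" using s \<rho> by (auto simp: \<tau>_def)
      have su: "solves_at F u (\<tau>, y)" and sv: "solves_at F v (\<tau>, y)"
        using u[OF \<tau>(5) _ y] v[OF \<tau>(5) _ y] \<tau>(1) by auto
      obtain r1 a1 A1 where j1: "jet u (0 + \<tau>, y) r1 a1 A1"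
        using su unfolding solves_at_def by auto
      obtain r2 b1 B1 where j2: "jet v (0 + \<tau>, y) r2 b1 B1"
        using sv unfolding solves_at_def by auto
      obtain H1 where H1: "symmetric_mat H1" "\<And>x. a1 0 2 x = x \<bullet> (H1 *v x)" using jetD(7)[OF j1] by metis
      obtain H2 where H2: "symmetric_mat H2" "\<And>x. b1 0 2 x = x \<bullet> (H2 *v x)" using jetD(7)[OF j2] by metis
      have "a1 1 0 0 = F (2 *\<^sub>R H1)" "b1 1 0 0 = F (2 *\<^sub>R H2)"
        using solves_at_jet[OF su, of r1 a1 A1 H1] solves_at_jet[OF sv, of r2 b1 B1 H2] j1 j2 H1 H2 \<tau>(1) by auto
      moreover have "\<bar>F (2 *\<^sub>R H1) - F (2 *\<^sub>R H2)\<bar> \<le> Lam * real CARD('n) * (2 * (C * s ^ Suc m))"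
      proof (rule elliptic_lipschitz[OF F])
        show "0 \<le> 2 * (C * s ^ Suc m)"
          using s \<rho> D0 suminf_nonneg[OF sD] by (auto simp: C_def)
        fix x :: "real^'n"
        have "a1 0 2 x = space_coeff a \<tau> x 2" "b1 0 2 x = space_coeff b \<tau> x 2"
          using jet_shift_time[OF ju j1 \<tau>(3)] jet_shift_time[OF jv j2 \<tau>(3)] \<tau>(1) by auto
        then have "\<bar>x \<bullet> (H1 *v x) - x \<bullet> (H2 *v x)\<bar> \<le> C * s ^ Suc m * (norm x)\<^sup>2"
          using hess[OF \<tau>(3), of x] H1(2)[of x] H2(2)[of x] \<tau>(6) by simp
        then show "\<bar>x \<bullet> ((2 *\<^sub>R H1) *v x) - x \<bullet> ((2 *\<^sub>R H2) *v x)\<bar> \<le> 2 * (C * s ^ Suc m) * (norm x)\<^sup>2"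
          unfolding scaleR_matrix_vector_assoc[symmetric] inner_scaleR_right by linarith
      qed (use H1 H2 in \<open>auto intro: symmetric_mat_scale\<close>)
      moreover have "a1 1 0 0 - b1 1 0 0 = (\<Sum>k. diffs f k * \<tau> ^ k)"
      proof -
        have "diffs f k * \<tau> ^ k = diffs (\<lambda>k. a k 0 0) k * \<tau> ^ k - diffs (\<lambda>k. b k 0 0) k * \<tau> ^ k" for k
          by (simp add: diffs_def f_def algebra_simps)
        moreover have "summable (\<lambda>k. diffs (\<lambda>k. a k 0 0) k * \<tau> ^ k)" "summable (\<lambda>k. diffs (\<lambda>k. b k 0 0) k * \<tau> ^ k)"
          using summable_abs_powser[OF summable_diffs_half[OF \<rho> jet_summable_center[OF ju]] \<tau>(4)]
            summable_abs_powser[OF summable_diffs_half[OF \<rho> jet_summable_center[OF jv]] \<tau>(4)] by auto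
        ultimately show ?thesis
          using jet_shift_time_deriv[OF ju j1 \<tau>(2)] jet_shift_time_deriv[OF jv j2 \<tau>(2)] \<tau>(1)
          by (simp add: suminf_diff)
      qed
      ultimately have "\<bar>(\<Sum>k. diffs f k * \<tau> ^ k)\<bar> \<le> Lam * real CARD('n) * (2 * (C * s ^ Suc m))" by simp
      then have "\<bar>diffs f m\<bar> * s ^ m \<le> Lam * real CARD('n) * (2 * (C * s ^ Suc m)) + M * s ^ Suc m"
        using time[OF \<tau>(4)] \<tau>(6) by simp
      also have "\<dots> = K * s * s ^ m" by (simp add: K_def algebra_simps)
      finally show "\<bar>diffs f m\<bar> \<le> K * s" using s by simp
    qed
    then have "f (Suc m) = 0" by (simp add: diffs_def)
    then show ?thesis by (simp add: f_def Suc)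
  qed
qed

text \<open>Continuation in time at a fixed \<open>y\<close>. At the supremum \<open>m\<close> of
  the times of disagreement the time coefficients coincide: by \<open>solution_coeff_unique\<close>
  if \<open>m = 0\<close>, and otherwise because \<open>u\<close> and \<open>v\<close> agree just
  after \<open>m\<close>. The common expansion then forces agreement on an interval before
  \<open>m\<close>, where some disagreement must lie.\<close>

lemma solution_unique:
  fixes F :: "real^'n^'n \<Rightarrow> real"
  assumes F: "uniformly_elliptic lam Lam F" "0 < lam" and X: "open X"
    and u: "\<And>t y. T < t \<Longrightarrow> t \<le> 0 \<Longrightarrow> y \<in> X \<Longrightarrow> solves_at F u (t, y)"
    and v: "\<And>t y. T < t \<Longrightarrow> t \<le> 0 \<Longrightarrow> y \<in> X \<Longrightarrow> solves_at F v (t, y)"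
    and uv: "\<And>y. y \<in> X \<Longrightarrow> u (0, y) = v (0, y)"
    and t: "T < t" "t \<le> 0" and y: "y \<in> X"
  shows "u (t, y) = v (t, y)"
proof (rule ccontr)
  assume neq: "u (t, y) \<noteq> v (t, y)"
  define S where "S = {s. T < s \<and> s \<le> 0 \<and> u (s, y) \<noteq> v (s, y)}"
  have S: "t \<in> S" "bdd_above S" using neq t by (auto simp: S_def intro!: bdd_aboveI[of _ 0])
  define m where "m = Sup S"
  have m: "t \<le> m" "m \<le> 0" using S by (auto simp: m_def S_def intro!: cSup_upper cSup_least)
  have after: "u (s, y) = v (s, y)" if "m < s" "s \<le> 0" for s
    using cSup_upper[OF _ S(2), of s] that m t unfolding m_def[symmetric] by (force simp: S_def)
  obtain r1 a A where j1: "jet u (m, y) r1 a A"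
    using u[of m y] m t y unfolding solves_at_def by auto
  obtain r2 b B where j2: "jet v (m, y) r2 b B"
    using v[of m y] m t y unfolding solves_at_def by auto
  define \<rho> where "\<rho> = min r1 r2"
  have \<rho>: "0 < \<rho>" using jetD(1)[OF j1] jetD(1)[OF j2] by (simp add: \<rho>_def)
  have ju: "jet u (m, y) \<rho> a A" and jv: "jet v (m, y) \<rho> b B"
    using jet_shrink[OF j1 \<rho>] jet_shrink[OF j2 \<rho>] by (auto simp: \<rho>_def)
  have eq: "a k 0 0 = b k 0 0" for k
  proof (cases "m = 0")
    case True
    have ju0: "jet u (0, y) \<rho> a A" and jv0: "jet v (0, y) \<rho> b B" using ju jv True by auto
    show ?thesis
      by (rule solution_coeff_unique[OF F X _ u v uv y ju0 jv0]) (use t in auto)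
  next
    case False
    show ?thesis
    proof (rule powser_unique_right[where \<delta> = "min \<rho> (- m)" and v = "\<lambda>s. u (m + s, y)"
          and f = "\<lambda>k. a k 0 0" and g = "\<lambda>k. b k 0 0"])
      show "0 < min \<rho> (- m)" using \<rho> False m by simp
      fix s assume "0 < s" "s < min \<rho> (- m)"
      then show "(\<lambda>k. a k 0 0 * s ^ k) sums u (m + s, y)" "(\<lambda>k. b k 0 0 * s ^ k) sums u (m + s, y)"
        using jet_time_center[OF ju, of s] jet_time_center[OF jv, of s] after[of "m + s"] by auto
    qed
  qed
  have "m - \<rho> < Sup S" using \<rho> by (simp add: m_def)
  then obtain s where s: "s \<in> S" "m - \<rho> < s"
    using less_cSupD[of S] S(1) by blast
  have "s \<le> m" using cSup_upper[OF s(1) S(2)] by (simp add: m_def)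
  then have "(\<lambda>k. a k 0 0 * (s - m) ^ k) sums u (s, y)" "(\<lambda>k. b k 0 0 * (s - m) ^ k) sums v (s, y)"
    using jet_time_center[OF ju, of "s - m"] jet_time_center[OF jv, of "s - m"] s(2) m by auto
  then have "u (s, y) = v (s, y)" unfolding eq by (rule sums_unique2)
  then show False using s(1) by (simp add: S_def)
qed

subsection \<open>Parabolic homogeneity\<close>

lemma solves_at_cong:
  assumes "solves_at F u (t, y)" "0 < e"
    and "\<And>\<tau> x. \<bar>\<tau>\<bar> \<le> e \<Longrightarrow> norm x \<le> e \<Longrightarrow> t + \<tau> \<le> 0 \<Longrightarrow> v (t + \<tau>, y + x) = u (t + \<tau>, y + x)"
  shows "solves_at F v (t, y)"
proof -
  obtain \<rho> a A where j: "jet u (t, y) \<rho> a A"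
    and s: "\<forall>H. symmetric_mat H \<longrightarrow> (\<forall>x. a 0 2 x = x \<bullet> (H *v x)) \<longrightarrow> a 1 0 0 = F (2 *\<^sub>R H)"
    using assms(1) unfolding solves_at_def by blast
  have "jet u (t, y) (min \<rho> e) a A" by (rule jet_shrink[OF j]) (use jetD(1)[OF j] assms(2) in auto)
  then have "jet v (t, y) (min \<rho> e) a A" by (rule jet_cong) (use assms(3) in auto)
  then show ?thesis using s unfolding solves_at_def by blast
qed

text \<open>The term of bidegree \<open>(k, n)\<close> picks up the factor
  \<open>s ^ (2 * k + n) / s\<^sup>2\<close>, which is 1 for \<open>(1, 0)\<close> and
  \<open>(0, 2)\<close>, the two that enter the equation. Restricting to \<open>s \<le> 1\<close>
  keeps the radius.\<close>

lemma jet_scale: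
  assumes j: "jet u (s\<^sup>2 * t, s *\<^sub>R y) \<rho> a A" and s: "0 < s" "s \<le> 1"
  shows "jet (\<lambda>(t, x). u (s\<^sup>2 * t, s *\<^sub>R x) / s\<^sup>2) (t, y) \<rho>
     (\<lambda>k n x. s ^ (2 * k + n) / s\<^sup>2 * a k n x) (\<lambda>k n. s ^ (2 * k + n) / s\<^sup>2 * A k n)"
  unfolding jet_def
proof (intro conjI allI impI)
  show "0 < \<rho>" using jetD(1)[OF j] .
  have "(\<lambda>(k, n). 1 / s\<^sup>2 * (A k n * \<rho> ^ (k + n))) summable_on UNIV"
    using summable_on_cmult_right[OF jetD(2)[OF j], of "1 / s\<^sup>2"] by (simp add: case_prod_unfold)
  then show "(\<lambda>(k, n). s ^ (2 * k + n) / s\<^sup>2 * A k n * \<rho> ^ (k + n)) summable_on UNIV"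
  proof (rule summable_on_comparison_test, clarify)
    fix k n
    have "s ^ (2 * k + n) / s\<^sup>2 * (A k n * \<rho> ^ (k + n)) \<le> 1 / s\<^sup>2 * (A k n * \<rho> ^ (k + n))"
      using s jetD(1,3)[OF j] by (intro mult_right_mono divide_right_mono power_le_one) auto
    then show "s ^ (2 * k + n) / s\<^sup>2 * A k n * \<rho> ^ (k + n) \<le> 1 / s\<^sup>2 * (A k n * \<rho> ^ (k + n))"
      by (simp add: mult.assoc)
  qed (use s jetD(1,3)[OF j] in auto)
  show "0 \<le> s ^ (2 * k + n) / s\<^sup>2 * A k n" for k n using s jetD(3)[OF j] by simp
  show "\<bar>s ^ (2 * k + n) / s\<^sup>2 * a k n x\<bar> \<le> s ^ (2 * k + n) / s\<^sup>2 * A k n * norm x ^ n" for k n x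
    using mult_left_mono[OF jetD(4)[OF j, of k n x], of "s ^ (2 * k + n) / s\<^sup>2"] s
    by (simp add: abs_mult mult.assoc)
  show "s ^ (2 * k + n) / s\<^sup>2 * a k n (c *\<^sub>R x) = c ^ n * (s ^ (2 * k + n) / s\<^sup>2 * a k n x)" for k n c x
    by (simp add: jetD(5)[OF j])
  show "\<exists>b. \<forall>x. s ^ (2 * k + 1) / s\<^sup>2 * a k 1 x = b \<bullet> x" for k
  proof -
    obtain b where b: "\<And>x. a k 1 x = b \<bullet> x" using jetD(6)[OF j] by metis
    show ?thesis unfolding b by (rule exI[of _ "(s ^ (2 * k + 1) / s\<^sup>2) *\<^sub>R b"]) simp
  qed
  show "\<exists>H. symmetric_mat H \<and> (\<forall>x. s ^ (2 * k + 2) / s\<^sup>2 * a k 2 x = x \<bullet> (H *v x))" for k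
  proof -
    obtain H where H: "symmetric_mat H" "\<And>x. a k 2 x = x \<bullet> (H *v x)" using jetD(7)[OF j] by metis
    show ?thesis unfolding H(2)
      by (rule exI[of _ "(s ^ (2 * k + 2) / s\<^sup>2) *\<^sub>R H"])
         (simp add: H(1) symmetric_mat_scale scaleR_matrix_vector_assoc[symmetric])
  qed
  fix \<tau> :: real and x :: "real^'a"
  assume h: "\<bar>\<tau>\<bar> \<le> \<rho>" "norm x \<le> \<rho>" "fst (t, y) + \<tau> \<le> 0"
  have "\<bar>s\<^sup>2 * \<tau>\<bar> \<le> 1 * \<rho>" unfolding abs_mult using h s by (intro mult_mono) (auto simp: power_le_one)
  moreover have "norm (s *\<^sub>R x) \<le> 1 * \<rho>" unfolding norm_scaleR using h s by (intro mult_mono) auto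
  moreover have "s\<^sup>2 * (t + \<tau>) \<le> 0" using h(3) by (simp add: mult_nonneg_nonpos)
  ultimately have "((\<lambda>(k, n). a k n (s *\<^sub>R x) * (s\<^sup>2 * \<tau>) ^ k) has_sum
      u (s\<^sup>2 * t + s\<^sup>2 * \<tau>, s *\<^sub>R y + s *\<^sub>R x)) UNIV"
    by (intro jet_has_sum[OF j]) (auto simp: distrib_left)
  then have "((\<lambda>(k, n). a k n (s *\<^sub>R x) * (s\<^sup>2 * \<tau>) ^ k) has_sum
      u (s\<^sup>2 * (t + \<tau>), s *\<^sub>R (y + x))) UNIV"
    by (simp add: distrib_left scaleR_add_right)
  from has_sum_cmult_right[OF this, of "1 / s\<^sup>2"]
  show "((\<lambda>(k, n). s ^ (2 * k + n) / s\<^sup>2 * a k n x * \<tau> ^ k) has_sum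
      (case (fst (t, y) + \<tau>, snd (t, y) + x) of (t, x) \<Rightarrow> u (s\<^sup>2 * t, s *\<^sub>R x) / s\<^sup>2)) UNIV"
    by (simp add: jetD(5)[OF j] case_prod_unfold power_mult_distrib power_add mult_ac flip: power_mult)
qed

lemma solves_at_scale:
  assumes "solves_at F u (s\<^sup>2 * t, s *\<^sub>R y)" and s: "0 < s" "s \<le> 1"
  shows "solves_at F (\<lambda>(t, x). u (s\<^sup>2 * t, s *\<^sub>R x) / s\<^sup>2) (t, y)"
proof -
  obtain \<rho> a A where j: "jet u (s\<^sup>2 * t, s *\<^sub>R y) \<rho> a A"
    and eq: "\<forall>H. symmetric_mat H \<longrightarrow> (\<forall>x. a 0 2 x = x \<bullet> (H *v x)) \<longrightarrow> a 1 0 0 = F (2 *\<^sub>R H)"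
    using assms(1) unfolding solves_at_def by blast
  show ?thesis
    unfolding solves_at_def
  proof (intro exI conjI)
    show "jet (\<lambda>(t, x). u (s\<^sup>2 * t, s *\<^sub>R x) / s\<^sup>2) (t, y) \<rho>
     (\<lambda>k n x. s ^ (2 * k + n) / s\<^sup>2 * a k n x) (\<lambda>k n. s ^ (2 * k + n) / s\<^sup>2 * A k n)"
      by (rule jet_scale[OF j s])
  qed (use eq s in \<open>simp add: power2_eq_square\<close>)
qed

lemma analytic_imp_jet:
  fixes u :: "real \<times> (real^'n) \<Rightarrow> real"
  assumes p: "(t, y) \<in> Q1" "open U" "(t, y) \<in> U" "real_analytic_on g U"
    and eq: "\<And>q. q \<in> U \<inter> Q1 \<Longrightarrow> u q = g q"
  shows "\<exists>\<rho> a A. jet u (t, y) \<rho> a A"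
proof -
  obtain \<rho> a A where j: "jet g (t, y) \<rho> a A"
    using real_analytic_imp_jet[of g "(t, y)"] assms unfolding real_analytic_on_def by blast
  obtain e where e: "0 < e" "ball (t, y) e \<subseteq> U" using assms(2,3) by (meson openE)
  have ty: "-1 < t" "norm y < 1" using p(1) by (auto simp: Q1_def)
  \<comment> \<open>The first pair of bounds stays within the jet and within \<open>U\<close>, the
    second pair within \<open>Q1\<close>; the upper bound on time is supplied by
    \<open>t + \<tau> \<le> 0\<close>.\<close>
  define r where "r = min (min \<rho> (e / 3)) (min ((1 + t) / 2) ((1 - norm y) / 2))"
  have r: "0 < r" "r \<le> \<rho>" "r \<le> e / 3" "r \<le> (1 + t) / 2" "r \<le> (1 - norm y) / 2"
    using e ty jetD(1)[OF j] unfolding r_def by (simp, linarith+)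
  have "jet u (t, y) r a A"
  proof (rule jet_cong[OF jet_shrink[OF j r(1,2)]])
    fix \<tau> :: real and x :: "real^'n" assume h: "\<bar>\<tau>\<bar> \<le> r" "norm x \<le> r" "t + \<tau> \<le> 0"
    have "dist (t + \<tau>, y + x) (t, y) < e"
      using dist_shift_le[of "(t, y)" \<tau> x] h r e by simp
    then have "(t + \<tau>, y + x) \<in> U" using e(2) by (auto simp: dist_commute)
    moreover have "norm (y + x) < 1" using norm_triangle_ineq[of y x] h(2) r(5) ty(2) by argo
    then have "(t + \<tau>, y + x) \<in> Q1" using h r ty by (auto simp: Q1_def)
    ultimately show "u (t + \<tau>, y + x) = g (t + \<tau>, y + x)" using eq by simp
  qed
  then show ?thesis by blast
qed

lemma Q1_iff: "(t, y) \<in> Q1 \<longleftrightarrow> -1 < t \<and> t \<le> 0 \<and> norm y < 1"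
  by (auto simp: Q1_def)

lemma Q1_scale: "(t, y) \<in> Q1 \<Longrightarrow> 0 < s \<Longrightarrow> s \<le> 1 \<Longrightarrow> (s\<^sup>2 * t, s *\<^sub>R y) \<in> Q1"
proof -
  assume h: "(t, y) \<in> Q1" "0 < s" "s \<le> 1"
  then have ty: "-1 < t" "t \<le> 0" "norm y < 1" by (auto simp: Q1_iff)
  have "s\<^sup>2 * (- t) \<le> 1 * (- t)" using h ty by (intro mult_right_mono power_le_one) auto
  moreover have "s * norm y \<le> 1 * norm y" using h by (intro mult_right_mono) auto
  ultimately show ?thesis using h ty by (auto simp: Q1_iff mult_nonneg_nonpos)
qed

text \<open>Uniqueness against the rescaled solution is applied on the punctured ball, because
  analyticity is not given at the origin at time 0. The axis \<open>y = 0\<close> is then reached by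
  continuity in space.\<close>

lemma solution_parabolic_homogeneous:
  fixes F :: "real^'n^'n \<Rightarrow> real"
  assumes F: "uniformly_elliptic lam Lam F" "0 < lam" and cont: "continuous_on Q1 u"
    and sol: "\<And>p. p \<in> Q1 - {(0, 0)} \<Longrightarrow> solves_at F u p"
    and hom: "\<And>a x. 0 < a \<Longrightarrow> x \<in> ball 0 1 \<Longrightarrow> a *\<^sub>R x \<in> ball 0 1 \<Longrightarrow> u (0, a *\<^sub>R x) = a\<^sup>2 * u (0, x)"
    and ty: "(t, y) \<in> Q1" and s: "0 < s" "s \<le> 1"
  shows "u (s\<^sup>2 * t, s *\<^sub>R y) = s\<^sup>2 * u (t, y)"
proof -
  have off: "u (s\<^sup>2 * t, s *\<^sub>R y) = s\<^sup>2 * u (t, y)" if "-1 < t" "t \<le> 0" "y \<in> ball 0 1 - {0}" for t y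
  proof -
    have "u (t, y) = (\<lambda>(t, x). u (s\<^sup>2 * t, s *\<^sub>R x) / s\<^sup>2) (t, y)"
    proof (rule solution_unique[OF F, where X = "ball 0 1 - {0}" and T = "-1"])
      show "open (ball (0 :: real^'n) 1 - {0})" by (intro open_Diff) auto
      fix t :: real and y :: "real^'n" assume h: "-1 < t" "t \<le> 0" "y \<in> ball 0 1 - {0}"
      then have Q: "(t, y) \<in> Q1" by (auto simp: Q1_iff)
      show "solves_at F u (t, y)" using Q h by (intro sol) auto
      show "solves_at F (\<lambda>(t, x). u (s\<^sup>2 * t, s *\<^sub>R x) / s\<^sup>2) (t, y)"
        by (intro solves_at_scale[OF _ s] sol) (use Q1_scale[OF Q s] h s in auto)
    next
      fix y :: "real^'n" assume y: "y \<in> ball 0 1 - {0}"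
      then have "(0, y) \<in> Q1" by (auto simp: Q1_iff)
      from Q1_scale[OF this s] have "s *\<^sub>R y \<in> ball 0 1" by (auto simp: Q1_iff)
      then show "u (0, y) = (\<lambda>(t, x). u (s\<^sup>2 * t, s *\<^sub>R x) / s\<^sup>2) (0, y)"
        using hom[OF s(1), of y] y s by simp
    qed (use that in auto)
    then show ?thesis using s by simp
  qed
  show ?thesis
  proof (cases "y = 0")
    case False
    then show ?thesis using off[of t y] ty by (auto simp: Q1_iff)
  next
    case True
    define f where "f x = u (s\<^sup>2 * t, s *\<^sub>R x) - s\<^sup>2 * u (t, x)" for x
    have Q: "(t, x) \<in> Q1" "(s\<^sup>2 * t, s *\<^sub>R x) \<in> Q1" if "x \<in> ball 0 1" for x :: "real^'n"
    proof -
      show "(t, x) \<in> Q1" using ty that by (auto simp: Q1_iff)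
      then show "(s\<^sup>2 * t, s *\<^sub>R x) \<in> Q1" by (rule Q1_scale[OF _ s])
    qed
    have "continuous_on (ball 0 1) f"
      unfolding f_def
      by (intro continuous_intros continuous_on_compose2[OF cont]) (use Q in auto)
    then have "isCont f 0" by (simp add: continuous_on_eq_continuous_at)
    then have "(f \<longlongrightarrow> f 0) (at 0)" by (simp add: isCont_def)
    moreover have "(f \<longlongrightarrow> 0) (at 0)"
    proof (rule tendsto_eventually)
      show "\<forall>\<^sub>F x in at 0. f x = 0"
        unfolding eventually_at
        using off[of t] ty by (intro exI[of _ 1]) (auto simp: Q1_iff f_def)
    qed
    ultimately have "f 0 = 0" using tendsto_unique[OF at_neq_bot] by blast
    then show ?thesis using True by (simp add: f_def)
  qed
qed

text \<open>A point is scaled into \<open>Q1\<close> and the value found there is scaled back;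
  \<open>compare\<close> shows that the result does not depend on the factor.\<close>

lemma homogeneous_extension:
  fixes F :: "real^'n^'n \<Rightarrow> real"
  assumes sol: "\<And>p. p \<in> Q1 - {(0, 0)} \<Longrightarrow> solves_at F u p"
    and hom: "\<And>t y s. (t, y) \<in> Q1 \<Longrightarrow> 0 < s \<Longrightarrow> s \<le> 1 \<Longrightarrow> u (s\<^sup>2 * t, s *\<^sub>R y) = s\<^sup>2 * u (t, y)"
  obtains U where "\<And>p. p \<in> Q1 \<Longrightarrow> U p = u p"
    "\<And>t y s. t \<le> 0 \<Longrightarrow> 0 < s \<Longrightarrow> U (s\<^sup>2 * t, s *\<^sub>R y) = s\<^sup>2 * U (t, y)"
    "\<And>t y. t \<le> 0 \<Longrightarrow> (t, y) \<noteq> (0, 0) \<Longrightarrow> solves_at F U (t, y)"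
proof -
  define sc where "sc t y = 1 / (1 + \<bar>t\<bar> + norm y)" for t :: real and y :: "real^'n"
  define U where "U = (\<lambda>(t, y). u ((sc t y)\<^sup>2 * t, sc t y *\<^sub>R y) / (sc t y)\<^sup>2)"
  have inQ: "(s\<^sup>2 * t, s *\<^sub>R y) \<in> Q1" if "t \<le> 0" "0 < s" "s * \<bar>t\<bar> < 1" "s * norm y < 1" "s \<le> 1" for s t y
  proof -
    have "s * (s * \<bar>t\<bar>) \<le> 1 * (s * \<bar>t\<bar>)" using that(2,5) by (intro mult_right_mono) auto
    also have "\<dots> < 1" using that(3) by simp
    finally have "- (s\<^sup>2 * t) < 1" using that(1) by (simp add: power2_eq_square mult.assoc)
    moreover have "s\<^sup>2 * t \<le> 0" using that(1) by (intro mult_nonneg_nonpos) auto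
    ultimately show ?thesis using that by (auto simp: Q1_iff)
  qed
  have sc: "0 < sc t y" "sc t y \<le> 1" "sc t y * \<bar>t\<bar> < 1" "sc t y * norm y < 1" for t y
  proof -
    have pos: "0 < 1 + \<bar>t\<bar> + norm y" by (simp add: add_pos_nonneg)
    then show "0 < sc t y" "sc t y \<le> 1" "sc t y * \<bar>t\<bar> < 1" "sc t y * norm y < 1"
      by (auto simp: sc_def divide_simps add_pos_nonneg)
  qed
  have compare: "u (s\<^sup>2 * t, s *\<^sub>R y) / s\<^sup>2 = u (r\<^sup>2 * t, r *\<^sub>R y) / r\<^sup>2"
    if h: "0 < s" "s \<le> r" "(r\<^sup>2 * t, r *\<^sub>R y) \<in> Q1" for s r t y
  proof -
    have "u ((s / r)\<^sup>2 * (r\<^sup>2 * t), (s / r) *\<^sub>R r *\<^sub>R y) = (s / r)\<^sup>2 * u (r\<^sup>2 * t, r *\<^sub>R y)"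
      using h by (intro hom) auto
    moreover have "(s / r)\<^sup>2 * (r\<^sup>2 * t) = s\<^sup>2 * t" "(s / r) *\<^sub>R r *\<^sub>R y = s *\<^sub>R y"
      using h by (auto simp: power_divide)
    ultimately show ?thesis using h by (simp add: power_divide)
  qed
  have U: "U (t, y) = u (s\<^sup>2 * t, s *\<^sub>R y) / s\<^sup>2" if "t \<le> 0" "0 < s" "(s\<^sup>2 * t, s *\<^sub>R y) \<in> Q1" for t y s
  proof -
    have "((sc t y)\<^sup>2 * t, sc t y *\<^sub>R y) \<in> Q1" by (rule inQ[OF that(1) sc(1) sc(3) sc(4) sc(2)])
    note Q = this
    have Ueq: "U (t, y) = u ((sc t y)\<^sup>2 * t, sc t y *\<^sub>R y) / (sc t y)\<^sup>2" by (simp add: U_def)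
    show ?thesis
    proof (cases "s \<le> sc t y")
      case True
      show ?thesis unfolding Ueq by (rule compare[OF that(2) True Q, symmetric])
    next
      case False
      then show ?thesis unfolding Ueq by (intro compare[OF sc(1) _ that(3)]) simp
    qed
  qed
  show ?thesis
  proof (rule that)
    fix p :: "real \<times> (real^'n)" assume "p \<in> Q1"
    then show "U p = u p" using U[of "fst p" 1 "snd p"] by (cases p) (auto simp: Q1_iff)
  next
    fix t s :: real and y :: "real^'n" assume h: "t \<le> 0" "0 < s"
    define r where "r = sc (s\<^sup>2 * t) (s *\<^sub>R y)"
    have st: "s\<^sup>2 * t \<le> 0" using h by (simp add: mult_nonneg_nonpos)
    have r: "0 < r" "(r\<^sup>2 * (s\<^sup>2 * t), r *\<^sub>R s *\<^sub>R y) \<in> Q1"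
      unfolding r_def using sc inQ st by blast+
    have "U (t, y) = u ((r * s)\<^sup>2 * t, (r * s) *\<^sub>R y) / (r * s)\<^sup>2"
      using r h by (intro U) (auto simp: power_mult_distrib mult.assoc)
    moreover have "U (s\<^sup>2 * t, s *\<^sub>R y) = u (r\<^sup>2 * (s\<^sup>2 * t), r *\<^sub>R s *\<^sub>R y) / r\<^sup>2"
      using r st by (intro U) auto
    ultimately show "U (s\<^sup>2 * t, s *\<^sub>R y) = s\<^sup>2 * U (t, y)"
      using h r(1) by (simp add: power_mult_distrib mult.assoc)
  next
    fix t :: real and y :: "real^'n" assume h: "t \<le> 0" "(t, y) \<noteq> (0, 0)"
    \<comment> \<open>Unlike \<open>sc\<close>, this factor is held fixed on a whole neighbourhood.
      The 3 leaves room for displacements of size 1, so near \<open>(t, y)\<close> the extension is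
      one single rescaling of \<open>u\<close>.\<close>
    define s where "s = 1 / (3 + \<bar>t\<bar> + norm y)"
    have pos: "0 < 3 + \<bar>t\<bar> + norm y" by (simp add: add_pos_nonneg)
    then have s: "0 < s" "s \<le> 1" using norm_ge_zero[of y] by (auto simp: s_def divide_simps)
    have near: "(s\<^sup>2 * (t + \<tau>), s *\<^sub>R (y + x)) \<in> Q1"
      if "\<bar>\<tau>\<bar> \<le> 1" "norm x \<le> 1" "t + \<tau> \<le> 0" for \<tau> x
    proof (rule inQ[OF that(3) s(1) _ _ s(2)])
      have "\<bar>t + \<tau>\<bar> < 3 + \<bar>t\<bar> + norm y" "norm (y + x) < 3 + \<bar>t\<bar> + norm y"
        using that norm_triangle_ineq[of y x] norm_ge_zero[of y] by linarith+
      then show "s * \<bar>t + \<tau>\<bar> < 1" "s * norm (y + x) < 1" using pos by (auto simp: s_def)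
    qed
    have "(s\<^sup>2 * t, s *\<^sub>R y) \<in> Q1 - {(0, 0)}" using near[of 0 0] h s by auto
    from solves_at_scale[OF sol[OF this] s]
    show "solves_at F U (t, y)"
    proof (rule solves_at_cong[where e = 1])
      fix \<tau> :: real and x :: "real^'n" assume "\<bar>\<tau>\<bar> \<le> 1" "norm x \<le> 1" "t + \<tau> \<le> 0"
      then show "U (t + \<tau>, y + x) = (case (t + \<tau>, y + x) of (t, x) \<Rightarrow> u (s\<^sup>2 * t, s *\<^sub>R x) / s\<^sup>2)"
        using U[OF _ s(1) near] by simp
    qed simp
  qed
qed

subsection \<open>The time derivative of a self-similar solution\<close>

text \<open>The bound covers all nearby negative times even if \<open>t = 0\<close>, so the time
  derivative stays bounded up to the terminal time. Uniformity in \<open>x\<close> comes from the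
  majorant.\<close>

lemma jet_time_deriv_bound:
  assumes jet: "jet u (t, y) \<rho> a A"
  shows "\<exists>C. \<forall>\<tau> x D. \<bar>\<tau>\<bar> < \<rho> / 2 \<longrightarrow> norm x < \<rho> \<longrightarrow> t + \<tau> < 0 \<longrightarrow>
     ((\<lambda>s. u (s, y + x)) has_real_derivative D) (at (t + \<tau>)) \<longrightarrow> \<bar>D\<bar> \<le> C"
proof -
  note \<rho> = jetD(1)[OF jet]
  define B where "B k = (\<Sum>n. A k n * \<rho> ^ n)" for k
  have B0: "0 \<le> B k" for k
    unfolding B_def
    by (intro suminf_nonneg summable_on_imp_summable jet_summable_degree(1)[OF jet])
       (use \<rho> jetD(3)[OF jet] in auto)
  have "summable (\<lambda>k. \<bar>B k\<bar> * \<rho> ^ k)"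
    using summable_on_imp_summable[OF jet_summable_degree(2)[OF jet]] B0 by (simp flip: B_def)
  from summable_diffs_half[OF \<rho> this]
  have sB: "summable (\<lambda>k. \<bar>diffs B k\<bar> * (\<rho> / 2) ^ k)" .
  show ?thesis
  proof (intro exI allI impI)
    fix \<tau> x D assume h: "\<bar>\<tau>\<bar> < \<rho> / 2" "norm x < \<rho>" "t + \<tau> < 0"
      "((\<lambda>s. u (s, y + x)) has_real_derivative D) (at (t + \<tau>))"
    have "D = (\<Sum>k. diffs (time_coeff a x) k * \<tau> ^ k)"
      using DERIV_unique[OF h(4) jet_time_deriv[OF jet, of x \<tau>]] h(1-3) \<rho> by simp
    moreover have "\<bar>diffs (time_coeff a x) k * \<tau> ^ k\<bar> \<le> \<bar>diffs B k\<bar> * (\<rho> / 2) ^ k" for k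
    proof -
      have "\<bar>time_coeff a x (Suc k)\<bar> \<le> \<bar>B (Suc k)\<bar>"
        using jet_time(2)[OF jet, of x "Suc k"] h(2) by (simp add: B_def)
      then have "\<bar>diffs (time_coeff a x) k\<bar> \<le> \<bar>diffs B k\<bar>"
        by (simp add: diffs_def abs_mult mult_left_mono del: of_nat_Suc)
      then show ?thesis
        unfolding abs_mult power_abs using h(1) by (intro mult_mono power_mono) auto
    qed
    ultimately show "\<bar>D\<bar> \<le> (\<Sum>k. \<bar>diffs B k\<bar> * (\<rho> / 2) ^ k)"
      using norm_suminf_le[OF _ sB, of "\<lambda>k. diffs (time_coeff a x) k * \<tau> ^ k"] by simp
  qed
qed

lemma self_similar_deriv:
  fixes U :: "real \<times> (real^'n) \<Rightarrow> real"
  assumes hom: "\<And>t y s. t \<le> 0 \<Longrightarrow> 0 < s \<Longrightarrow> U (s\<^sup>2 * t, s *\<^sub>R y) = s\<^sup>2 * U (t, y)"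
    and D: "((\<lambda>s. U (s, y)) has_real_derivative D) (at (-1))" and s: "0 < s"
  shows "((\<lambda>t. U (t, s *\<^sub>R y)) has_real_derivative D) (at (- (s\<^sup>2)))"
proof -
  have D': "((\<lambda>t. U (t, y)) has_real_derivative D) (at (- (s\<^sup>2) / s\<^sup>2))" using D s by simp
  have "((\<lambda>t. U (t / s\<^sup>2, y)) has_real_derivative D * (1 / s\<^sup>2)) (at (- (s\<^sup>2)))"
    by (rule DERIV_chain2[where f = "\<lambda>t. U (t, y)", OF D' DERIV_cdivide[OF DERIV_ident]])
  then have *: "((\<lambda>t. s\<^sup>2 * U (t / s\<^sup>2, y)) has_real_derivative s\<^sup>2 * (D * (1 / s\<^sup>2))) (at (- (s\<^sup>2)))"
    by (rule DERIV_cmult)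
  have "((\<lambda>t. U (t, s *\<^sub>R y)) has_real_derivative s\<^sup>2 * (D * (1 / s\<^sup>2))) (at (- (s\<^sup>2)))"
  proof (rule has_field_derivative_transform_within_open[OF *])
    show "open {..<0 :: real}" "- (s\<^sup>2) \<in> {..<0}" using s by auto
    fix t :: real assume "t \<in> {..<0}"
    then have "U (s\<^sup>2 * (t / s\<^sup>2), s *\<^sub>R y) = s\<^sup>2 * U (t / s\<^sup>2, y)"
      using s by (intro hom) (auto simp: divide_le_0_iff)
    then show "s\<^sup>2 * U (t / s\<^sup>2, y) = U (t, s *\<^sub>R y)" using s by simp
  qed
  then show ?thesis using s by simp
qed

text \<open>By self-similarity \<open>W y\<close> is the time derivative along the whole parabola
  through \<open>(-1, y)\<close>, which meets the compact cap \<open>K\<close>, a set avoiding the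
  origin. Large \<open>y\<close> meet it near time 0, where the local bounds up to the terminal time
  are needed.\<close>

lemma bounded_time_deriv:
  fixes U :: "real \<times> (real^'n) \<Rightarrow> real"
  assumes hom: "\<And>t y s. t \<le> 0 \<Longrightarrow> 0 < s \<Longrightarrow> U (s\<^sup>2 * t, s *\<^sub>R y) = s\<^sup>2 * U (t, y)"
    and jets: "\<And>t y. t \<le> 0 \<Longrightarrow> (t, y) \<noteq> (0, 0) \<Longrightarrow> \<exists>\<rho> a A. jet U (t, y) \<rho> a A"
    and W: "\<And>y. ((\<lambda>s. U (s, y)) has_real_derivative W y) (at (-1))"
  shows "\<exists>B. \<forall>y. \<bar>W y\<bar> \<le> B"
proof -
  define K :: "(real \<times> (real^'n)) set"
    where "K = ({-1..0} \<times> cball 0 1) \<inter> {p. (norm (snd p))\<^sup>2 - fst p = 1}"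
  have compact: "compact K"
    unfolding K_def
    by (intro compact_Int_closed compact_Times closed_Collect_eq continuous_intros) auto
  have "\<exists>N C. open N \<and> p \<in> N \<and> (\<forall>t y D. (t, y) \<in> N \<longrightarrow> t < 0 \<longrightarrow>
      ((\<lambda>s. U (s, y)) has_real_derivative D) (at t) \<longrightarrow> \<bar>D\<bar> \<le> C)" if "p \<in> K" for p
  proof -
    obtain t y where p: "p = (t, y)" by (cases p)
    have "t \<le> 0" "(t, y) \<noteq> (0, 0)" using that by (auto simp: K_def p)
    then obtain \<rho> a A where j: "jet U (t, y) \<rho> a A" using jets by metis
    obtain C where C: "\<And>\<tau> x D. \<bar>\<tau>\<bar> < \<rho> / 2 \<Longrightarrow> norm x < \<rho> \<Longrightarrow> t + \<tau> < 0 \<Longrightarrow>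
       ((\<lambda>s. U (s, y + x)) has_real_derivative D) (at (t + \<tau>)) \<Longrightarrow> \<bar>D\<bar> \<le> C"
      using jet_time_deriv_bound[OF j] by blast
    show ?thesis
    proof (intro exI conjI allI impI)
      show "open (ball t (\<rho> / 2) \<times> ball y \<rho>)" by (intro open_Times) auto
      show "p \<in> ball t (\<rho> / 2) \<times> ball y \<rho>" using jetD(1)[OF j] by (simp add: p)
      fix t' y' D assume h: "(t', y') \<in> ball t (\<rho> / 2) \<times> ball y \<rho>" "t' < 0"
        "((\<lambda>s. U (s, y')) has_real_derivative D) (at t')"
      show "\<bar>D\<bar> \<le> C"
        by (rule C[of "t' - t" "y' - y"]) (use h in \<open>auto simp: dist_norm norm_minus_commute abs_minus_commute\<close>)
    qed
  qed
  then obtain N C where N: "\<And>p. p \<in> K \<Longrightarrow> open (N p)" "\<And>p. p \<in> K \<Longrightarrow> p \<in> N p"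
    and C: "\<And>p t y D. p \<in> K \<Longrightarrow> (t, y) \<in> N p \<Longrightarrow> t < 0 \<Longrightarrow>
      ((\<lambda>s. U (s, y)) has_real_derivative D) (at t) \<Longrightarrow> \<bar>D\<bar> \<le> C p"
    by metis
  have "K \<subseteq> (\<Union>p\<in>K. N p)" using N(2) by blast
  then obtain K' where K': "K' \<subseteq> K" "finite K'" "K \<subseteq> (\<Union>p\<in>K'. N p)"
    using compactE_image[OF compact, of K N] N(1) by blast
  have "\<bar>W y\<bar> \<le> (\<Sum>p\<in>K'. \<bar>C p\<bar>)" for y
  proof -
    \<comment> \<open>The scale at which the parabola crosses \<open>K\<close>.\<close>
    define s where "s = 1 / sqrt (1 + (norm y)\<^sup>2)"
    have pos: "0 < 1 + (norm y)\<^sup>2" by (simp add: add_pos_nonneg)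
    have s: "0 < s" "s\<^sup>2 = 1 / (1 + (norm y)\<^sup>2)" using pos by (auto simp: s_def power_divide)
    have s1: "s\<^sup>2 * (norm y)\<^sup>2 + s\<^sup>2 = 1"
      unfolding s(2) using pos by (simp add: field_simps)
    then have "s\<^sup>2 \<le> 1" "(s * norm y)\<^sup>2 \<le> 1"
      using zero_le_power2[of s] zero_le_power2[of "s * norm y"] unfolding power_mult_distrib by linarith+
    then have "s * norm y \<le> 1" "s\<^sup>2 \<le> 1" using abs_square_le_1[of "s * norm y"] s(1) by auto
    then have "(- (s\<^sup>2), s *\<^sub>R y) \<in> K"
      using s(1) s1 by (auto simp: K_def power_mult_distrib abs_square_le_1)
    then obtain p where p: "p \<in> K'" "(- (s\<^sup>2), s *\<^sub>R y) \<in> N p" using K'(3) by blast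
    then have "\<bar>W y\<bar> \<le> C p"
      using C[OF _ p(2) _ self_similar_deriv[OF hom W s(1)]] K'(1) s(1) by auto
    also have "\<dots> \<le> \<bar>C p\<bar>" by simp
    also have "\<dots> \<le> (\<Sum>p\<in>K'. \<bar>C p\<bar>)" using p(1) K'(2) by (intro member_le_sum) auto
    finally show ?thesis .
  qed
  then show ?thesis by blast
qed

text \<open>
  Euler's relation \<open>y \<bullet> \<nabla>W = 2 w\<^sub>t\<close> for the time derivative \<open>w = U\<^sub>t\<close>, which is homogeneous of degree zero,
  read off on coefficients.
\<close>

lemma euler_identity:
  fixes U :: "real \<times> (real^'n) \<Rightarrow> real"
  assumes hom: "\<And>t y s. t \<le> 0 \<Longrightarrow> 0 < s \<Longrightarrow> U (s\<^sup>2 * t, s *\<^sub>R y) = s\<^sup>2 * U (t, y)"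
    and jet: "jet U (-1, y) \<rho> a A"
  shows "a 1 1 y = 4 * a 2 0 0"
proof -
  note \<rho> = jetD(1)[OF jet]
  define f where "f k = a k 0 0" for k
  define G where "G \<tau> = (\<Sum>k. diffs f k * \<tau> ^ k)" for \<tau>
  define R where "R \<sigma> = time_coeff a (\<sigma> *\<^sub>R y) 1" for \<sigma>
  have "summable (\<lambda>k. \<bar>f k\<bar> * \<rho> ^ k)" unfolding f_def by (rule jet_summable_center[OF jet])
  from summable_diffs_half[OF \<rho> this]
  have sf: "summable (\<lambda>k. \<bar>diffs f k\<bar> * (\<rho> / 2) ^ k)" .
  have "(\<lambda>k. diffs f k * s ^ k) sums G s" if "\<bar>s\<bar> < \<rho> / 2" for s
    unfolding G_def using summable_abs_powser[OF sf] that by (intro summable_sums) auto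
  then have "(G has_real_derivative (\<Sum>k. diffs (diffs f) k * 0 ^ k)) (at 0)"
    using DERIV_powser[OF _ sf, of 0 UNIV G] \<rho> by auto
  moreover have "(\<Sum>k. diffs (diffs f) k * 0 ^ k) = 2 * a 2 0 0"
    by (subst suminf_finite[of "{0}"]) (auto simp: diffs_def f_def numeral_2_eq_2)
  ultimately have DG: "(G has_real_derivative 2 * a 2 0 0) (at 0)" by simp
  define r where "r = \<rho> / (1 + norm y)"
  have r: "0 < r" "r * norm y \<le> \<rho>"
  proof -
    have "0 < 1 + norm y" by (simp add: add_pos_nonneg)
    then show "0 < r" "r * norm y \<le> \<rho>" using \<rho> by (auto simp: r_def divide_simps)
  qed
  have sr: "summable (\<lambda>n. \<bar>a 1 n y\<bar> * r ^ n)"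
  proof (rule summable_comparison_test[OF _ summable_on_imp_summable[OF jet_summable_degree(1)[OF jet, of 1]]])
    have "\<bar>a 1 n y\<bar> * r ^ n \<le> A 1 n * \<rho> ^ n" for n
    proof -
      have "\<bar>a 1 n y\<bar> * r ^ n \<le> A 1 n * norm y ^ n * r ^ n"
        using jetD(4)[OF jet] r by (intro mult_right_mono) auto
      also have "\<dots> = A 1 n * (r * norm y) ^ n" by (simp add: power_mult_distrib)
      also have "\<dots> \<le> A 1 n * \<rho> ^ n" using r jetD(3)[OF jet] by (intro mult_left_mono power_mono) auto
      finally show ?thesis .
    qed
    then show "\<exists>N. \<forall>n\<ge>N. norm (\<bar>a 1 n y\<bar> * r ^ n) \<le> A 1 n * \<rho> ^ n" using r by (auto simp: abs_mult)
  qed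
  have small: "\<bar>s\<bar> * norm y \<le> \<rho>" if "\<bar>s\<bar> < r" for s
    using mult_right_mono[of "\<bar>s\<bar>" r "norm y"] that r by auto
  have "(R has_real_derivative (\<Sum>n. diffs (\<lambda>n. a 1 n y) n * 0 ^ n)) (at 0)"
    by (rule DERIV_powser[OF r(1) sr, of 0 UNIV]) (use r jet_space_line[OF jet small] in \<open>auto simp: R_def\<close>)
  moreover have "(\<Sum>n. diffs (\<lambda>n. a 1 n y) n * 0 ^ n) = a 1 1 y"
    by (subst suminf_finite[of "{0}"]) (auto simp: diffs_def)
  ultimately have DR: "(R has_real_derivative a 1 1 y) (at 0)" by simp
  have c1: "((\<lambda>\<mu>::real. 1 - \<mu>\<^sup>2) \<longlongrightarrow> 1 - 1\<^sup>2) (at 1)" "((\<lambda>\<mu>::real. 1 / \<mu> - 1) \<longlongrightarrow> 1 / 1 - 1) (at 1)"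
    by (intro tendsto_intros; simp)+
  have "\<forall>\<^sub>F \<mu> :: real in nhds 1. 0 < \<mu> \<and> \<bar>1 - \<mu>\<^sup>2\<bar> < \<rho> \<and> \<bar>1 / \<mu> - 1\<bar> < r"
  proof -
    have "\<forall>\<^sub>F \<mu> :: real in at 1. 0 < \<mu> \<and> \<bar>1 - \<mu>\<^sup>2\<bar> < \<rho> \<and> \<bar>1 / \<mu> - 1\<bar> < r"
      using order_tendstoD(1)[OF tendsto_ident_at, of 0 "1 :: real" UNIV]
        tendstoD[OF c1(1) \<rho>] tendstoD[OF c1(2) r(1)]
      by (simp add: dist_real_def eventually_conj_iff)
    then show ?thesis using \<rho> r by (simp add: eventually_nhds_conv_at)
  qed
  \<comment> \<open>Both sides are the time derivative at \<open>(- (\<mu>\<^sup>2), y)\<close>: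
    \<open>G\<close> moves in time from \<open>-1\<close>, while \<open>R\<close> first rescales the
    point to \<open>(-1, (1 / \<mu>) *\<^sub>R y)\<close>. Differentiating at
    \<open>\<mu> = 1\<close> brings out the inner factors -2 and -1.\<close>
  then have ev: "\<forall>\<^sub>F \<mu> in nhds 1. G (1 - \<mu>\<^sup>2) = R (1 / \<mu> - 1)"
  proof (rule eventually_mono)
    fix \<mu> :: real assume \<mu>: "0 < \<mu> \<and> \<bar>1 - \<mu>\<^sup>2\<bar> < \<rho> \<and> \<bar>1 / \<mu> - 1\<bar> < r"
    have "((\<lambda>s. U (s, y + (1 / \<mu> - 1) *\<^sub>R y)) has_real_derivative R (1 / \<mu> - 1)) (at (-1))"
      unfolding R_def using \<mu> small[of "1 / \<mu> - 1"] by (intro jet_time_deriv_0[OF jet]) auto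
    moreover have "y + (1 / \<mu> - 1) *\<^sub>R y = (1 / \<mu>) *\<^sub>R y" by (simp add: algebra_simps)
    ultimately have "((\<lambda>t. U (t, \<mu> *\<^sub>R (1 / \<mu>) *\<^sub>R y)) has_real_derivative R (1 / \<mu> - 1)) (at (- (\<mu>\<^sup>2)))"
      using \<mu> by (intro self_similar_deriv[OF hom]) auto
    then have "((\<lambda>t. U (t, y)) has_real_derivative R (1 / \<mu> - 1)) (at (- (\<mu>\<^sup>2)))" using \<mu> by simp
    moreover have "((\<lambda>t. U (t, y)) has_real_derivative G (1 - \<mu>\<^sup>2)) (at (- (\<mu>\<^sup>2)))"
      using jet_time_deriv_center[OF jet, of "1 - \<mu>\<^sup>2"] \<mu> by (simp add: G_def f_def[abs_def])
    ultimately show "G (1 - \<mu>\<^sup>2) = R (1 / \<mu> - 1)" using DERIV_unique by blast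
  qed
  have "((\<lambda>\<mu>. G (1 - \<mu>\<^sup>2)) has_real_derivative (2 * a 2 0 0) * (- 2)) (at 1)"
    by (rule DERIV_chain2[where f = G]) (use DG in \<open>auto intro!: derivative_eq_intros\<close>)
  moreover have "((\<lambda>\<mu>. R (1 / \<mu> - 1)) has_real_derivative a 1 1 y * (- 1)) (at 1)"
    by (rule DERIV_chain2[where f = R]) (use DR in \<open>auto intro!: derivative_eq_intros\<close>)
  ultimately have "(2 * a 2 0 0) * (- 2) = a 1 1 y * (- 1)"
    using DERIV_cong_ev[OF refl ev refl] DERIV_unique by blast
  then show ?thesis by simp
qed

text \<open>
  The equation differentiated in time: \<open>2 * a 2 0 0\<close> is \<open>U\<^sub>t\<^sub>t\<close>, and \<open>2 * a 1 2\<close> is the quadratic form of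
  the Hessian of \<open>U\<^sub>t\<close>. As \<open>F\<close> need not be differentiable, only a one-sided bound survives.
\<close>

lemma drift_inequality:
  fixes F :: "real^'n^'n \<Rightarrow> real"
  assumes F: "uniformly_elliptic lam Lam F" "0 < lam"
    and sol: "\<And>t. t < 0 \<Longrightarrow> solves_at F U (t, y)"
    and jet: "jet U (-1, y) \<rho> a A" and ce: "0 \<le> c" "0 \<le> e"
    and le: "\<And>x. 2 * a 1 2 x \<le> c * (norm x)\<^sup>2 - e * (z \<bullet> x)\<^sup>2"
  shows "2 * a 2 0 0 \<le> Lam * real CARD('n) * c - lam * e * (norm z)\<^sup>2"
proof -
  note \<rho> = jetD(1)[OF jet]
  obtain H0 where H0: "symmetric_mat H0" "\<And>x. a 0 2 x = x \<bullet> (H0 *v x)" using jetD(7)[OF jet] by metis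
  have eq0: "a 1 0 0 = F (2 *\<^sub>R H0)" using solves_at_jet[OF sol jet _ H0] by simp
  have sA: "summable (\<lambda>k. A k 2 * \<rho> ^ k)" by (intro summable_on_imp_summable jet_summable_time[OF jet])
  define C where "C = (\<Sum>k. A k 2 * \<rho> ^ k) / \<rho>\<^sup>2"
  have C0: "0 \<le> C" unfolding C_def using \<rho> jetD(3)[OF jet] by (intro divide_nonneg_nonneg suminf_nonneg sA) auto
  have hess: "space_coeff a \<tau> x 2 \<le> a 0 2 x + a 1 2 x * \<tau> + C * \<tau>\<^sup>2 * (norm x)\<^sup>2"
    if \<tau>: "\<bar>\<tau>\<bar> \<le> \<rho>" for \<tau> x
  proof -
    have "\<bar>space_coeff a \<tau> x 2 - (\<Sum>k<2. a k 2 x * \<tau> ^ k)\<bar>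
        \<le> (\<Sum>k. (norm x)\<^sup>2 * A k 2 * \<rho> ^ k) * (\<bar>\<tau>\<bar> / \<rho>)\<^sup>2"
    proof (rule series_tail_bound[OF \<rho> _ \<tau>])
      show "summable (\<lambda>k. (norm x)\<^sup>2 * A k 2 * \<rho> ^ k)"
        using summable_mult[OF sA, of "(norm x)\<^sup>2"] by (simp add: mult.assoc)
      show "\<bar>a k 2 x * \<tau> ^ k\<bar> \<le> (norm x)\<^sup>2 * A k 2 * \<bar>\<tau>\<bar> ^ k" for k
        using mult_right_mono[OF jetD(4)[OF jet, of k 2 x], of "\<bar>\<tau>\<bar> ^ k"]
        by (simp add: abs_mult power_abs mult_ac)
      show "(\<lambda>k. a k 2 x * \<tau> ^ k) sums space_coeff a \<tau> x 2"
        by (intro has_sum_imp_sums jet_space(1)[OF jet \<tau>])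
    qed (use jetD(3)[OF jet] in auto)
    also have "(\<Sum>k. (norm x)\<^sup>2 * A k 2 * \<rho> ^ k) = (norm x)\<^sup>2 * (\<Sum>k. A k 2 * \<rho> ^ k)"
      using suminf_mult[OF sA, of "(norm x)\<^sup>2"] by (simp add: mult.assoc)
    finally have "\<bar>space_coeff a \<tau> x 2 - (a 0 2 x + a 1 2 x * \<tau>)\<bar> \<le> C * \<tau>\<^sup>2 * (norm x)\<^sup>2"
      by (simp add: C_def power_divide mult_ac numeral_2_eq_2)
    then show ?thesis by simp
  qed
  define f where "f k = a k 0 0" for k
  define G where "G \<tau> = (\<Sum>k. diffs f k * \<tau> ^ k)" for \<tau>
  have "summable (\<lambda>k. \<bar>f k\<bar> * \<rho> ^ k)" unfolding f_def by (rule jet_summable_center[OF jet])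
  from summable_diffs_half[OF \<rho> this]
  have sf: "summable (\<lambda>k. \<bar>diffs f k\<bar> * (\<rho> / 2) ^ k)" .
  define M where "M = (\<Sum>k. \<bar>diffs f k\<bar> * (\<rho> / 2) ^ k) / (\<rho> / 2)\<^sup>2"
  have time: "a 1 0 0 + 2 * a 2 0 0 * \<tau> - M * \<tau>\<^sup>2 \<le> G \<tau>" if \<tau>: "\<bar>\<tau>\<bar> \<le> \<rho> / 2" for \<tau>
  proof -
    have "\<bar>G \<tau> - (\<Sum>k<2. diffs f k * \<tau> ^ k)\<bar> \<le> (\<Sum>k. \<bar>diffs f k\<bar> * (\<rho> / 2) ^ k) * (\<bar>\<tau>\<bar> / (\<rho> / 2))\<^sup>2"
      unfolding G_def using \<rho> \<tau> sf summable_sums[OF summable_abs_powser[OF sf \<tau>]]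
      by (intro series_tail_bound) (auto simp: abs_mult power_abs)
    also have "\<dots> = M * \<tau>\<^sup>2"
      by (simp only: M_def power_divide times_divide_eq_right times_divide_eq_left power2_abs)
    also have "(\<Sum>k<2. diffs f k * \<tau> ^ k) = a 1 0 0 + 2 * a 2 0 0 * \<tau>"
      by (simp add: diffs_def f_def numeral_2_eq_2)
    finally show ?thesis by (simp add: abs_le_iff)
  qed
  define L where "L = Lam * real CARD('n)"
  \<comment> \<open>A forward difference from time \<open>-1\<close>: the hypothesis on
    \<open>a 1 2\<close> controls the first-order change of the Hessian,
    \<open>elliptic_upper\<close> turns it into a change of \<open>F\<close>, and the errors of
    order \<open>\<tau>\<^sup>2\<close> disappear after division by \<open>\<tau>\<close>.\<close>
  have "2 * a 2 0 0 - (L * c - lam * e * (norm z)\<^sup>2) \<le> 0"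
  proof (rule le_0_if_le_small)
    show "0 < min (\<rho> / 2) 1" using \<rho> by simp
    fix \<tau> :: real assume h: "0 < \<tau>" "\<tau> < min (\<rho> / 2) 1"
    then have \<tau>: "\<bar>\<tau>\<bar> < \<rho>" "\<bar>\<tau>\<bar> \<le> \<rho>" "\<bar>\<tau>\<bar> \<le> \<rho> / 2" "-1 + \<tau> < 0" using \<rho> by auto
    obtain r1 a1 A1 where j1: "jet U (-1 + \<tau>, y) r1 a1 A1"
      using sol[OF \<tau>(4)] unfolding solves_at_def by blast
    obtain H1 where H1: "symmetric_mat H1" "\<And>x. a1 0 2 x = x \<bullet> (H1 *v x)" using jetD(7)[OF j1] by metis
    have "a1 1 0 0 = F (2 *\<^sub>R H1)" by (rule solves_at_jet[OF sol[OF \<tau>(4)] j1 _ H1]) (use \<tau> in simp)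
    moreover have "a1 1 0 0 = G \<tau>"
      using jet_shift_time_deriv[OF jet j1 \<tau>(1,4)] by (simp add: G_def f_def[abs_def])
    moreover have "F (2 *\<^sub>R H1) \<le> F (2 *\<^sub>R H0) + Lam * real CARD('n) * (\<tau> * c + 2 * C * \<tau>\<^sup>2) - lam * (\<tau> * e) * (norm z)\<^sup>2"
    proof (rule elliptic_upper[OF F symmetric_mat_scale[OF H0(1)] symmetric_mat_scale[OF H1(1)]])
      show "0 \<le> \<tau> * c + 2 * C * \<tau>\<^sup>2" "0 \<le> \<tau> * e" using h C0 ce by auto
      fix x :: "real^'n"
      have "x \<bullet> (H1 *v x) \<le> x \<bullet> (H0 *v x) + a 1 2 x * \<tau> + C * \<tau>\<^sup>2 * (norm x)\<^sup>2"
        using hess[OF \<tau>(2), of x] jet_shift_time[OF jet j1 \<tau>(2), of 2 x] \<tau>(4) H0(2)[of x] H1(2)[of x] by simp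
      moreover have "\<tau> * (2 * a 1 2 x) \<le> \<tau> * (c * (norm x)\<^sup>2 - e * (z \<bullet> x)\<^sup>2)"
        using h le by (intro mult_left_mono) auto
      ultimately show "x \<bullet> ((2 *\<^sub>R H1) *v x) \<le> x \<bullet> ((2 *\<^sub>R H0) *v x) + (\<tau> * c + 2 * C * \<tau>\<^sup>2) * (norm x)\<^sup>2 - \<tau> * e * (z \<bullet> x)\<^sup>2"
        unfolding scaleR_matrix_vector_assoc[symmetric] inner_scaleR_right
        by (simp add: algebra_simps)
    qed
    ultimately have "2 * a 2 0 0 * \<tau> - M * \<tau>\<^sup>2 \<le> L * (\<tau> * c + 2 * C * \<tau>\<^sup>2) - lam * (\<tau> * e) * (norm z)\<^sup>2"
      using time[OF \<tau>(3)] eq0 by (simp add: L_def)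
    then have "\<tau> * (2 * a 2 0 0 - (L * c - lam * e * (norm z)\<^sup>2)) \<le> \<tau> * ((2 * L * C + M) * \<tau>)"
      by (simp add: algebra_simps power2_eq_square)
    then show "2 * a 2 0 0 - (L * c - lam * e * (norm z)\<^sup>2) \<le> (2 * L * C + M) * \<tau>"
      using h(1) by simp
  qed
  then show ?thesis by (simp add: L_def)
qed

section \<open>Maximum conditions along lines\<close>

lemma first_order_max:
  fixes k :: "real \<Rightarrow> real"
  assumes "0 < \<delta>" "(k has_real_derivative D) (at 0)" "\<And>s. 0 < s \<Longrightarrow> s < \<delta> \<Longrightarrow> k s \<le> k 0"
  shows "D \<le> 0"
proof (rule ccontr)
  assume "\<not> D \<le> 0"
  then obtain d where d: "d > 0" "\<And>h. 0 < h \<Longrightarrow> h < d \<Longrightarrow> k 0 < k (0 + h)"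
    using DERIV_pos_inc_right[OF assms(2)] by auto
  define s where "s = min d \<delta> / 2"
  have "0 < s" "s < d" "s < \<delta>" using d(1) assms(1) by (auto simp: s_def min_def)
  then show False using d(2)[of s] assms(3)[of s] by simp
qed

text \<open>The cubic slack is there because \<open>h\<close> will be built from the second-order
  expansion of \<open>W\<close>, not from \<open>W\<close> itself. Subtracting
  \<open>C * s ^ 3\<close> changes neither of the two derivatives at 0 and leaves a true one-sided
  maximum; reflection handles the other side.\<close>

lemma second_order_max:
  fixes h h' :: "real \<Rightarrow> real"
  assumes \<delta>: "0 < \<delta>" and h: "\<And>s. (h has_real_derivative h' s) (at s)"
    and h': "(h' has_real_derivative D) (at 0)"
    and le: "\<And>s. \<bar>s\<bar> < \<delta> \<Longrightarrow> h s \<le> h 0 + C * \<bar>s\<bar> ^ 3"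
  shows "h' 0 = 0" "D \<le> 0"
proof -
  define k where "k s = h s - C * s ^ 3" for s
  have k: "(k has_real_derivative h' s - 3 * C * s\<^sup>2) (at s)" for s
    unfolding k_def by (auto intro!: derivative_eq_intros h)
  have kle: "k s \<le> k 0" if "0 < s" "s < \<delta>" for s
    using le[of s] that by (simp add: k_def)
  have "h' 0 - 3 * C * 0\<^sup>2 \<le> 0" by (rule first_order_max[OF \<delta> k kle])
  moreover have "- h' 0 \<le> 0"
  proof (rule first_order_max[OF \<delta>])
    have "((\<lambda>s. h (- s)) has_real_derivative h' (- 0) * (- 1)) (at 0)"
      by (rule DERIV_chain2[where f = h, OF h]) (auto intro!: derivative_eq_intros)
    then show "((\<lambda>s. h (- s) - C * s ^ 3) has_real_derivative - h' 0) (at 0)"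
      by (auto intro!: derivative_eq_intros)
    show "h (- s) - C * s ^ 3 \<le> h (- 0) - C * 0 ^ 3" if "0 < s" "s < \<delta>" for s
      using le[of "- s"] that by simp
  qed
  ultimately show h0: "h' 0 = 0" by simp
  show "D \<le> 0"
  proof (rule ccontr)
    assume D: "\<not> D \<le> 0"
    have "((\<lambda>s. h' s - 3 * C * s\<^sup>2) has_real_derivative D) (at 0)"
      by (auto intro!: derivative_eq_intros h')
    from DERIV_pos_inc_right[OF this] D
    obtain d where d: "d > 0" "\<And>s. 0 < s \<Longrightarrow> s < d \<Longrightarrow> 0 < h' s - 3 * C * s\<^sup>2"
      using h0 by auto
    define s where "s = min d \<delta> / 2"
    have s: "0 < s" "s < d" "s < \<delta>" using d(1) \<delta> by (auto simp: s_def min_def)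
    obtain x where x: "0 < x" "x < s" "k s - k 0 = (s - 0) * (h' x - 3 * C * x\<^sup>2)"
      using MVT2[of 0 s k "\<lambda>x. h' x - 3 * C * x\<^sup>2"] s(1) k by auto
    have "0 < (s - 0) * (h' x - 3 * C * x\<^sup>2)" using d(2)[of x] x s by (intro mult_pos_pos) auto
    then show False using x(3) kle[of s] s by simp
  qed
qed

lemma jet_line_bounds:
  assumes jet: "jet u (t, y) \<rho> a A"
  shows "\<exists>C \<delta>. 0 < \<delta> \<and> (\<forall>s. \<bar>s\<bar> < \<delta> \<longrightarrow> \<bar>s\<bar> * norm x \<le> \<rho> \<and>
      \<bar>time_coeff a (s *\<^sub>R x) 1 - (a 1 0 0 + a 1 1 x * s + a 1 2 x * s\<^sup>2)\<bar> \<le> C * \<bar>s\<bar> ^ 3)"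
proof -
  note \<rho> = jetD(1)[OF jet]
  define r where "r = \<rho> / (1 + norm x)"
  have r: "0 < r" "r * norm x \<le> \<rho>"
  proof -
    have "0 < 1 + norm x" by (simp add: add_pos_nonneg)
    then show "0 < r" "r * norm x \<le> \<rho>" using \<rho> by (auto simp: r_def divide_simps)
  qed
  have sA: "summable (\<lambda>n. A 1 n * norm x ^ n * r ^ n)"
  proof (rule summable_comparison_test[OF _ summable_on_imp_summable[OF jet_summable_degree(1)[OF jet, of 1]]])
    have "A 1 n * norm x ^ n * r ^ n \<le> A 1 n * \<rho> ^ n" for n
    proof -
      have "A 1 n * norm x ^ n * r ^ n = A 1 n * (r * norm x) ^ n" by (simp add: power_mult_distrib)
      also have "\<dots> \<le> A 1 n * \<rho> ^ n" using r jetD(3)[OF jet] by (intro mult_left_mono power_mono) auto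
      finally show ?thesis .
    qed
    then show "\<exists>N. \<forall>n\<ge>N. norm (A 1 n * norm x ^ n * r ^ n) \<le> A 1 n * \<rho> ^ n"
      using r jetD(3)[OF jet] by auto
  qed
  show ?thesis
  proof (intro exI conjI allI impI)
    show "0 < r" by fact
    fix s assume s: "\<bar>s\<bar> < r"
    show small: "\<bar>s\<bar> * norm x \<le> \<rho>"
      using mult_right_mono[of "\<bar>s\<bar>" r "norm x"] s r by auto
    have "\<bar>time_coeff a (s *\<^sub>R x) 1 - (\<Sum>n<3. a 1 n x * s ^ n)\<bar>
        \<le> (\<Sum>n. A 1 n * norm x ^ n * r ^ n) * (\<bar>s\<bar> / r) ^ 3"
    proof (rule series_tail_bound[OF r(1) _ _ sA _ _ jet_space_line[OF jet small]])
      show "\<bar>a 1 n x * s ^ n\<bar> \<le> A 1 n * norm x ^ n * \<bar>s\<bar> ^ n" for n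
        unfolding abs_mult power_abs by (intro mult_right_mono jetD(4)[OF jet]) auto
    qed (use s jetD(3)[OF jet] in auto)
    also have "(\<Sum>n<3. a 1 n x * s ^ n) = a 1 0 0 + a 1 1 x * s + a 1 2 x * s\<^sup>2"
      using jet_degree_0[OF jet, of 1 x] by (simp add: numeral_3_eq_3 numeral_2_eq_2)
    also have "(\<Sum>n. A 1 n * norm x ^ n * r ^ n) * (\<bar>s\<bar> / r) ^ 3 =
        (\<Sum>n. A 1 n * norm x ^ n * r ^ n) / r ^ 3 * \<bar>s\<bar> ^ 3" by (simp add: power_divide)
    finally show "\<bar>time_coeff a (s *\<^sub>R x) 1 - (a 1 0 0 + a 1 1 x * s + a 1 2 x * s\<^sup>2)\<bar>
        \<le> (\<Sum>n. A 1 n * norm x ^ n * r ^ n) / r ^ 3 * \<bar>s\<bar> ^ 3" .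
  qed
qed

lemma jet_time_coeff_continuous:
  assumes jet: "jet u (t, y) \<rho> a A"
  shows "((\<lambda>x. time_coeff a x 1) \<longlongrightarrow> a 1 0 0) (at 0)"
proof -
  note \<rho> = jetD(1)[OF jet]
  define M where "M = (\<Sum>n. A 1 n * \<rho> ^ n) / \<rho>"
  have bd: "\<bar>time_coeff a x 1 - a 1 0 0\<bar> \<le> M * norm x" if x: "norm x \<le> \<rho>" for x
  proof -
    have "\<bar>time_coeff a x 1 - (\<Sum>n<1. a 1 n x)\<bar> \<le> (\<Sum>n. A 1 n * \<rho> ^ n) * (norm x / \<rho>) ^ 1"
      by (rule series_tail_bound[OF \<rho> _ x summable_on_imp_summable[OF jet_summable_degree(1)[OF jet]] _ _
            has_sum_imp_sums[OF jet_time(1)[OF jet x]]])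
         (use jetD(3,4)[OF jet] in auto)
    then show ?thesis using jet_degree_0[OF jet, of 1 x] by (simp add: M_def)
  qed
  show ?thesis
  proof (rule LIM_zero_cancel, rule Lim_null_comparison)
    show "\<forall>\<^sub>F x in at 0. norm (time_coeff a x 1 - a 1 0 0) \<le> M * norm x"
      unfolding eventually_at using \<rho> bd by (intro exI[of _ \<rho>]) (auto simp: dist_norm)
    show "((\<lambda>x. M * norm x) \<longlongrightarrow> 0) (at (0 :: real^'a))"
      by (auto intro!: tendsto_eq_intros)
  qed
qed

subsection \<open>Liouville argument\<close>

lemma norm_add_scaleR_sq:
  fixes z x :: "'a::real_inner"
  shows "(norm (z + s *\<^sub>R x))\<^sup>2 = (norm z)\<^sup>2 + 2 * (z \<bullet> x) * s + (norm x)\<^sup>2 * s\<^sup>2"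
  unfolding power2_norm_eq_inner
  by (simp add: inner_add_left inner_add_right inner_commute[of x z] power2_eq_square algebra_simps)

text \<open>Here \<open>z\<close> stands for \<open>y - y0\<close>. The first-order condition
  determines \<open>a 1 1\<close>, the second-order condition bounds \<open>a 1 2\<close>,
  \<open>drift_inequality\<close> converts that into a bound for \<open>2 * a 2 0 0\<close>, and
  Euler's relation identifies the latter with half of \<open>a 1 1 y\<close>. Each condition is
  tested in one direction at a time, so maximality along lines is enough.\<close>

lemma max_point_inequality:
  fixes F :: "real^'n^'n \<Rightarrow> real"
  assumes F: "uniformly_elliptic lam Lam F" "0 < lam"
    and hom: "\<And>t y s. t \<le> 0 \<Longrightarrow> 0 < s \<Longrightarrow> U (s\<^sup>2 * t, s *\<^sub>R y) = s\<^sup>2 * U (t, y)"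
    and sol: "\<And>t y. t \<le> 0 \<Longrightarrow> (t, y) \<noteq> (0, 0) \<Longrightarrow> solves_at F U (t, y)"
    and W: "\<And>y. ((\<lambda>s. U (s, y)) has_real_derivative W y) (at (-1))"
    and pos: "0 < \<alpha>" "0 < \<epsilon>" "0 < \<eta>"
    and max: "\<And>x. \<exists>\<delta>>0. \<forall>s. \<bar>s\<bar> < \<delta> \<longrightarrow>
      W (y + s *\<^sub>R x) + \<epsilon> * exp (- \<alpha> * (norm (z + s *\<^sub>R x))\<^sup>2) - \<eta> * (norm (y + s *\<^sub>R x))\<^sup>2
      \<le> W y + \<epsilon> * exp (- \<alpha> * (norm z)\<^sup>2) - \<eta> * (norm y)\<^sup>2"
  defines "b \<equiv> \<epsilon> * exp (- \<alpha> * (norm z)\<^sup>2)"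
  shows "\<alpha> * b * (z \<bullet> y) + \<eta> * (norm y)\<^sup>2
    \<le> Lam * real CARD('n) * (2 * \<alpha> * b + 2 * \<eta>) - lam * (4 * \<alpha>\<^sup>2 * b) * (norm z)\<^sup>2"
proof -
  obtain \<rho> a A where jet: "jet U (-1, y) \<rho> a A" using sol[of "-1" y] unfolding solves_at_def by auto
  have b: "0 < b" using pos by (simp add: b_def)
  have W0: "W y = a 1 0 0" using DERIV_unique[OF W jet_deriv[OF jet]] by simp
  have both: "a 1 1 x = 2 * \<alpha> * b * (z \<bullet> x) + 2 * \<eta> * (y \<bullet> x) \<and>
      2 * a 1 2 x \<le> (2 * \<alpha> * b + 2 * \<eta>) * (norm x)\<^sup>2 - 4 * \<alpha>\<^sup>2 * b * (z \<bullet> x)\<^sup>2" for x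
  proof -
    obtain \<delta>1 where \<delta>1: "\<delta>1 > 0" "\<And>s. \<bar>s\<bar> < \<delta>1 \<Longrightarrow>
      W (y + s *\<^sub>R x) + \<epsilon> * exp (- \<alpha> * (norm (z + s *\<^sub>R x))\<^sup>2) - \<eta> * (norm (y + s *\<^sub>R x))\<^sup>2
      \<le> W y + \<epsilon> * exp (- \<alpha> * (norm z)\<^sup>2) - \<eta> * (norm y)\<^sup>2" using max[of x] by blast
    obtain C \<delta>2 where \<delta>2: "0 < \<delta>2" "\<And>s. \<bar>s\<bar> < \<delta>2 \<Longrightarrow> \<bar>s\<bar> * norm x \<le> \<rho>"
      "\<And>s. \<bar>s\<bar> < \<delta>2 \<Longrightarrow>
        \<bar>time_coeff a (s *\<^sub>R x) 1 - (a 1 0 0 + a 1 1 x * s + a 1 2 x * s\<^sup>2)\<bar> \<le> C * \<bar>s\<bar> ^ 3"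
      using jet_line_bounds[OF jet, of x] by blast
    define E where "E s = exp (- \<alpha> * ((norm z)\<^sup>2 + 2 * (z \<bullet> x) * s + (norm x)\<^sup>2 * s\<^sup>2))" for s
    define E' where "E' s = E s * (- \<alpha> * (2 * (z \<bullet> x) + 2 * (norm x)\<^sup>2 * s))" for s
    have E: "(E has_real_derivative E' s) (at s)" for s
      unfolding E_def E'_def by (auto intro!: derivative_eq_intros simp: algebra_simps)
    define h where "h s = a 1 1 x * s + a 1 2 x * s\<^sup>2 + \<epsilon> * E s
        - \<eta> * ((norm y)\<^sup>2 + 2 * (y \<bullet> x) * s + (norm x)\<^sup>2 * s\<^sup>2)" for s
    define h' where "h' s = a 1 1 x + 2 * a 1 2 x * s + \<epsilon> * E' s
        - \<eta> * (2 * (y \<bullet> x) + 2 * (norm x)\<^sup>2 * s)" for s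
    define D where "D = 2 * a 1 2 x + \<epsilon> * (E' 0 * (- \<alpha> * (2 * (z \<bullet> x))) + E 0 * (- \<alpha> * (2 * (norm x)\<^sup>2)))
        - \<eta> * (2 * (norm x)\<^sup>2)"
    have h: "(h has_real_derivative h' s) (at s)" for s
      unfolding h_def h'_def by (auto intro!: derivative_eq_intros E)
    have E': "(E' has_real_derivative E' 0 * (- \<alpha> * (2 * (z \<bullet> x))) + E 0 * (- \<alpha> * (2 * (norm x)\<^sup>2))) (at 0)"
      unfolding E'_def[abs_def] by (auto intro!: derivative_eq_intros E simp: E'_def)
    have h': "(h' has_real_derivative D) (at 0)"
      unfolding h'_def D_def by (auto intro!: derivative_eq_intros E')
    have le: "h s \<le> h 0 + C * \<bar>s\<bar> ^ 3" if s: "\<bar>s\<bar> < min \<delta>1 \<delta>2" for s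
    proof -
      have sm: "norm (s *\<^sub>R x) \<le> \<rho>" using \<delta>2(2)[of s] s by simp
      have "W (y + s *\<^sub>R x) = time_coeff a (s *\<^sub>R x) 1"
        using DERIV_unique[OF W jet_time_deriv_0[OF jet sm]] by simp
      then have "a 1 0 0 + a 1 1 x * s + a 1 2 x * s\<^sup>2 \<le> W (y + s *\<^sub>R x) + C * \<bar>s\<bar> ^ 3"
        using \<delta>2(3)[of s] s by (simp add: abs_le_iff)
      moreover have "W (y + s *\<^sub>R x) + \<epsilon> * E s - \<eta> * ((norm y)\<^sup>2 + 2 * (y \<bullet> x) * s + (norm x)\<^sup>2 * s\<^sup>2)
          \<le> a 1 0 0 + \<epsilon> * E 0 - \<eta> * (norm y)\<^sup>2"
        using \<delta>1(2)[of s] s unfolding norm_add_scaleR_sq W0 by (simp add: E_def)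
      ultimately show ?thesis by (simp add: h_def)
    qed
    have "h' 0 = 0" "D \<le> 0"
      using second_order_max[of "min \<delta>1 \<delta>2", OF _ h h' le] \<delta>1(1) \<delta>2(1) by auto
    moreover have "\<epsilon> * E 0 = b" by (simp add: E_def b_def)
    moreover have "\<epsilon> * E' 0 = b * (- \<alpha> * (2 * (z \<bullet> x)))" by (simp add: E'_def E_def b_def)
    moreover have "D = 2 * a 1 2 x + (\<epsilon> * E' 0) * (- \<alpha> * (2 * (z \<bullet> x))) + (\<epsilon> * E 0) * (- \<alpha> * (2 * (norm x)\<^sup>2))
        - \<eta> * (2 * (norm x)\<^sup>2)" by (simp add: D_def algebra_simps)
    ultimately show ?thesis by (simp add: h'_def algebra_simps power2_eq_square)
  qed
  have "2 * a 2 0 0 \<le> Lam * real CARD('n) * (2 * \<alpha> * b + 2 * \<eta>) - lam * (4 * \<alpha>\<^sup>2 * b) * (norm z)\<^sup>2"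
  proof (rule drift_inequality[OF F _ jet])
    show "solves_at F U (t, y)" if "t < 0" for t using sol[of t y] that by simp
  qed (use both pos b in auto)
  moreover have "a 1 1 y = 4 * a 2 0 0" by (rule euler_identity[OF hom jet])
  moreover have "a 1 1 y = 2 * \<alpha> * b * (z \<bullet> y) + 2 * \<eta> * (norm y)\<^sup>2"
    using both[of y] by (simp add: power2_norm_eq_inner)
  ultimately show ?thesis by (simp add: algebra_simps)
qed

text \<open>The supremum \<open>m\<close> may fail to be attained, so the argument starts from a
  point where \<open>W\<close> lies below it: comparison outside a small ball around that point
  pushes \<open>W\<close> below \<open>m - \<epsilon>\<close> everywhere, against the definition of
  \<open>m\<close>.\<close>

lemma time_deriv_constant:
  fixes F :: "real^'n^'n \<Rightarrow> real" and U :: "real \<times> (real^'n) \<Rightarrow> real"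
  assumes F: "uniformly_elliptic lam Lam F" "0 < lam" "lam \<le> Lam"
    and hom: "\<And>t y s. t \<le> 0 \<Longrightarrow> 0 < s \<Longrightarrow> U (s\<^sup>2 * t, s *\<^sub>R y) = s\<^sup>2 * U (t, y)"
    and sol: "\<And>t y. t \<le> 0 \<Longrightarrow> (t, y) \<noteq> (0, 0) \<Longrightarrow> solves_at F U (t, y)"
    and W: "\<And>y. ((\<lambda>s. U (s, y)) has_real_derivative W y) (at (-1))"
  shows "W y = Sup (range W)"
proof (rule ccontr)
  define y0 where "y0 = y"
  assume neq: "W y \<noteq> Sup (range W)"
  have jets: "\<exists>\<rho> a A. jet U (t, y) \<rho> a A" if "t \<le> 0" "(t, y) \<noteq> (0, 0)" for t y
    using sol[OF that] unfolding solves_at_def by blast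
  obtain B where B: "\<And>y. \<bar>W y\<bar> \<le> B" using bounded_time_deriv[OF hom jets W] by blast
  define m where "m = Sup (range W)"
  have bdd: "bdd_above (range W)" using B by (intro bdd_aboveI[of _ B]) (auto simp: abs_le_iff)
  have Wm: "W y \<le> m" for y unfolding m_def by (rule cSup_upper[OF _ bdd]) simp
  have Wcont: "isCont W y" for y
  proof -
    obtain \<rho> a A where jet: "jet U (-1, y) \<rho> a A" using jets[of "-1" y] by auto
    have eq: "W (y + x) = time_coeff a x 1" if "norm x \<le> \<rho>" for x
      using DERIV_unique[OF W jet_time_deriv_0[OF jet that]] by simp
    have "W y = a 1 0 0" using DERIV_unique[OF W jet_deriv[OF jet]] by simp
    moreover have "\<forall>\<^sub>F x in at 0. time_coeff a x 1 = W (y + x)"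
      unfolding eventually_at using jetD(1)[OF jet] eq by (intro exI[of _ \<rho>]) (auto simp: dist_norm)
    ultimately show ?thesis
      unfolding isCont_iff using Lim_transform_eventually[OF jet_time_coeff_continuous[OF jet]] by simp
  qed
  \<comment> \<open>Near \<open>y0\<close> continuity costs two quarters of the gap and the barrier
    at most one, so a deficit \<open>\<epsilon>\<close> remains.\<close>
  define \<epsilon> where "\<epsilon> = (m - W y0) / 4"
  have \<epsilon>: "0 < \<epsilon>" using neq Wm[of y] by (simp add: \<epsilon>_def m_def y0_def)
  obtain \<delta>' where \<delta>': "\<delta>' > 0" "\<And>y. dist y y0 < \<delta>' \<Longrightarrow> dist (W y) (W y0) < 2 * \<epsilon>"
    using Wcont[of y0] \<epsilon> unfolding continuous_at by (metis LIM_def dist_self mult_pos_pos zero_less_numeral)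
  define \<delta> where "\<delta> = \<delta>' / 2"
  have \<delta>: "0 < \<delta>" using \<delta>' by (simp add: \<delta>_def)
  have near: "W y \<le> m - 2 * \<epsilon>" if "norm (y - y0) \<le> \<delta>" for y
  proof -
    have "dist (W y) (W y0) < 2 * \<epsilon>" using that \<delta>' by (intro \<delta>'(2)) (auto simp: \<delta>_def dist_norm)
    moreover have "m - W y0 = 4 * \<epsilon>" by (simp add: \<epsilon>_def)
    ultimately show ?thesis unfolding dist_real_def by linarith
  qed
  define L where "L = Lam * real CARD('n)"
  have L: "0 < L" using F by (simp add: L_def)
  \<comment> \<open>Chosen so that the bracket multiplying \<open>\<alpha> * b\<close> in
    \<open>main\<close> is at least 1 for \<open>norm z \<ge> \<delta>\<close>; the term with
    \<open>norm y0\<close> pays for the possibly negative \<open>z \<bullet> y1\<close>.\<close>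
  define \<alpha> where "\<alpha> = (2 * L + (norm y0)\<^sup>2 / 4 + 1) / (4 * lam * \<delta>\<^sup>2)"
  have \<alpha>: "0 < \<alpha>" "4 * lam * \<alpha> * \<delta>\<^sup>2 = 2 * L + (norm y0)\<^sup>2 / 4 + 1"
  proof -
    have "0 < 2 * L + (norm y0)\<^sup>2 / 4 + 1" using L by (simp add: add_pos_nonneg)
    then show "0 < \<alpha>" "4 * lam * \<alpha> * \<delta>\<^sup>2 = 2 * L + (norm y0)\<^sup>2 / 4 + 1"
      using F(2) \<delta> by (auto simp: \<alpha>_def)
  qed
  \<comment> \<open>The drift may fail to dominate only where
    \<open>(norm y1)\<^sup>2 < 2 * L\<close>. There \<open>\<epsilon> * b0\<close> bounds the
    barrier from below, and for \<open>\<eta> < \<eta>0\<close> the loss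
    \<open>2 * L * \<eta>\<close> is smaller than \<open>\<alpha> * \<epsilon> * b0\<close>.\<close>
  define b0 where "b0 = exp (- \<alpha> * (sqrt (2 * L) + norm y0)\<^sup>2)"
  define \<eta>0 where "\<eta>0 = \<alpha> * \<epsilon> * b0 / (2 * L)"
  have \<eta>0: "0 < \<eta>0" using \<alpha> \<epsilon> L by (simp add: \<eta>0_def b0_def)
  define V where "V \<eta> y = W y + \<epsilon> * exp (- \<alpha> * (norm (y - y0))\<^sup>2) - \<eta> * (norm y)\<^sup>2" for \<eta> y
  have exp_le: "\<epsilon> * exp (- \<alpha> * (norm (y - y0))\<^sup>2) \<le> \<epsilon>" for y
    using \<epsilon> \<alpha> by simp
  have far: "V \<eta> y \<le> m - \<epsilon>" if \<eta>: "0 < \<eta>" "\<eta> < \<eta>0" and y: "\<delta> \<le> norm (y - y0)" for \<eta> y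
  proof (rule ccontr)
    assume gt: "\<not> V \<eta> y \<le> m - \<epsilon>"
    \<comment> \<open>The first entry puts \<open>y\<close> into the compact set \<open>S\<close>;
      beyond the second, the penalty outweighs the bound \<open>B\<close> and forces
      \<open>V \<eta> \<le> m - \<epsilon>\<close>.\<close>
    define R where "R = max (norm y) (sqrt (\<bar>B + 2 * \<epsilon> - m\<bar> / \<eta>))"
    have out: "V \<eta> x \<le> m - \<epsilon>" if "R < norm x" for x
    proof -
      have "sqrt (\<bar>B + 2 * \<epsilon> - m\<bar> / \<eta>) < norm x" using that by (simp add: R_def)
      then have "(sqrt (\<bar>B + 2 * \<epsilon> - m\<bar> / \<eta>))\<^sup>2 \<le> (norm x)\<^sup>2" using \<eta> by (intro power_mono) auto
      then have "\<bar>B + 2 * \<epsilon> - m\<bar> \<le> \<eta> * (norm x)\<^sup>2" using \<eta> by (simp add: pos_divide_le_eq mult.commute)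
      moreover have "W x \<le> B" using B[of x] by (simp add: abs_le_iff)
      ultimately show ?thesis unfolding V_def using exp_le[of x] by linarith
    qed
    define S where "S = cball 0 R \<inter> {x. \<delta> \<le> norm (x - y0)}"
    have "compact S"
      unfolding S_def by (intro compact_Int_closed closed_Collect_le continuous_intros) auto
    moreover have "y \<in> S" using y by (simp add: S_def R_def)
    moreover have "continuous_on S (V \<eta>)"
      unfolding V_def
      by (intro continuous_intros continuous_at_imp_continuous_on ballI Wcont)
    ultimately obtain y1 where y1: "y1 \<in> S" "\<And>x. x \<in> S \<Longrightarrow> V \<eta> x \<le> V \<eta> y1"
      using continuous_attains_sup[of S "V \<eta>"] by blast
    have big: "m - \<epsilon> < V \<eta> y1" using gt y1(2)[OF \<open>y \<in> S\<close>] by simp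
    have glob: "V \<eta> x \<le> V \<eta> y1" if "\<delta> \<le> norm (x - y0)" for x
      using y1(2)[of x] out[of x] big that by (cases "norm x \<le> R") (auto simp: S_def)
    define z where "z = y1 - y0"
    \<comment> \<open>On the inner sphere \<open>near\<close> already gives
      \<open>V \<eta> \<le> m - \<epsilon>\<close>, so the maximum lies strictly outside the ball
      and is a local maximum in every direction.\<close>
    have "norm z \<noteq> \<delta>"
    proof
      assume "norm z = \<delta>"
      then have "W y1 \<le> m - 2 * \<epsilon>" by (intro near) (simp add: z_def)
      moreover have "0 \<le> \<eta> * (norm y1)\<^sup>2" using \<eta> by simp
      ultimately have "V \<eta> y1 \<le> m - \<epsilon>" unfolding V_def using exp_le[of y1] by linarith
      then show False using big by simp
    qed
    then have z\<delta>: "\<delta> < norm z" using y1(1) by (simp add: S_def z_def)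
    define b where "b = \<epsilon> * exp (- \<alpha> * (norm z)\<^sup>2)"
    have b: "0 < b" using \<epsilon> by (simp add: b_def)
    have "\<alpha> * b * (z \<bullet> y1) + \<eta> * (norm y1)\<^sup>2
        \<le> Lam * real CARD('n) * (2 * \<alpha> * b + 2 * \<eta>) - lam * (4 * \<alpha>\<^sup>2 * b) * (norm z)\<^sup>2"
      unfolding b_def
    proof (rule max_point_inequality[OF F(1,2) hom sol W \<alpha>(1) \<epsilon> \<eta>(1)])
      fix x :: "real^'n"
      show "\<exists>d>0. \<forall>s. \<bar>s\<bar> < d \<longrightarrow>
        W (y1 + s *\<^sub>R x) + \<epsilon> * exp (- \<alpha> * (norm (z + s *\<^sub>R x))\<^sup>2) - \<eta> * (norm (y1 + s *\<^sub>R x))\<^sup>2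
        \<le> W y1 + \<epsilon> * exp (- \<alpha> * (norm z)\<^sup>2) - \<eta> * (norm y1)\<^sup>2"
      proof (intro exI conjI allI impI)
        have pos: "0 < norm z - \<delta>" using z\<delta> by simp
        show "0 < (norm z - \<delta>) / (1 + norm x)" by (rule small_scale[OF pos])
        fix s :: real assume s: "\<bar>s\<bar> < (norm z - \<delta>) / (1 + norm x)"
        have "\<bar>s\<bar> * norm x < norm z - \<delta>"
          using small_scale(2)[OF pos, of "\<bar>s\<bar>" x] s pos by (cases "s = 0") auto
        then have "\<delta> \<le> norm (z + s *\<^sub>R x)" using norm_diff_ineq[of z "s *\<^sub>R x"] by simp
        then have "V \<eta> (y1 + s *\<^sub>R x) \<le> V \<eta> y1" by (intro glob) (simp add: z_def algebra_simps)
        moreover have "y1 + s *\<^sub>R x - y0 = z + s *\<^sub>R x" by (simp add: z_def)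
        ultimately show "W (y1 + s *\<^sub>R x) + \<epsilon> * exp (- \<alpha> * (norm (z + s *\<^sub>R x))\<^sup>2) - \<eta> * (norm (y1 + s *\<^sub>R x))\<^sup>2
          \<le> W y1 + \<epsilon> * exp (- \<alpha> * (norm z)\<^sup>2) - \<eta> * (norm y1)\<^sup>2"
          by (simp add: V_def z_def)
      qed
    qed
    then have main: "\<alpha> * b * (z \<bullet> y1 - 2 * L + 4 * lam * \<alpha> * (norm z)\<^sup>2) + \<eta> * ((norm y1)\<^sup>2 - 2 * L) \<le> 0"
      by (simp add: L_def algebra_simps power2_eq_square)
    \<comment> \<open>Completing the square in \<open>z \<bullet> (z + y0)\<close>.\<close>
    have "0 \<le> (norm (z + (1 / 2) *\<^sub>R y0))\<^sup>2" by simp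
    then have "- ((norm y0)\<^sup>2 / 4) \<le> z \<bullet> (z + y0)"
      unfolding norm_add_scaleR_sq by (simp add: inner_add_right power2_norm_eq_inner field_simps)
    then have 1: "- ((norm y0)\<^sup>2 / 4) \<le> z \<bullet> y1" by (simp add: z_def)
    have "4 * lam * \<alpha> * \<delta>\<^sup>2 \<le> 4 * lam * \<alpha> * (norm z)\<^sup>2"
      using z\<delta> \<delta> \<alpha>(1) F(2) by (intro mult_left_mono power_mono) auto
    then have "1 \<le> z \<bullet> y1 - 2 * L + 4 * lam * \<alpha> * (norm z)\<^sup>2" using 1 \<alpha>(2) by linarith
    then have "\<alpha> * b * 1 \<le> \<alpha> * b * (z \<bullet> y1 - 2 * L + 4 * lam * \<alpha> * (norm z)\<^sup>2)"
      using \<alpha> b by (intro mult_left_mono) auto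
    then have key: "\<alpha> * b + \<eta> * ((norm y1)\<^sup>2 - 2 * L) \<le> 0" using main by simp
    show False
    proof (cases "2 * L \<le> (norm y1)\<^sup>2")
      case True
      then have "0 \<le> \<eta> * ((norm y1)\<^sup>2 - 2 * L)" using \<eta> by simp
      moreover have "0 < \<alpha> * b" using \<alpha> b by simp
      ultimately show False using key by linarith
    next
      case False
      then have "norm y1 \<le> sqrt (2 * L)" using real_le_rsqrt by simp
      then have "norm z \<le> sqrt (2 * L) + norm y0"
        using norm_triangle_ineq4[of y1 y0] by (simp add: z_def)
      then have "(norm z)\<^sup>2 \<le> (sqrt (2 * L) + norm y0)\<^sup>2" by (intro power_mono) auto
      then have "b0 \<le> exp (- \<alpha> * (norm z)\<^sup>2)" using \<alpha> by (simp add: b0_def)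
      then have "\<alpha> * \<epsilon> * b0 \<le> \<alpha> * b" using \<alpha> \<epsilon> by (simp add: b_def)
      moreover have "\<eta> * (2 * L) < \<alpha> * \<epsilon> * b0" using \<eta>(2) L by (simp add: \<eta>0_def pos_less_divide_eq)
      moreover have "0 \<le> \<eta> * (norm y1)\<^sup>2" using \<eta> by simp
      ultimately show False using key by (simp add: algebra_simps)
    qed
  qed
  have "W y \<le> m - \<epsilon>" for y
  proof (cases "norm (y - y0) \<le> \<delta>")
    case True
    then show ?thesis using near[of y] \<epsilon> by simp
  next
    case False
    \<comment> \<open>The positive barrier is dropped and \<open>\<eta>\<close> tends to 0 with
      \<open>y\<close> fixed.\<close>
    have "W y - (m - \<epsilon>) \<le> 0"
    proof (rule le_0_if_le_small[OF \<eta>0])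
      fix \<eta> assume "0 < \<eta>" "\<eta> < \<eta>0"
      from far[OF this, of y] False have "V \<eta> y \<le> m - \<epsilon>" by simp
      moreover have "0 \<le> \<epsilon> * exp (- \<alpha> * (norm (y - y0))\<^sup>2)" using \<epsilon> by simp
      ultimately show "W y - (m - \<epsilon>) \<le> (norm y)\<^sup>2 * \<eta>" by (simp add: V_def mult.commute)
    qed
    then show ?thesis by simp
  qed
  then have "m \<le> m - \<epsilon>" unfolding m_def by (intro cSup_least) auto
  then show False using \<epsilon> by simp
qed


section \<open>Quadratic terminal data and the contradiction\<close>

lemma C2_on_quadratic:
  fixes H :: "real^'n^'n"
  assumes H: "symmetric_mat H" and f: "\<And>x. x \<in> ball 0 r \<Longrightarrow> f x = x \<bullet> (H *v x)"
  shows "C2_on (ball 0 r) f"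
proof -
  let ?q = "\<lambda>(t :: real, x :: real^'n). 0 + 0 * (t - 0) + 0 * (t - 0)\<^sup>2 + 0 \<bullet> (x - 0) + (x - 0) \<bullet> (H *v (x - 0))"
  obtain g where q: "continuous_on UNIV ?q" and g: "\<And>i. continuous_on UNIV (g i)"
    and dq: "\<And>t x i. ((\<lambda>s. ?q (t, x + s *\<^sub>R axis i 1)) has_real_derivative g i (t, x)) (at 0)"
    and dg: "\<And>t x i j. ((\<lambda>s. g i (t, x + s *\<^sub>R axis j 1)) has_real_derivative (2 *\<^sub>R H) $ i $ j) (at 0)"
    using C12_quadratic[OF H, of 0 0 0 0 0 0] unfolding C12_test_def by blast
  have pair: "continuous_on S (\<lambda>x :: real^'n. (0 :: real, x))" for S by (intro continuous_intros)
  show ?thesis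
    unfolding C2_on_def
  proof (intro exI conjI allI ballI)
    have "continuous_on (ball 0 r) (\<lambda>x. ?q (0, x))"
      by (rule continuous_on_compose2[OF q pair]) simp
    then show "continuous_on (ball 0 r) f"
      by (rule continuous_on_eq) (simp add: f)
    show "continuous_on (ball 0 r) (\<lambda>x. g i (0, x))" for i
      by (rule continuous_on_compose2[OF g pair]) simp
    show "continuous_on (ball 0 r) (\<lambda>x. (2 *\<^sub>R H) $ i $ j)" for i j by simp
    fix x :: "real^'n" and i j assume x: "x \<in> ball 0 r"
    show "((\<lambda>s. f (x + s *\<^sub>R axis i 1)) has_real_derivative g i (0, x)) (at 0)"
    proof (rule has_field_derivative_transform_within_open[OF dq[of 0 x i]])
      show "open ((\<lambda>s. x + s *\<^sub>R axis i 1) -` ball 0 r)"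
        by (intro open_vimage continuous_intros) auto
      show "0 \<in> (\<lambda>s. x + s *\<^sub>R axis i 1) -` ball 0 r" using x by simp
    qed (simp add: f)
    show "((\<lambda>s. g i (0, x + s *\<^sub>R axis j 1)) has_real_derivative (2 *\<^sub>R H) $ i $ j) (at 0)"
      by (rule dg)
  qed
qed

theorem theorem1p3:
  fixes F :: "real^'n^'n \<Rightarrow> real" and lam Lam :: real
  assumes "0 < lam" and "lam \<le> Lam" and "uniformly_elliptic lam Lam F"
  shows "\<not> (\<exists>u :: real \<times> (real^'n) \<Rightarrow> real.
     continuous_on Q1 u \<and>
     viscosity_solution F Q1 u \<and>
     (\<forall>p\<in>Q1 - {(0, 0)}. \<exists>U g. open U \<and> p \<in> U \<and> real_analytic_on g U \<and>
        (\<forall>q\<in>U \<inter> Q1. u q = g q)) \<and>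
     (\<forall>a>0. \<forall>x. x \<in> ball 0 1 \<and> a *\<^sub>R x \<in> ball 0 1 \<longrightarrow> u (0, a *\<^sub>R x) = a ^ 2 * u (0, x)) \<and>
     \<not> (\<exists>r>0. C2_on (ball 0 r) (\<lambda>x. u (0, x))))"
proof (rule notI, elim exE conjE)
  fix u :: "real \<times> (real^'n) \<Rightarrow> real"
  assume cont: "continuous_on Q1 u" and visc: "viscosity_solution F Q1 u"
    and ana: "\<forall>p\<in>Q1 - {(0, 0)}. \<exists>U g. open U \<and> p \<in> U \<and> real_analytic_on g U \<and> (\<forall>q\<in>U \<inter> Q1. u q = g q)"
    and hom0: "\<forall>a>0. \<forall>x. x \<in> ball 0 1 \<and> a *\<^sub>R x \<in> ball 0 1 \<longrightarrow> u (0, a *\<^sub>R x) = a ^ 2 * u (0, x)"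
    and notC2: "\<not> (\<exists>r>0. C2_on (ball 0 r) (\<lambda>x. u (0, x)))"
  have sol: "solves_at F u p" if p: "p \<in> Q1 - {(0, 0)}" for p
  proof -
    obtain t y where ty: "p = (t, y)" by (cases p)
    have Q: "(t, y) \<in> Q1" using p ty by simp
    from bspec[OF ana p] obtain U g where Ug: "open U" "(t, y) \<in> U" "real_analytic_on g U"
      and eq: "\<forall>q\<in>U \<inter> Q1. u q = g q"
      unfolding ty by (elim exE conjE)
    have "\<exists>\<rho> a A. jet u (t, y) \<rho> a A"
      by (rule analytic_imp_jet[OF Q Ug]) (use eq in blast)
    then obtain \<rho> a A where j: "jet u (t, y) \<rho> a A" by (elim exE)
    have "a 1 0 0 = F (2 *\<^sub>R H)" if "symmetric_mat H" "\<forall>x. a 0 2 x = x \<bullet> (H *v x)" for H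
      by (rule viscosity_imp_equation[OF assms(3,1) visc Q j that(1)]) (use that(2) in simp)
    then show ?thesis unfolding solves_at_def ty using j by blast
  qed
  have hom: "u (s\<^sup>2 * t, s *\<^sub>R y) = s\<^sup>2 * u (t, y)" if "(t, y) \<in> Q1" "0 < s" "s \<le> 1" for t y s
    by (rule solution_parabolic_homogeneous[OF assms(3,1) cont sol _ that]) (use hom0 in auto)
  obtain U where U: "\<And>p. p \<in> Q1 \<Longrightarrow> U p = u p"
    and Uhom: "\<And>t y s. t \<le> 0 \<Longrightarrow> 0 < s \<Longrightarrow> U (s\<^sup>2 * t, s *\<^sub>R y) = s\<^sup>2 * U (t, y)"
    and Usol: "\<And>t y. t \<le> 0 \<Longrightarrow> (t, y) \<noteq> (0, 0) \<Longrightarrow> solves_at F U (t, y)"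
    using homogeneous_extension[OF sol hom] by blast
  have "\<exists>D. ((\<lambda>s. U (s, y)) has_real_derivative D) (at (-1))" for y
  proof -
    obtain \<rho> a A where "jet U (-1, y) \<rho> a A" using Usol[of "-1" y] unfolding solves_at_def by auto
    then show ?thesis using jet_deriv by fastforce
  qed
  then obtain W where W: "\<And>y. ((\<lambda>s. U (s, y)) has_real_derivative W y) (at (-1))" by metis
  define c where "c = Sup (range W)"
  have Wc: "W y = c" for y
    unfolding c_def by (rule time_deriv_constant[OF assms(3,1,2) Uhom Usol W])
  have Uderiv: "((\<lambda>s. U (s, y)) has_real_derivative c) (at t)" if "t < 0" for t y
  proof -
    \<comment> \<open>The parabola through \<open>(t, y)\<close> passes through
      \<open>(-1, (1 / s) *\<^sub>R y)\<close>.\<close>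
    define s where "s = sqrt (- t)"
    have s: "0 < s" "s\<^sup>2 = - t" using that by (auto simp: s_def)
    from self_similar_deriv[OF Uhom W s(1), of "(1 / s) *\<^sub>R y"] show ?thesis using s by (simp add: Wc)
  qed
  \<comment> \<open>This carries the terminal profile to a time at which \<open>u\<close> has a jet
    at \<open>x = 0\<close>. The mean value theorem is used because at the origin itself only
    continuity up to time 0 is available.\<close>
  have lin: "u (0, x) = u (- 1 / 2, x) + c / 2" if x: "norm x < 1" for x
  proof -
    have deriv: "((\<lambda>s. u (s, x)) has_real_derivative c) (at z)" if z: "- 1 / 2 < z" "z < 0" for z
      by (rule has_field_derivative_transform_within_open[OF Uderiv[OF z(2)], where S = "{-1<..<0}"])
         (use z x in \<open>auto intro!: U simp: Q1_iff\<close>)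
    have "\<exists>l z. - 1 / 2 < z \<and> z < 0 \<and> ((\<lambda>s. u (s, x)) has_real_derivative l) (at z) \<and>
        u (0, x) - u (- 1 / 2, x) = (0 - - 1 / 2) * l"
    proof (rule MVT)
      show "continuous_on {- 1 / 2..0} (\<lambda>s. u (s, x))"
        by (rule continuous_on_compose2[OF cont]) (use x in \<open>auto intro!: continuous_intros simp: Q1_iff\<close>)
      show "(\<lambda>s. u (s, x)) differentiable (at z)" if z: "- 1 / 2 < z" "z < 0" for z
        using deriv[OF z] real_differentiable_def by blast
    qed simp
    then obtain l z where z: "- 1 / 2 < z" "z < 0" "((\<lambda>s. u (s, x)) has_real_derivative l) (at z)"
      "u (0, x) - u (- 1 / 2, x) = (0 - - 1 / 2) * l" by blast
    from DERIV_unique[OF z(3) deriv[OF z(1,2)]] z(4) show ?thesis by simp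
  qed
  obtain \<rho> a A where jet: "jet u (- 1 / 2, 0) \<rho> a A"
    using sol[of "(- 1 / 2, 0)"] unfolding solves_at_def by (auto simp: Q1_iff)
  obtain H where H: "symmetric_mat H" "\<And>x. a 0 2 x = x \<bullet> (H *v x)" using jetD(7)[OF jet] by metis
  have quad: "u (0, x) = x \<bullet> (H *v x)" if x: "x \<in> ball 0 1" for x
  proof -
    \<comment> \<open>The coefficients of \<open>s\<^sup>2 * u (0, x) - c / 2\<close>, which is
      \<open>u\<close> at time \<open>- 1 / 2\<close> along the ray through \<open>x\<close>. Its
      coefficient of degree two is at once \<open>u (0, x)\<close> and the quadratic form
      \<open>a 0 2 x\<close>.\<close>
    define g where "g n = (if n = 0 then - c / 2 else if n = 2 then u (0, x) else 0)" for n :: nat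
    have "a 0 2 x = g 2"
    proof (rule powser_unique_right[where \<delta> = "min \<rho> 1 / (1 + norm x)" and f = "\<lambda>n. a 0 n x" and g = g
          and v = "\<lambda>s. s\<^sup>2 * u (0, x) - c / 2"])
      have pos: "0 < min \<rho> 1" using jetD(1)[OF jet] by simp
      show "0 < min \<rho> 1 / (1 + norm x)" by (rule small_scale[OF pos])
      fix s assume s: "0 < s" "s < min \<rho> 1 / (1 + norm x)"
      have sx: "\<bar>s\<bar> * norm x < \<rho>" "norm (s *\<^sub>R x) < 1" using small_scale(2)[OF pos s] by auto
      have "u (0, s *\<^sub>R x) = s\<^sup>2 * u (0, x)" using hom0 s(1) x sx(2) by auto
      then have "u (- 1 / 2, s *\<^sub>R x) = s\<^sup>2 * u (0, x) - c / 2" using lin[OF sx(2)] by simp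
      then show "(\<lambda>n. a 0 n x * s ^ n) sums (s\<^sup>2 * u (0, x) - c / 2)"
        using jet_space(2)[OF jet, of 0 s x] sx(1) jetD(1)[OF jet] by (simp add: space_coeff_0)
      have "(\<lambda>n. g n * s ^ n) sums (\<Sum>n\<in>{0, 2}. g n * s ^ n)"
        by (rule sums_finite) (auto simp: g_def)
      then show "(\<lambda>n. g n * s ^ n) sums (s\<^sup>2 * u (0, x) - c / 2)" by (simp add: g_def mult.commute)
    qed
    then show ?thesis using H(2)[of x] by (simp add: g_def)
  qed
  have "C2_on (ball 0 1) (\<lambda>x. u (0, x))" by (rule C2_on_quadratic[OF H(1) quad])
  then show False using notC2 zero_less_one by blast
qed

end
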